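(* Let $H$ be a cocommutative graded connected Hopf algebra over a field of characteristic zero that is a free associative algebra with word basis $\mathcal{B}$, with a fixed total order on the generators such that $\deg(c)<\deg(c')$ implies $c<c'$. Define $g_b$ for $b\in\mathcal{B}$ by: $g_c:=e(c)$ for a generator $c$; for a Lyndon word $b$ of length at least $2$ with standard factorization $b=b_1b_2$, inductively $g_b:=[g_{b_1},g_{b_2}]=g_{b_1}g_{b_2}-g_{b_2}g_{b_1}$; and for $b$ with Lyndon factorization $b=b_1\cdots b_k$, $g_b:=\sum_{\sigma\in S_k}g_{b_{\sigma(1)}}g_{b_{\sigma(2)}}\cdots g_{b_{\sigma(k)}}$. Then for every positive integer $a$, $g_b$ is an eigenvector of $\Psi^a$ of eigenvalue $a^k$, where $k$ is the number of Lyndon factors of $b$, and it satisfies $$g_b=\sum_{b'\in\mathcal{B},\ b\to b'}g_b(b')\,b'=\mathrm{sym}(b)+\sum_{b'\in\mathcal{B},\ l(b')>l(b)}g_b(b')\,b'.$$ Hence $\{g_b:b\in\mathcal{B}_n\}$ is a basis of $H_n$ consisting of eigenvectors of $\Psi^a$, and the multiplicity of the eigenvalue $a^k$ on $H_n$ is the coefficient of $x^ny^k$ in $\prod_{i\ge1}(1-yx^i)^{-d_i}$, where $d_i$ is the number of Lyndon words of degree $i$ in the alphabet of generators.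
   Context: Graded connected Hopf algebra: $H=\bigoplus_{n\ge0}H_n$, $H_0$ the ground field, each $H_n$ finite-dimensional, structure maps respecting the grading, counit zero on positive degrees. $m^{[a]}$, $\Delta^{[a]}$ are the $a$-fold product and coproduct ($\Delta^{[a]}=(\mathrm{id}^{\otimes(a-2)}\otimes\Delta)\Delta^{[a-1]}$), $\Psi^a=m^{[a]}\Delta^{[a]}$. "Free associative algebra with word basis $\mathcal{B}$": as an algebra $H=k\langle c_1,c_2,\dots\rangle$ is free on homogeneous generators $c_i$ of positive degree, and $\mathcal{B}$ is the set of words in them; the degree of a word is the sum of the degrees of its letters; $\mathcal{B}_n$ is the set of words of degree $n$; the length $l(b)$ is the number of letters of $b$. $b\to b'$ means $b'$ has nonzero coefficient in $\Psi^a(b)$ for some positive integer $a$; $g(b')$ is the coefficient of $b'$ in $g\in H$. Eulerian idempotent: $\bar\Delta(x)=\Delta(x)-1\otimes x-x\otimes1$, $\bar\Delta^{[1]}=\mathrm{id}$, $\bar\Delta^{[a]}=(\mathrm{id}^{\otimes(a-2)}\otimes\bar\Delta)\bar\Delta^{[a-1]}$, $e(x)=\sum_{a\ge1}\frac{(-1)^{a-1}}{a}m^{[a]}\bar\Delta^{[a]}(x)$ for $x$ of positive degree. Words in the generators are ordered lexicographically (a proper prefix is smaller). A Lyndon word is a nonempty word strictly smaller than each of its nontrivial cyclic rotations. Every word $b$ has a unique Lyndon factorization $b=b_1\cdots b_k$ with each $b_i$ Lyndon and $b_1\ge b_2\ge\cdots\ge b_k$. A Lyndon word $l$ of length $\ge2$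 has standard factorization $l=l_1l_2$, where $l_2$ is the longest proper suffix of $l$ that is Lyndon (then $l_1$ is Lyndon too). The standard bracketing $\lambda(l)\in H$ of a Lyndon word is $\lambda(c)=c$ for a letter and $\lambda(l)=[\lambda(l_1),\lambda(l_2)]$ for standard factorization $l=l_1l_2$. For $b$ with Lyndon factorization $b_1\cdots b_k$, $\mathrm{sym}(b)=\sum_{\sigma\in S_k}\lambda(b_{\sigma(1)})\cdots\lambda(b_{\sigma(k)})$.
   Formalization: The first equality is proved for b' reachable from b by a chain of arrows, and with b→b' itself only when the coproduct has nonnegative structure constants (it can fail otherwise); the multiplicity as eigenspace dimension is for a≥2, for a=1 only the count of the g_b is given. *)

theory Defs
  imports
    "HOL-Analysis.Infinite_Products"
    "HOL-Computational_Algebra.Formal_Power_Series"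
    "HOL-Combinatorics.Permutations"
    "HOL-Library.Poly_Mapping"
    "HOL-Library.Product_Plus"
    "HOL-Library.List_Lexorder"
begin

section \<open>Linear algebra with a distinguished basis\<close>

text \<open>
  Over a type \<open>'b\<close> of basis elements, \<open>'b \<Rightarrow>\<^sub>0 'k\<close> is the vector space with basis \<open>'b\<close>.
\<close>

definition scale_pm :: "'k::field \<Rightarrow> ('b \<Rightarrow>\<^sub>0 'k) \<Rightarrow> ('b \<Rightarrow>\<^sub>0 'k)" where
  "scale_pm a x = Poly_Mapping.map ((*) a) x"

lemma lookup_scale_pm [simp]: "Poly_Mapping.lookup (scale_pm a x) b = a * Poly_Mapping.lookup x b"
  unfolding scale_pm_def by transfer (auto simp: when_def)

global_interpretation pmv: vector_space "scale_pm :: 'k::field \<Rightarrow> ('b \<Rightarrow>\<^sub>0 'k) \<Rightarrow> ('b \<Rightarrow>\<^sub>0 'k)"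
  by unfold_locales (auto intro!: poly_mapping_eqI simp: lookup_add algebra_simps)

definition basis :: "'b \<Rightarrow> ('b \<Rightarrow>\<^sub>0 'k::field)" where
  "basis b = Poly_Mapping.single b 1"

text \<open>The linear map with prescribed values on the basis:\<close>

definition lin_ext :: "('b \<Rightarrow> ('d \<Rightarrow>\<^sub>0 'k::field)) \<Rightarrow> ('b \<Rightarrow>\<^sub>0 'k) \<Rightarrow> ('d \<Rightarrow>\<^sub>0 'k)" where
  "lin_ext f x = (\<Sum>b\<in>Poly_Mapping.keys x. scale_pm (Poly_Mapping.lookup x b) (f b))"

text \<open>The tensor product of the spaces with bases \<open>'b\<close> and \<open>'d\<close> is the space with basis \<open>'b \<times> 'd\<close>.\<close>

definition tensor :: "('b \<Rightarrow>\<^sub>0 'k::field) \<Rightarrow> ('d \<Rightarrow>\<^sub>0 'k) \<Rightarrow> ('b \<times> 'd \<Rightarrow>\<^sub>0 'k)" where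
  "tensor x y = lin_ext (\<lambda>u. lin_ext (\<lambda>v. basis (u, v)) y) x"

definition tensor_map :: "(('b \<Rightarrow>\<^sub>0 'k::field) \<Rightarrow> ('b' \<Rightarrow>\<^sub>0 'k)) \<Rightarrow> (('d \<Rightarrow>\<^sub>0 'k) \<Rightarrow> ('d' \<Rightarrow>\<^sub>0 'k))
    \<Rightarrow> ('b \<times> 'd \<Rightarrow>\<^sub>0 'k) \<Rightarrow> ('b' \<times> 'd' \<Rightarrow>\<^sub>0 'k)" where
  "tensor_map f g = lin_ext (\<lambda>(u, v). tensor (f (basis u)) (g (basis v)))"

definition tensor_assoc :: "(('b \<times> 'd) \<times> 'f \<Rightarrow>\<^sub>0 'k::field) \<Rightarrow> ('b \<times> 'd \<times> 'f \<Rightarrow>\<^sub>0 'k)" where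
  "tensor_assoc = lin_ext (\<lambda>((u, v), w). basis (u, v, w))"

definition tensor_swap :: "('b \<times> 'd \<Rightarrow>\<^sub>0 'k::field) \<Rightarrow> ('d \<times> 'b \<Rightarrow>\<^sub>0 'k)" where
  "tensor_swap = lin_ext (\<lambda>(u, v). basis (v, u))"

definition eigenvector :: "(('b \<Rightarrow>\<^sub>0 'k::field) \<Rightarrow> ('b \<Rightarrow>\<^sub>0 'k)) \<Rightarrow> 'k \<Rightarrow> ('b \<Rightarrow>\<^sub>0 'k) \<Rightarrow> bool" where
  "eigenvector f a x \<longleftrightarrow> x \<noteq> 0 \<and> f x = scale_pm a x"

section \<open>Free associative algebras\<close>

text \<open>
  Words form a monoid under concatenation. The convolution product of \<open>HOL-Library.Poly_Mapping\<close>
  then makes \<open>'c list \<Rightarrow>\<^sub>0 'k\<close> the free associative algebra on the alphabet \<open>'c\<close>, and makes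
  \<open>'c list \<times> 'c list \<Rightarrow>\<^sub>0 'k\<close> its tensor square, with
  \<open>(x \<otimes> y) (x' \<otimes> y') = x x' \<otimes> y y'\<close>.
\<close>

instantiation list :: (type) monoid_add
begin
definition zero_list :: "'a list" where "zero_list = []"
definition plus_list :: "'a list \<Rightarrow> 'a list \<Rightarrow> 'a list" where "plus_list u v = u @ v"
instance by standard (simp_all add: zero_list_def plus_list_def)
end

type_synonym ('c, 'k) free_alg = "'c list \<Rightarrow>\<^sub>0 'k"

definition wdeg :: "('c \<Rightarrow> nat) \<Rightarrow> 'c list \<Rightarrow> nat" where
  "wdeg deg w = sum_list (map deg w)"

definition words :: "('c \<Rightarrow> nat) \<Rightarrow> nat \<Rightarrow> 'c list set" where
  "words deg n = {w. wdeg deg w = n}"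

definition homog :: "('c \<Rightarrow> nat) \<Rightarrow> nat \<Rightarrow> ('c, 'k::field) free_alg set" where
  "homog deg n = {x. Poly_Mapping.keys x \<subseteq> words deg n}"

definition tensor_mult :: "('c list \<times> 'c list \<Rightarrow>\<^sub>0 'k::field) \<Rightarrow> ('c, 'k) free_alg" where
  "tensor_mult = lin_ext (\<lambda>(u, v). basis (u @ v))"

section \<open>Cocommutative graded connected Hopf algebras that are free as algebras\<close>

text \<open>
  Unit and product, which are those of the free algebra, respect the grading automatically, and
  positivity of the degrees makes the degree zero part the ground field.
\<close>

locale cocomm_graded_free_hopf_algebra =
  fixes deg :: "'c \<Rightarrow> nat"
    and \<Delta> :: "('c, 'k::field) free_alg \<Rightarrow> ('c list \<times> 'c list \<Rightarrow>\<^sub>0 'k)"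
    and \<epsilon> :: "('c, 'k) free_alg \<Rightarrow> 'k"
    and S :: "('c, 'k) free_alg \<Rightarrow> ('c, 'k) free_alg"
  assumes deg_pos: "deg c > 0"
    and finite_dim: "\<exists>B :: ('c, 'k) free_alg set. finite B \<and> pmv.span B = homog deg n"
    and coprod_linear: "Vector_Spaces.linear scale_pm scale_pm \<Delta>"
    and coprod_one: "\<Delta> 1 = 1"
    and coprod_mult: "\<Delta> (x * y) = \<Delta> x * \<Delta> y"
    and counit_linear: "Vector_Spaces.linear scale_pm (*) \<epsilon>"
    and counit_one: "\<epsilon> 1 = 1"
    and counit_mult: "\<epsilon> (x * y) = \<epsilon> x * \<epsilon> y"
    and coassoc: "tensor_assoc (tensor_map \<Delta> id (\<Delta> x)) = tensor_map id \<Delta> (\<Delta> x)"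
    and counit_left: "lin_ext (\<lambda>(u, v). scale_pm (\<epsilon> (basis u)) (basis v)) (\<Delta> x) = x"
    and counit_right: "lin_ext (\<lambda>(u, v). scale_pm (\<epsilon> (basis v)) (basis u)) (\<Delta> x) = x"
    and antipode_linear: "Vector_Spaces.linear scale_pm scale_pm S"
    and antipode_left: "tensor_mult (tensor_map S id (\<Delta> x)) = scale_pm (\<epsilon> x) 1"
    and antipode_right: "tensor_mult (tensor_map id S (\<Delta> x)) = scale_pm (\<epsilon> x) 1"
    and coprod_graded: "x \<in> homog deg n \<Longrightarrow> (u, v) \<in> Poly_Mapping.keys (\<Delta> x) \<Longrightarrow> wdeg deg u + wdeg deg v = n"
    and counit_graded: "n > 0 \<Longrightarrow> x \<in> homog deg n \<Longrightarrow> \<epsilon> x = 0"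
    and antipode_graded: "x \<in> homog deg n \<Longrightarrow> S x \<in> homog deg n"
    and cocommutative: "tensor_swap (\<Delta> x) = \<Delta> x"

section \<open>Hopf powers and the Eulerian idempotent\<close>

text \<open>
  The \<open>a\<close>-fold tensor power of the free algebra is the subspace of \<open>'c list list \<Rightarrow>\<^sub>0 'k\<close> spanned by
  the lists of \<open>a\<close> words. \<open>on_last D\<close> is \<open>id \<otimes> \<dots> \<otimes> id \<otimes> D\<close>, and \<open>iter_coprod D a\<close>,
  for \<open>a \<ge> 1\<close>, is the \<open>a\<close>-fold coproduct built from \<open>D\<close>, starting with the identity at \<open>a = 1\<close>.
\<close>

definition on_last :: "(('c, 'k::field) free_alg \<Rightarrow> ('c list \<times> 'c list \<Rightarrow>\<^sub>0 'k))
    \<Rightarrow> ('c list list \<Rightarrow>\<^sub>0 'k) \<Rightarrow> ('c list list \<Rightarrow>\<^sub>0 'k)" where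
  "on_last D = lin_ext (\<lambda>ws. lin_ext (\<lambda>(u, v). basis (butlast ws @ [u, v])) (D (basis (last ws))))"

definition iter_coprod :: "(('c, 'k::field) free_alg \<Rightarrow> ('c list \<times> 'c list \<Rightarrow>\<^sub>0 'k))
    \<Rightarrow> nat \<Rightarrow> ('c, 'k) free_alg \<Rightarrow> ('c list list \<Rightarrow>\<^sub>0 'k)" where
  "iter_coprod D a x = (on_last D ^^ (a - 1)) (lin_ext (\<lambda>w. basis [w]) x)"

definition iter_mult :: "('c list list \<Rightarrow>\<^sub>0 'k::field) \<Rightarrow> ('c, 'k) free_alg" where
  "iter_mult = lin_ext (\<lambda>ws. basis (concat ws))"

definition hopf_power :: "(('c, 'k::field) free_alg \<Rightarrow> ('c list \<times> 'c list \<Rightarrow>\<^sub>0 'k))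
    \<Rightarrow> nat \<Rightarrow> ('c, 'k) free_alg \<Rightarrow> ('c, 'k) free_alg" where
  "hopf_power \<Delta> a x = iter_mult (iter_coprod \<Delta> a x)"

definition reduced_coprod :: "(('c, 'k::field) free_alg \<Rightarrow> ('c list \<times> 'c list \<Rightarrow>\<^sub>0 'k))
    \<Rightarrow> ('c, 'k) free_alg \<Rightarrow> ('c list \<times> 'c list \<Rightarrow>\<^sub>0 'k)" where
  "reduced_coprod \<Delta> x = \<Delta> x - tensor 1 x - tensor x 1"

text \<open>For \<open>x\<close> of positive degree only finitely many summands are nonzero.\<close>

definition eulerian :: "(('c, 'k::field) free_alg \<Rightarrow> ('c list \<times> 'c list \<Rightarrow>\<^sub>0 'k))
    \<Rightarrow> ('c, 'k) free_alg \<Rightarrow> ('c, 'k) free_alg" where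
  "eulerian \<Delta> x = Sum_any (\<lambda>a. if a \<ge> 1
     then scale_pm ((-1) ^ (a - 1) / of_nat a) (iter_mult (iter_coprod (reduced_coprod \<Delta>) a x))
     else 0)"

definition leads_to :: "(('c, 'k::field) free_alg \<Rightarrow> ('c list \<times> 'c list \<Rightarrow>\<^sub>0 'k))
    \<Rightarrow> 'c list \<Rightarrow> 'c list \<Rightarrow> bool" where
  "leads_to \<Delta> b b' \<longleftrightarrow> (\<exists>a\<ge>1. Poly_Mapping.lookup (hopf_power \<Delta> a (basis b)) b' \<noteq> 0)"

text \<open>
  The structure constants of the coproduct in the word basis are nonnegative with respect to some
  set \<open>P\<close> of positive scalars; over an ordered field one can take \<open>P = {0<..}\<close>. The structure
  constants of the product are \<open>0\<close> and \<open>1\<close>, and \<open>1 \<in> P\<close> follows from the counit axiom.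

  Without such a condition the words occurring in the eigenvectors \<open>gvec\<close> below need not satisfy
  \<open>leads_to\<close>, although they can always be reached in several \<open>leads_to\<close> steps: let \<open>c < p < q < d\<close>
  have degrees 1, 1, 1, 3, with \<open>c\<close>, \<open>p\<close>, \<open>q\<close> primitive and
  \<open>reduced_coprod \<Delta> d = 2 ([c,p] \<otimes> q + q \<otimes> [c,p])\<close>. Then \<open>cpcq\<close> has coefficient \<open>1\<close> in
  \<open>gvec \<Delta> cd = [c, d - [c,p]q - q[c,p]]\<close>, but coefficient \<open>0\<close> in every Hopf power of \<open>cd\<close>.
\<close>

definition nonneg_coprod :: "(('c, 'k::field) free_alg \<Rightarrow> ('c list \<times> 'c list \<Rightarrow>\<^sub>0 'k)) \<Rightarrow> bool" where
  "nonneg_coprod \<Delta> \<longleftrightarrow> (\<exists>P. 0 \<notin> P \<and> (\<forall>x\<in>P. \<forall>y\<in>P. x + y \<in> P \<and> x * y \<in> P) \<and>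
     (\<forall>w u v. Poly_Mapping.lookup (\<Delta> (basis w)) (u, v) \<in> insert 0 P))"

section \<open>Lyndon words\<close>

text \<open>
  The order on words is the lexicographic one of \<open>HOL-Library.List_Lexorder\<close>, in which a proper
  prefix is smaller.
\<close>

definition lyndon :: "'c::linorder list \<Rightarrow> bool" where
  "lyndon w \<longleftrightarrow> w \<noteq> [] \<and> (\<forall>i. 0 < i \<and> i < length w \<longrightarrow> w < rotate i w)"

definition lyndon_factors :: "'c::linorder list \<Rightarrow> 'c list list" where
  "lyndon_factors b = (THE bs. concat bs = b \<and> (\<forall>l\<in>set bs. lyndon l) \<and> sorted_wrt (\<ge>) bs)"

text \<open>
  The position at which the longest Lyndon proper suffix starts; it exists for words of length
  at least two, as the last letter is a Lyndon word.
\<close>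

definition std_pos :: "'c::linorder list \<Rightarrow> nat" where
  "std_pos l = (LEAST i. 0 < i \<and> i < length l \<and> lyndon (drop i l))"

lemma std_pos_bounds:
  assumes "length l \<ge> 2"
  shows "0 < std_pos l" "std_pos l < length l"
proof -
  have "drop (length l - 1) l = [last l]"
    using assms by (cases l rule: rev_cases) auto
  then have "0 < length l - 1 \<and> length l - 1 < length l \<and> lyndon (drop (length l - 1) l)"
    using assms by (auto simp: lyndon_def)
  then have "0 < std_pos l \<and> std_pos l < length l \<and> lyndon (drop (std_pos l) l)"
    unfolding std_pos_def by (rule LeastI)
  then show "0 < std_pos l" "std_pos l < length l" by auto
qed

text \<open>
  Standard bracketing of a Lyndon word, with \<open>\<phi> c\<close> in place of the letter \<open>c\<close>. Its values at words
  that are not Lyndon are irrelevant.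
\<close>

function std_bracket :: "('c::linorder \<Rightarrow> 'r::ring_1) \<Rightarrow> 'c list \<Rightarrow> 'r" where
  "std_bracket \<phi> l = (if length l < 2 then \<phi> (hd l) else
     (let x = std_bracket \<phi> (take (std_pos l) l);
          y = std_bracket \<phi> (drop (std_pos l) l)
      in x * y - y * x))"
  by pat_completeness auto
termination
  by (relation "measure (length \<circ> snd)") (use std_pos_bounds in \<open>force simp: not_less\<close>)+

declare std_bracket.simps [simp del]

definition sym_bracket :: "('c::linorder \<Rightarrow> 'r::ring_1) \<Rightarrow> 'c list \<Rightarrow> 'r" where
  "sym_bracket \<phi> b = (let bs = lyndon_factors b; k = length bs in
     \<Sum>\<sigma> | \<sigma> permutes {..<k}. prod_list (map (\<lambda>i. std_bracket \<phi> (bs ! \<sigma> i)) [0..<k]))"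

definition sym_word :: "'c::linorder list \<Rightarrow> ('c, 'k::field) free_alg" where
  "sym_word = sym_bracket (\<lambda>c. basis [c])"

definition gvec :: "(('c::linorder, 'k::field) free_alg \<Rightarrow> ('c list \<times> 'c list \<Rightarrow>\<^sub>0 'k))
    \<Rightarrow> 'c list \<Rightarrow> ('c, 'k) free_alg" where
  "gvec \<Delta> = sym_bracket (\<lambda>c. eulerian \<Delta> (basis [c]))"

text \<open>
  The power series \<open>\<Prod>\<^sub>i\<^sub>\<ge>\<^sub>1 (1 - y x\<^sup>i)\<^sup>-\<^sup>d\<^sup>i\<close> in \<open>x\<close>, with coefficients in the power series
  in \<open>y\<close>; the infinite product converges in the \<open>x\<close>-adic topology.
\<close>

definition num_lyndon :: "('c::linorder \<Rightarrow> nat) \<Rightarrow> nat \<Rightarrow> nat" where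
  "num_lyndon deg i = card {l. lyndon l \<and> wdeg deg l = i}"

definition lyndon_series :: "('c::linorder \<Rightarrow> nat) \<Rightarrow> rat fps fps" where
  "lyndon_series deg =
     prodinf (\<lambda>j. inverse (1 - fps_const fps_X * fps_X ^ Suc j) ^ num_lyndon deg (Suc j))"

end

theory Submission
  imports Defs "HOL-Computational_Algebra.Polynomial"
begin

text \<open>
  Convolution powers of the identity give \<open>\<Psi>\<^sup>n = \<Sum>\<^sub>k (n choose k) J\<^sup>k\<close> with \<open>J\<close> the projection onto
  positive degree, so \<open>\<Psi>\<^sup>n\<close> is a polynomial in \<open>n\<close> whose linear coefficient is the Eulerian
  idempotent. By cocommutativity \<open>\<Delta> \<Psi>\<^sup>n = (\<Psi>\<^sup>n \<otimes> \<Psi>\<^sup>n) \<Delta>\<close>, and comparing linear coefficients shows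
  that the image of a generator is primitive. For primitive \<open>x\<close> one has \<open>\<Psi>\<^sup>a (x\<^sup>k) = a\<^sup>k x\<^sup>k\<close>, which
  polarizes to symmetrized products.

  Independence: brackets of Lyndon words are unitriangular with respect to length followed by the
  lexicographic order, so some linear \<open>f\<close> into a polynomial ring, with \<open>f 1 = 0\<close>, sends them to
  independent variables. The \<open>k\<close>-th convolution power of \<open>f\<close> sends the eigenvector of a word with \<open>k\<close>
  Lyndon factors to a nonzero multiple of the monomial of its factors, and those of words with fewer
  factors to \<open>0\<close>.

  Reachability: the words reachable from \<open>b\<close> form a set closed under \<open>\<Psi>\<^sup>2\<close>, hence under rearrangement
  of letters. By induction on the degree of the letter \<open>c\<close>, such a set is also closed under replacing
  \<open>c\<close> by a word of its Eulerian image: letters of high degree can be collected at the end of the word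
  and ignored, while for the remaining ones \<open>\<Psi>\<^sup>2\<close> commutes with brackets with primitive elements.
\<close>

section \<open>Linear maps on spaces with a basis\<close>

text \<open>Cancellation is what shapes the reachability part: a word contributed by one term of a
  Hopf power may be annihilated by another, so closure under \<open>hp2\<close> says nothing
  directly about single terms. Three facts give control. Among words of the original length, the
  coproduct acts like the one with primitive letters, whose coefficients are natural numbers. The
  words of an element can be recovered from its commutators with a primitive element, up to powers
  of a single letter, and coefficients at such powers behave as in a commutative ring. Powers of two
  are infinitely many points, so a coefficient that vanishes in every iterate of \<open>hp2\<close>
  on a letter vanishes in its Eulerian image. For independence, symmetrized products of brackets are
  not visibly triangular; carrying them to a polynomial ring by convolution takes the place of the
  Poincare-Birkhoff-Witt theorem.\<close>

global_interpretation pmp: vector_space_pair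
  "scale_pm :: 'k::field \<Rightarrow> ('b \<Rightarrow>\<^sub>0 'k) \<Rightarrow> ('b \<Rightarrow>\<^sub>0 'k)"
  "scale_pm :: 'k::field \<Rightarrow> ('d \<Rightarrow>\<^sub>0 'k) \<Rightarrow> ('d \<Rightarrow>\<^sub>0 'k)"
  by unfold_locales

abbreviation lin :: "(('b \<Rightarrow>\<^sub>0 'k::field) \<Rightarrow> ('d \<Rightarrow>\<^sub>0 'k)) \<Rightarrow> bool" where
  "lin \<equiv> Vector_Spaces.linear scale_pm scale_pm"

abbreviation "lookup \<equiv> Poly_Mapping.lookup"
abbreviation "keys \<equiv> Poly_Mapping.keys"

named_theorems lin_intros

lemma lin_iff: "lin f \<longleftrightarrow>
    (\<forall>x y. f (x + y) = f x + f y) \<and> (\<forall>a x. f (scale_pm a x) = scale_pm a (f x))"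
  by (simp add: Vector_Spaces.linear_iff pmv.vector_space_axioms)

lemma lin_add: "lin f \<Longrightarrow> f (x + y) = f x + f y"
  and lin_scale: "lin f \<Longrightarrow> f (scale_pm a x) = scale_pm a (f x)"
  and lin_zero: "lin f \<Longrightarrow> f 0 = 0"
  and lin_diff: "lin f \<Longrightarrow> f (x - y) = f x - f y"
  and lin_sum: "lin f \<Longrightarrow> f (\<Sum>i\<in>I. h i) = (\<Sum>i\<in>I. f (h i))"
  by (simp_all add: pmp.linear_add pmp.linear_scale pmp.linear_0 pmp.linear_diff
      pmp.linear_sum)

lemma lin_id [lin_intros]: "lin (\<lambda>x. x)"
  by (simp add: lin_iff)

lemma lin_compose: "lin g \<Longrightarrow> lin f \<Longrightarrow> lin (\<lambda>x. g (f x))"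
  and lin_plus [lin_intros]: "lin f \<Longrightarrow> lin f' \<Longrightarrow> lin (\<lambda>x. f x + f' x)"
  and lin_minus [lin_intros]: "lin f \<Longrightarrow> lin f' \<Longrightarrow> lin (\<lambda>x. f x - f' x)"
  and lin_scale_pm [lin_intros]: "lin f \<Longrightarrow> lin (\<lambda>x. scale_pm a (f x))"
  by (simp_all add: lin_iff pmv.scale_right_distrib pmv.scale_right_diff_distrib mult.commute)

lemma lin_sum' [lin_intros]: "(\<And>i. i \<in> I \<Longrightarrow> lin (f i)) \<Longrightarrow> lin (\<lambda>x. \<Sum>i\<in>I. f i x)"
  by (simp add: lin_iff sum.distrib pmv.scale_sum_right)

lemma lookup_basis: "lookup (basis u) v = (if u = v then 1 else 0)"
  by (simp add: basis_def lookup_single)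

lemma lookup_basis_eq [simp]: "lookup (basis u) u = 1"
  by (simp add: lookup_basis)

lemma keys_basis [simp]: "keys (basis u :: 'b \<Rightarrow>\<^sub>0 'k::field) = {u}"
  by (simp add: basis_def)

lemma keys_scale_pm: "keys (scale_pm a x) = (if a = 0 then {} else keys x)"
  by (auto simp: in_keys_iff)

lemma keys_minus_subset: "keys (x - y :: 'b \<Rightarrow>\<^sub>0 'k::field) \<subseteq> keys x \<union> keys y"
  by (auto simp: in_keys_iff lookup_minus)

lemma keys_sum_subset: "keys (\<Sum>i\<in>I. f i :: 'b \<Rightarrow>\<^sub>0 'k::field) \<subseteq> (\<Union>i\<in>I. keys (f i))"
proof
  fix x assume "x \<in> keys (sum f I)"
  then have "(\<Sum>i\<in>I. lookup (f i) x) \<noteq> 0" by (simp add: in_keys_iff lookup_sum)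
  then obtain i where "i \<in> I" "lookup (f i) x \<noteq> 0" by (rule sum.not_neutral_contains_not_neutral)
  then show "x \<in> (\<Union>i\<in>I. keys (f i))" by (auto simp: in_keys_iff)
qed

lemma lin_ext_superset:
  assumes "finite A" "keys x \<subseteq> A"
  shows "lin_ext f x = (\<Sum>b\<in>A. scale_pm (lookup x b) (f b))"
  unfolding lin_ext_def using assms
  by (intro sum.mono_neutral_left) (auto simp: in_keys_iff)

lemma lin_lin_ext: "lin (lin_ext f)"
proof -
  have "lin_ext f (x + y) = lin_ext f x + lin_ext f y" for x y
    using keys_add[of x y]
    by (simp add: lin_ext_superset[of "keys x \<union> keys y"] lookup_add pmv.scale_left_distrib sum.distrib)
  moreover have "lin_ext f (scale_pm a x) = scale_pm a (lin_ext f x)" for a x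
    by (simp add: lin_ext_superset[of "keys x"] keys_scale_pm pmv.scale_sum_right)
  ultimately show ?thesis by (simp add: lin_iff)
qed

lemma lin_lin_ext' [lin_intros]: "lin g \<Longrightarrow> lin (\<lambda>x. lin_ext f (g x))"
  by (rule lin_compose[OF lin_lin_ext])

lemma lin_ext_basis [simp]: "lin_ext f (basis b) = f b"
  by (simp add: lin_ext_def)

lemma lin_ext_basis_id [simp]: "lin_ext basis x = (x :: 'b \<Rightarrow>\<^sub>0 'k::field)"
  by (rule poly_mapping_eqI)
    (simp add: lin_ext_def lookup_sum lookup_basis mult_delta_right sum.delta in_keys_iff)

lemma lin_ext_comp: "lin g \<Longrightarrow> g (lin_ext f x) = lin_ext (\<lambda>b. g (f b)) x"
  unfolding lin_ext_def by (subst lin_sum, assumption, rule sum.cong[OF refl], erule lin_scale)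

lemma lin_eq_lin_ext: "lin f \<Longrightarrow> f x = lin_ext (\<lambda>b. f (basis b)) x"
  by (rule lin_ext_comp[of f basis x, unfolded lin_ext_basis_id])

lemma lin_eqI:
  assumes "lin f" "lin g" "\<And>b. b \<in> keys x \<Longrightarrow> f (basis b) = g (basis b)"
  shows "f x = g x"
  by (subst lin_eq_lin_ext[OF assms(1)], subst lin_eq_lin_ext[OF assms(2)])
    (simp add: lin_ext_def assms(3))

lemma lin_ext_cong: "(\<And>b. b \<in> keys x \<Longrightarrow> f b = g b) \<Longrightarrow> lin_ext f x = lin_ext g x"
  by (simp add: lin_ext_def)

lemma lin_lin_ext_fun [lin_intros]: "(\<And>b. lin (\<lambda>x. f x b)) \<Longrightarrow> lin (\<lambda>x. lin_ext (f x) y)"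
  unfolding lin_ext_def by (intro lin_intros)

lemma lin_ext_plus: "lin_ext (\<lambda>b. f b + g b) x = lin_ext f x + lin_ext g x"
  by (simp add: lin_ext_def pmv.scale_right_distrib sum.distrib)

lemma lookup_lin_ext: "lookup (lin_ext f x) z = (\<Sum>b\<in>keys x. lookup x b * lookup (f b) z)"
  by (simp add: lin_ext_def lookup_sum)

lemma keys_lin_ext: "keys (lin_ext f x) \<subseteq> (\<Union>b\<in>keys x. keys (f b))"
  using keys_sum_subset[of "\<lambda>b. scale_pm (lookup x b) (f b)" "keys x"]
  by (auto simp: lin_ext_def keys_scale_pm split: if_splits)

lemma lin_keys: "lin f \<Longrightarrow> keys (f x) \<subseteq> (\<Union>b\<in>keys x. keys (f (basis b)))"
  by (subst lin_eq_lin_ext) (auto dest: subsetD[OF keys_lin_ext])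

lemma basis_zero: "basis 0 = (1 :: 'd::monoid_add \<Rightarrow>\<^sub>0 'k::field)"
  by (simp add: basis_def)

lemma basis_mult: "basis u * basis v = (basis (u + v) :: 'd::monoid_add \<Rightarrow>\<^sub>0 'k::field)"
  by (simp add: basis_def mult_single)

lemma basis_Nil: "basis [] = (1 :: ('c, 'k::field) free_alg)"
  using basis_zero[where 'd="'c list"] by (simp add: zero_list_def)

lemma basis_append: "basis (u @ v) = (basis u * basis v :: ('c, 'k::field) free_alg)"
  by (simp add: basis_mult plus_list_def)

lemma scale_pm_eq_mult: "scale_pm a x = Poly_Mapping.single 0 a * (x :: 'd::monoid_add \<Rightarrow>\<^sub>0 'k::field)"
  unfolding scale_pm_def by (rule mult_map_scale_conv_mult)

lemma scale_pm_mult_left [simp]: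
  "scale_pm a x * y = scale_pm a (x * y :: 'd::monoid_add \<Rightarrow>\<^sub>0 'k::field)"
  by (simp add: scale_pm_eq_mult mult.assoc)

lemma lin_mult_right [lin_intros]: "lin f \<Longrightarrow> lin (\<lambda>x. f x * (y :: 'd::monoid_add \<Rightarrow>\<^sub>0 'k::field))"
  by (simp add: lin_iff distrib_right)

text \<open>Scalars are the constants at the neutral element, and these commute with every basis
  element even though the monoid need not be commutative.\<close>

lemma scale_pm_mult_right [simp]:
  "x * scale_pm a y = scale_pm a (x * y :: 'd::monoid_add \<Rightarrow>\<^sub>0 'k::field)"
proof -
  have comm: "basis b * Poly_Mapping.single 0 a = Poly_Mapping.single 0 a * basis b" for b :: 'd
    by (simp add: basis_def mult_single)
  have "lin (\<lambda>x. scale_pm a x)" by (intro lin_intros)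
  then have "x * Poly_Mapping.single 0 a = scale_pm a x"
    by (rule lin_eqI[of "\<lambda>x. x * Poly_Mapping.single 0 a", rotated])
       (intro lin_intros | simp add: comm scale_pm_eq_mult)+
  moreover have "x * scale_pm a y = (x * Poly_Mapping.single 0 a) * y"
    by (simp only: scale_pm_eq_mult mult.assoc)
  ultimately show ?thesis by simp
qed

lemma lin_mult_left [lin_intros]: "lin f \<Longrightarrow> lin (\<lambda>x. (y :: 'd::monoid_add \<Rightarrow>\<^sub>0 'k::field) * f x)"
  by (simp add: lin_iff distrib_left)

lemma of_nat_mult_eq_scale: "of_nat n * x = scale_pm (of_nat n) (x :: 'd::monoid_add \<Rightarrow>\<^sub>0 'k::field)"
  by (simp add: scale_pm_eq_mult)

lemma lin_ext_mult_left: "y * lin_ext f x = lin_ext (\<lambda>b. (y :: 'd::monoid_add \<Rightarrow>\<^sub>0 'k::field) * f b) x"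
  by (simp add: lin_ext_def sum_distrib_left)

lemma keys_mult_subset:
  "keys (x * y :: 'd::monoid_add \<Rightarrow>\<^sub>0 'k::field) \<subseteq> {u + v |u v. u \<in> keys x \<and> v \<in> keys y}"
  by (rule keys_mult)

lemma keys_mult_wordE:
  assumes "w \<in> keys (x * y :: ('c, 'k::field) free_alg)"
  obtains u v where "w = u @ v" "u \<in> keys x" "v \<in> keys y"
  using subsetD[OF keys_mult_subset assms] by (auto simp: plus_list_def)

text \<open>\<open>independent\<close> speaks of sets, so a family with repetitions would slip
  through; injectivity is therefore recorded with it. Two equal values would satisfy the relation
  with coefficients 1 and -1.\<close>

lemma independent_family:
  assumes "\<And>F c b. finite F \<Longrightarrow> F \<subseteq> W \<Longrightarrow> (\<Sum>b\<in>F. scale_pm (c b) (g b)) = 0 \<Longrightarrow> b \<in> F \<Longrightarrow> c b = 0"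
  shows "inj_on g W \<and> pmv.independent (g ` W)"
proof
  show inj: "inj_on g W"
  proof (rule inj_onI, rule ccontr)
    fix x y assume xy: "x \<in> W" "y \<in> W" "g x = g y" "x \<noteq> y"
    then have "(\<Sum>b\<in>{x, y}. scale_pm (if b = x then 1 else - 1) (g b)) = 0" by simp
    from assms[OF _ _ this, of x] xy show False by simp
  qed
  show "pmv.independent (g ` W)"
    unfolding pmv.independent_explicit_finite_subsets
  proof (intro allI impI ballI)
    fix T u v assume T: "T \<subseteq> g ` W" "finite T" "(\<Sum>v\<in>T. scale_pm (u v) v) = 0" "v \<in> T"
    then obtain F where F: "F \<subseteq> W" "finite F" "T = g ` F" by (meson finite_subset_image)
    then have "(\<Sum>b\<in>F. scale_pm (u (g b)) (g b)) = 0"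
      using T(3) inj by (simp add: sum.reindex inj_on_subset)
    then show "u v = 0" using assms[of F "\<lambda>b. u (g b)"] F T(4) by auto
  qed
qed

lemma independent_basis:
  "inj_on (basis :: _ \<Rightarrow> ('b \<Rightarrow>\<^sub>0 'k::field)) W \<and> pmv.independent (basis ` W :: ('b \<Rightarrow>\<^sub>0 'k) set)"
proof (rule independent_family)
  fix F and c :: "'b \<Rightarrow> 'k" and b
  assume "finite F" "(\<Sum>b\<in>F. scale_pm (c b) (basis b)) = 0" "b \<in> F"
  then have "lookup (\<Sum>b\<in>F. scale_pm (c b) (basis b)) b = 0" by simp
  then show "c b = 0"
    using \<open>finite F\<close> \<open>b \<in> F\<close> by (simp add: lookup_sum lookup_basis mult_delta_right sum.delta)
qed

section \<open>Tensor products\<close>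

lemma tensor_basis [simp]: "tensor (basis u) (basis v) = basis (u, v)"
  by (simp add: tensor_def)

lemma lin_tensor_right [lin_intros]: "lin f \<Longrightarrow> lin (\<lambda>y. tensor x (f y))"
  unfolding tensor_def by (intro lin_intros)

lemma lin_tensor_left [lin_intros]: "lin f \<Longrightarrow> lin (\<lambda>x. tensor (f x) y)"
  unfolding tensor_def by (intro lin_intros)

lemma lookup_tensor: "lookup (tensor x y) (u, v) = lookup x u * lookup y v"
proof -
  have "lookup (lin_ext (\<lambda>v. basis (u', v)) y) (u, v) = (if u' = u then lookup y v else 0)" for u'
    by (cases "u' = u") (simp_all add: lookup_lin_ext lookup_basis mult_delta_right sum.delta in_keys_iff)
  then show ?thesis
    by (simp add: tensor_def lookup_lin_ext[where x=x] mult_delta_right sum.delta in_keys_iff)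
qed

lemma tensor_mult_tensor:
  "tensor x y * tensor x' y' = (tensor (x * x') (y * y') :: 'b::monoid_add \<times> 'd::monoid_add \<Rightarrow>\<^sub>0 'k::field)"
proof -
  have "tensor (basis u) (basis v) * tensor (basis u') y' = tensor (basis u * basis u') (basis v * y')" for u v u'
    by (rule lin_eqI[where x=y']) (intro lin_intros | simp add: basis_mult)+
  then have "tensor (basis u) (basis v) * tensor x' y' = tensor (basis u * x') (basis v * y')" for u v
    by (rule lin_eqI[where x=x' and f="\<lambda>x'. tensor _ _ * tensor x' y'", rotated 2]) (intro lin_intros | simp)+
  then have "tensor (basis u) y * tensor x' y' = tensor (basis u * x') (y * y')" for u
    by (rule lin_eqI[where x=y and f="\<lambda>y. tensor _ y * tensor x' y'", rotated 2]) (intro lin_intros | simp)+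
  then show ?thesis
    by (rule lin_eqI[where x=x and f="\<lambda>x. tensor x y * tensor x' y'", rotated 2]) (intro lin_intros | simp)+
qed

lemma tensor_one_one: "tensor 1 1 = (1 :: 'b::monoid_add \<times> 'd::monoid_add \<Rightarrow>\<^sub>0 'k::field)"
  by (simp flip: basis_zero add: zero_prod_def)

text \<open>The universal property of the tensor product: a bilinear map factors through
  \<open>tensor\<close>. Linearity in the first argument is asked for at basis elements, because the
  second argument is expanded last.\<close>

lemma lin_ext_tensor:
  assumes "\<And>v. lin (\<lambda>x. h x (basis v))" "\<And>x. lin (h x)"
  shows "lin_ext (\<lambda>(u, v). h (basis u) (basis v)) (tensor x y) = h x y"
proof -
  have "lin_ext (\<lambda>(u, v). h (basis u) (basis v)) (tensor x (basis v)) = h x (basis v)" for v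
    by (rule lin_eqI[where x=x]) (intro lin_intros assms | simp)+
  then show ?thesis
    by (rule lin_eqI[where x=y and f="\<lambda>y. lin_ext _ (tensor x y)", rotated 2]) (intro lin_intros assms | simp)+
qed

lemma lin_tensor_mult [lin_intros]: "lin f \<Longrightarrow> lin (\<lambda>x. tensor_mult (f x))"
  unfolding tensor_mult_def by (intro lin_intros)

lemma tensor_mult_basis [simp]: "tensor_mult (basis (u, v)) = basis (u @ v)"
  by (simp add: tensor_mult_def)

lemma tensor_mult_tensor_eq [simp]: "tensor_mult (tensor x y) = x * y"
  unfolding tensor_mult_def
  using lin_ext_tensor[of "\<lambda>x y. x * y" x y] by (simp add: basis_append lin_intros)

section \<open>Convolution\<close>

lemma wdeg_append [simp]: "wdeg deg (u @ v) = wdeg deg u + wdeg deg v"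
  and wdeg_Nil [simp]: "wdeg deg [] = 0"
  and wdeg_Cons [simp]: "wdeg deg (c # v) = deg c + wdeg deg v"
  by (simp_all add: wdeg_def)

locale hopf_char0 = cocomm_graded_free_hopf_algebra deg \<Delta> \<epsilon> S
  for deg :: "'c \<Rightarrow> nat"
    and \<Delta> :: "('c, 'k::field_char_0) free_alg \<Rightarrow> ('c list \<times> 'c list \<Rightarrow>\<^sub>0 'k)"
    and \<epsilon> :: "('c, 'k) free_alg \<Rightarrow> 'k"
    and S :: "('c, 'k) free_alg \<Rightarrow> ('c, 'k) free_alg"
begin

lemma lin_coprod [lin_intros]: "lin f \<Longrightarrow> lin (\<lambda>x. \<Delta> (f x))"
  using coprod_linear by (rule lin_compose)

lemma counit_scale: "\<epsilon> (scale_pm a x) = a * \<epsilon> x" and counit_add: "\<epsilon> (x + y) = \<epsilon> x + \<epsilon> y"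
  using counit_linear by (simp_all add: Vector_Spaces.linear_iff)

lemma wdeg_eq_0_iff [simp]: "wdeg deg w = 0 \<longleftrightarrow> w = []"
  using deg_pos by (cases w) (auto simp: wdeg_def)

lemma basis_in_homog: "basis w \<in> homog deg (wdeg deg w)"
  by (simp add: homog_def words_def)

lemma counit_basis: "\<epsilon> (basis w) = (if w = [] then 1 else 0)"
  using counit_graded[OF _ basis_in_homog, of w] wdeg_eq_0_iff[of w]
  by (auto simp: basis_Nil counit_one simp del: wdeg_eq_0_iff)

lemma wdeg_coprod: "(u, v) \<in> keys (\<Delta> (basis w)) \<Longrightarrow> wdeg deg u + wdeg deg v = wdeg deg w"
  by (rule coprod_graded[OF basis_in_homog])

lemma lookup_coprod_Nil_left: "lookup (\<Delta> x) ([], z) = lookup x z"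
proof -
  have "lookup x z = lookup (lin_ext (\<lambda>(u, v). scale_pm (\<epsilon> (basis u)) (basis v)) (\<Delta> x)) z"
    by (simp add: counit_left)
  also have "\<dots> = (\<Sum>b\<in>keys (\<Delta> x). if b = ([], z) then lookup (\<Delta> x) b else 0)"
    unfolding lookup_lin_ext by (rule sum.cong) (auto simp: counit_basis lookup_basis split: if_splits)
  finally show ?thesis by (simp add: sum.delta in_keys_iff)
qed

lemma lookup_coprod_Nil_right: "lookup (\<Delta> x) (z, []) = lookup x z"
proof -
  have "lookup x z = lookup (lin_ext (\<lambda>(u, v). scale_pm (\<epsilon> (basis v)) (basis u)) (\<Delta> x)) z"
    by (simp add: counit_right)
  also have "\<dots> = (\<Sum>b\<in>keys (\<Delta> x). if b = (z, []) then lookup (\<Delta> x) b else 0)"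
    unfolding lookup_lin_ext by (rule sum.cong) (auto simp: counit_basis lookup_basis split: if_splits)
  finally show ?thesis by (simp add: sum.delta in_keys_iff)
qed

text \<open>The target is any monoid algebra: the free algebra gives the Hopf powers, its tensor
  square gives \<open>coprod_cpow_id\<close>, and multisets of words, a polynomial ring, give the
  independence argument.\<close>

definition conv :: "(('c, 'k) free_alg \<Rightarrow> ('d::monoid_add \<Rightarrow>\<^sub>0 'k)) \<Rightarrow> (('c, 'k) free_alg \<Rightarrow> ('d \<Rightarrow>\<^sub>0 'k))
    \<Rightarrow> ('c, 'k) free_alg \<Rightarrow> ('d \<Rightarrow>\<^sub>0 'k)" where
  "conv f g x = lin_ext (\<lambda>(u, v). f (basis u) * g (basis v)) (\<Delta> x)"

definition conv_unit :: "('c, 'k) free_alg \<Rightarrow> ('d::monoid_add \<Rightarrow>\<^sub>0 'k)" where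
  "conv_unit x = scale_pm (\<epsilon> x) 1"

primrec cpow :: "(('c, 'k) free_alg \<Rightarrow> ('d::monoid_add \<Rightarrow>\<^sub>0 'k)) \<Rightarrow> nat \<Rightarrow> ('c, 'k) free_alg \<Rightarrow> ('d \<Rightarrow>\<^sub>0 'k)" where
  "cpow f 0 = conv_unit"
| "cpow f (Suc n) = conv f (cpow f n)"

abbreviation \<Psi> :: "nat \<Rightarrow> ('c, 'k) free_alg \<Rightarrow> ('c, 'k) free_alg" where
  "\<Psi> \<equiv> cpow (\<lambda>x. x)"

lemma lin_conv [lin_intros]: "lin h \<Longrightarrow> lin (\<lambda>x. conv f g (h x))"
  unfolding conv_def by (intro lin_intros)

lemma lin_conv_unit [lin_intros]: "lin h \<Longrightarrow> lin (\<lambda>x. conv_unit (h x))"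
  by (simp add: lin_iff conv_unit_def counit_add counit_scale pmv.scale_left_distrib)

lemma lin_cpow [lin_intros]: "lin h \<Longrightarrow> lin (\<lambda>x. cpow f n (h x))"
  by (cases n) (simp_all add: lin_intros)

lemma lin_cpow': "lin (cpow f n)" and lin_conv': "lin (conv f' g)"
  and lin_conv_unit': "lin conv_unit"
  using lin_cpow[OF lin_id] lin_conv[OF lin_id] lin_conv_unit[OF lin_id] by simp_all

lemma conv_unit_basis: "conv_unit (basis w) = (if w = [] then 1 else 0)"
  by (simp add: conv_unit_def counit_basis)

lemma conv_assoc:
  fixes f g h :: "('c, 'k) free_alg \<Rightarrow> ('d::monoid_add \<Rightarrow>\<^sub>0 'k)"
  assumes "lin f" "lin g" "lin h"
  shows "conv (conv f g) h = conv f (conv g h)"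
proof
  fix x
  \<comment> \<open>\<open>T\<close> multiplies three tensor factors; its values at the two sides of
    \<open>coassoc\<close> are the two bracketings.\<close>
  define T where "T = lin_ext (\<lambda>(u, v, w). f (basis u) * g (basis v) * h (basis w))"
  have lT: "lin T" unfolding T_def by (rule lin_lin_ext)
  have la: "lin (tensor_assoc :: (('c list \<times> 'c list) \<times> 'c list \<Rightarrow>\<^sub>0 'k) \<Rightarrow> _)"
    unfolding tensor_assoc_def by (rule lin_lin_ext)
  have 1: "T (tensor_assoc (tensor z (basis v)))
      = lin_ext (\<lambda>(u, v). f (basis u) * g (basis v)) z * h (basis v)" for z v
    by (rule lin_eqI[where x=z])
       (intro lin_intros lin_compose[OF lT] lin_compose[OF la] | auto simp: tensor_assoc_def T_def)+
  have 2: "T (tensor (basis u) z)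
      = f (basis u) * lin_ext (\<lambda>(u, v). g (basis u) * h (basis v)) z" for z u
    by (rule lin_eqI[where x=z]) (intro lin_intros lin_compose[OF lT] | auto simp: T_def mult.assoc)+
  have "T (tensor_assoc (tensor_map \<Delta> id (\<Delta> x))) = conv (conv f g) h x"
    unfolding tensor_map_def conv_def
    by (subst lin_ext_comp[OF la], subst lin_ext_comp[OF lT], rule lin_ext_cong) (auto simp: 1)
  moreover have "T (tensor_map id \<Delta> (\<Delta> x)) = conv f (conv g h) x"
    unfolding tensor_map_def conv_def
    by (subst lin_ext_comp[OF lT], rule lin_ext_cong) (auto simp: 2)
  ultimately show "conv (conv f g) h x = conv f (conv g h) x"
    by (simp add: coassoc)
qed

lemma conv_unit_left: 
  assumes "lin f" shows "conv conv_unit f = f"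
proof
  fix x
  have "f x = f (lin_ext (\<lambda>(u, v). scale_pm (\<epsilon> (basis u)) (basis v)) (\<Delta> x))"
    by (simp add: counit_left)
  also have "\<dots> = conv conv_unit f x"
    unfolding conv_def
    by (subst lin_ext_comp[OF assms], rule lin_ext_cong) (auto simp: conv_unit_def lin_scale[OF assms])
  finally show "conv conv_unit f x = f x" by simp
qed

lemma conv_unit_right: 
  assumes "lin f" shows "conv f conv_unit = f"
proof
  fix x
  have "f x = f (lin_ext (\<lambda>(u, v). scale_pm (\<epsilon> (basis v)) (basis u)) (\<Delta> x))"
    by (simp add: counit_right)
  also have "\<dots> = conv f conv_unit x"
    unfolding conv_def
    by (subst lin_ext_comp[OF assms], rule lin_ext_cong) (auto simp: conv_unit_def lin_scale[OF assms])
  finally show "conv f conv_unit x = f x" by simp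
qed

lemma conv_plus_left: "conv (\<lambda>x. f x + g x) h x = conv f h x + conv g h x"
  unfolding conv_def lin_ext_plus[symmetric]
  by (rule lin_ext_cong) (auto simp: distrib_right)

lemma cpow_add: "lin f \<Longrightarrow> cpow f (m + n) = conv (cpow f m) (cpow f n)"
  by (induction m) (simp_all add: conv_unit_left conv_assoc lin_cpow')

lemma conv_commute_cpow:
  assumes "lin f" "lin g" "conv f g = conv g f"
  shows "conv g (cpow f n) = conv (cpow f n) g"
proof (induction n)
  case 0
  then show ?case by (simp add: conv_unit_left conv_unit_right assms)
next
  case (Suc n)
  have "conv g (conv f (cpow f n)) = conv (conv f g) (cpow f n)"
    using assms(3) by (simp add: conv_assoc[symmetric] assms(1,2) lin_cpow')
  also have "\<dots> = conv f (conv (cpow f n) g)"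
    using Suc by (simp add: conv_assoc assms(1,2) lin_cpow')
  finally show ?case by (simp add: conv_assoc assms(1,2) lin_cpow')
qed

text \<open>As for commuting elements of any monoid. It is applied to the two embeddings of the
  algebra into its tensor square.\<close>

lemma cpow_conv:
  assumes "lin f" "lin g" "conv f g = conv g f"
  shows "cpow (conv f g) n = conv (cpow f n) (cpow g n)"
proof (induction n)
  case 0
  then show ?case by (simp add: conv_unit_left lin_conv_unit')
next
  case (Suc n)
  note [simp] = assms(1,2) lin_cpow' lin_conv'
  have "cpow (conv f g) (Suc n) = conv f (conv (conv g (cpow f n)) (cpow g n))"
    using Suc by (simp add: conv_assoc)
  also have "\<dots> = conv (conv f (cpow f n)) (conv g (cpow g n))"
    by (simp add: conv_commute_cpow[OF assms] conv_assoc)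
  finally show ?case by simp
qed

lemma cpow_hom:
  assumes "lin \<phi>" "\<phi> 1 = 1" "\<And>x y. \<phi> (x * y) = \<phi> x * \<phi> y"
  shows "\<phi> (cpow f n x) = cpow (\<lambda>x. \<phi> (f x)) n x"
proof (induction n arbitrary: x)
  case 0
  then show ?case by (simp add: conv_unit_def lin_scale[OF assms(1)] assms(2))
next
  case (Suc n)
  show ?case
    unfolding cpow.simps conv_def
    by (subst lin_ext_comp[OF assms(1)], rule lin_ext_cong) (auto simp: assms(3) Suc)
qed

lemma conv_primitive_tensor:
  assumes "lin f" "lin g"
  shows "lin_ext (\<lambda>(u, v). f (basis u) * g (basis v)) (tensor x y) = f x * g y"
  by (rule lin_ext_tensor) (intro lin_intros assms | simp)+

section \<open>Hopf powers as convolution powers\<close>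

lemma lin_on_last: "lin (on_last D)"
  unfolding on_last_def by (rule lin_lin_ext)

lemma lin_on_last_pow: "lin ((on_last D) ^^ n)"
  by (induction n) (simp_all add: lin_iff lin_add[OF lin_on_last] lin_scale[OF lin_on_last])

lemma lin_iter_mult: "lin iter_mult"
  unfolding iter_mult_def by (rule lin_lin_ext)

lemma lin_iter_mult_on_last: "lin (\<lambda>x. iter_mult ((on_last D ^^ n) x))"
  by (rule lin_compose[OF lin_iter_mult lin_on_last_pow])

lemma iter_mult_basis: "iter_mult (basis ws) = basis (concat ws)"
  by (simp add: iter_mult_def)

text \<open>\<open>on_last\<close> touches only the last tensor factor, so after multiplication the
  earlier factors come out on the left unchanged.\<close>

lemma iter_mult_on_last:
  assumes "ws \<noteq> []"
  shows "iter_mult ((on_last D ^^ a) (basis ws))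
    = basis (concat (butlast ws)) * iter_mult ((on_last D ^^ a) (basis [last ws]))"
  using assms
proof (induction a arbitrary: ws)
  case 0
  then have "concat ws = concat (butlast ws) @ last ws"
    by (metis append_butlast_last_id concat.simps concat_append append_Nil2)
  then show ?case by (simp add: iter_mult_basis basis_append)
next
  case (Suc a)
  have *: "iter_mult ((on_last D ^^ Suc a) (basis vs)) = 
      lin_ext (\<lambda>(u, v). basis (concat (butlast vs)) * (basis u * iter_mult ((on_last D ^^ a) (basis [v])))) (D (basis (last vs)))" 
    if "vs \<noteq> []" for vs
  proof -
    have "iter_mult ((on_last D ^^ Suc a) (basis vs)) = iter_mult ((on_last D ^^ a) 
        (lin_ext (\<lambda>(u, v). basis (butlast vs @ [u, v])) (D (basis (last vs)))))"
      by (simp only: funpow_Suc_right o_apply) (simp add: on_last_def)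
    also have "\<dots> = lin_ext (\<lambda>(u, v). basis (concat (butlast vs)) * (basis u * iter_mult ((on_last D ^^ a) (basis [v])))) (D (basis (last vs)))"
      by (subst lin_ext_comp[OF lin_iter_mult_on_last], rule lin_ext_cong)
         (clarsimp, subst Suc.IH, simp, simp add: butlast_append basis_append mult.assoc)
    finally show ?thesis .
  qed
  show ?case
    by (subst *[OF Suc.prems], subst *, simp)
       (simp add: lin_ext_mult_left basis_Nil case_prod_unfold)
qed

text \<open>The definition iterates at the last tensor factor, whereas convolution powers recurse on
  the first. Once everything is multiplied out, the first application of \<open>D\<close> can be
  separated, which turns one recursion into the other.\<close>

lemma iter_coprod_Suc_Suc:
  assumes "lin D"
  shows "iter_mult (iter_coprod D (Suc (Suc a)) x)
    = lin_ext (\<lambda>(u, v). basis u * iter_mult (iter_coprod D (Suc a) (basis v))) (D x)"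
proof (rule lin_eqI[where x=x])
  show "lin (\<lambda>x. iter_mult (iter_coprod D (Suc (Suc a)) x))"
    unfolding iter_coprod_def by (rule lin_compose[OF lin_iter_mult_on_last lin_lin_ext])
  show "lin (\<lambda>x. lin_ext (\<lambda>(u, v). basis u * iter_mult (iter_coprod D (Suc a) (basis v))) (D x))"
    by (rule lin_lin_ext'[OF assms])
  fix w
  have "iter_mult (iter_coprod D (Suc (Suc a)) (basis w)) = iter_mult ((on_last D ^^ a) 
        (lin_ext (\<lambda>(u, v). basis [u, v]) (D (basis w))))"
    unfolding iter_coprod_def diff_Suc_1 funpow_Suc_right o_apply by (simp add: on_last_def)
  also have "\<dots> = lin_ext (\<lambda>(u, v). basis u * iter_mult ((on_last D ^^ a) (basis [v]))) (D (basis w))"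
    by (subst lin_ext_comp[OF lin_iter_mult_on_last], rule lin_ext_cong)
       (auto simp: iter_mult_on_last[of "[_, _]"])
  finally show "iter_mult (iter_coprod D (Suc (Suc a)) (basis w))
      = lin_ext (\<lambda>(u, v). basis u * iter_mult (iter_coprod D (Suc a) (basis v))) (D (basis w))"
    by (simp add: iter_coprod_def)
qed

lemma iter_coprod_1: "iter_mult (iter_coprod D (Suc 0) x) = x"
proof (rule lin_eqI[where x=x])
  show "lin (\<lambda>x. iter_mult (iter_coprod D (Suc 0) x))"
    unfolding iter_coprod_def by (rule lin_compose[OF lin_iter_mult_on_last lin_lin_ext])
qed (auto simp: lin_intros iter_coprod_def iter_mult_basis)

text \<open>The exponent starts at 1: truncated subtraction makes \<open>iter_coprod\<close> at 0
  the same as at 1, whereas \<open>\<Psi> 0\<close> is the convolution unit.\<close>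

lemma hopf_power_Suc: "hopf_power \<Delta> (Suc n) = \<Psi> (Suc n)"
proof (induction n)
  case 0
  then show ?case by (simp add: fun_eq_iff hopf_power_def iter_coprod_1 conv_unit_right lin_id)
next
  case (Suc n)
  have "hopf_power \<Delta> (Suc (Suc n)) x = conv (\<lambda>x. x) (hopf_power \<Delta> (Suc n)) x" for x
    unfolding hopf_power_def conv_def by (rule iter_coprod_Suc_Suc[OF coprod_linear])
  then show ?case by (simp add: Suc fun_eq_iff)
qed

lemma hopf_power_eq_cpow: "a \<ge> 1 \<Longrightarrow> hopf_power \<Delta> a = \<Psi> a"
  using hopf_power_Suc[of "a - 1"] by simp

lemma hopf_power_2: "hopf_power \<Delta> 2 x = tensor_mult (\<Delta> x)"
  by (simp add: hopf_power_eq_cpow numeral_2_eq_2 conv_unit_right lin_id conv_def tensor_mult_def basis_append)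

section \<open>Convolution powers of the projection onto positive degree\<close>

definition aug_proj :: "('c, 'k) free_alg \<Rightarrow> ('c, 'k) free_alg" where
  "aug_proj x = x - conv_unit x"

lemma lin_aug_proj [lin_intros]: "lin h \<Longrightarrow> lin (\<lambda>x. aug_proj (h x))"
  unfolding aug_proj_def by (intro lin_intros)

lemma aug_proj_basis: "aug_proj (basis w) = (if w = [] then 0 else basis w)"
  by (simp add: aug_proj_def conv_unit_basis basis_Nil)

lemma coprod_basis_Nil: "\<Delta> (basis []) = basis ([], [])"
proof -
  have "basis ([], []) = (1 :: 'c list \<times> 'c list \<Rightarrow>\<^sub>0 'k)"
    using basis_zero[where 'd="'c list \<times> 'c list"] by (simp add: zero_prod_def zero_list_def)
  then show ?thesis by (simp add: basis_Nil coprod_one)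
qed

lemma cpow_aug_proj_Nil: "cpow aug_proj (Suc k) (basis []) = 0"
  by (simp add: conv_def coprod_basis_Nil aug_proj_basis)

text \<open>By the counit axioms the terms of the coproduct with an empty factor are exactly the two
  that are subtracted. For the empty word these two coincide, so that \<open>([], [])\<close> keeps
  the coefficient -1; hence the first assumption.\<close>

lemma keys_reduced_coprod:
  assumes "w \<noteq> []" "(u, v) \<in> keys (reduced_coprod \<Delta> (basis w))"
  shows "u \<noteq> []" "v \<noteq> []" "(u, v) \<in> keys (\<Delta> (basis w))"
  using assms
  by (auto simp: reduced_coprod_def in_keys_iff lookup_minus lookup_tensor lookup_coprod_Nil_left
      lookup_coprod_Nil_right lookup_basis basis_Nil[symmetric] split: if_splits)

lemma lin_reduced_coprod: "lin (reduced_coprod \<Delta>)"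
proof -
  have "reduced_coprod \<Delta> = (\<lambda>x. \<Delta> x - tensor 1 x - tensor x 1)"
    by (simp add: fun_eq_iff reduced_coprod_def)
  then show ?thesis by (simp only:) (intro lin_intros)
qed

lemma iter_reduced_coprod:
  "w \<noteq> [] \<Longrightarrow> iter_mult (iter_coprod (reduced_coprod \<Delta>) (Suc a) (basis w)) = cpow aug_proj (Suc a) (basis w)"
proof (induction a arbitrary: w)
  case 0
  have "lin aug_proj" using lin_aug_proj[OF lin_id] by simp
  with 0 show ?case by (simp add: iter_coprod_1 conv_unit_right aug_proj_basis)
next
  case (Suc a)
  define G where "G = (\<lambda>(u, v). aug_proj (basis u) * cpow aug_proj (Suc a) (basis v))"
  have "iter_mult (iter_coprod (reduced_coprod \<Delta>) (Suc (Suc a)) (basis w))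
      = lin_ext G (reduced_coprod \<Delta> (basis w))"
    unfolding iter_coprod_Suc_Suc[OF lin_reduced_coprod] G_def
    using keys_reduced_coprod[OF Suc.prems]
    by (intro lin_ext_cong) (auto simp: Suc.IH aug_proj_basis simp del: cpow.simps)
  also have "\<dots> = lin_ext G (\<Delta> (basis w)) - lin_ext G (tensor 1 (basis w)) - lin_ext G (tensor (basis w) 1)"
    by (simp add: reduced_coprod_def lin_diff[OF lin_lin_ext])
  \<comment> \<open>\<open>G\<close> vanishes as soon as one of the two words is empty, because
    \<open>aug_proj\<close> kills the unit.\<close>
  also have "\<dots> = lin_ext G (\<Delta> (basis w))"
    by (simp add: basis_Nil[symmetric] G_def aug_proj_basis cpow_aug_proj_Nil del: cpow.simps)
  finally show ?case by (simp add: G_def conv_def)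
qed

text \<open>Each convolution factor consumes positive degree. Hence the Eulerian series is finite
  and \<open>\<Psi>\<close> is polynomial in its exponent.\<close>

lemma cpow_aug_proj_eq_0: "k > wdeg deg w \<Longrightarrow> cpow aug_proj k (basis w) = 0"
proof (induction k arbitrary: w)
  case (Suc k)
  have "aug_proj (basis u) * cpow aug_proj k (basis v) = 0" if "(u, v) \<in> keys (\<Delta> (basis w))" for u v
  proof (cases "u = []")
    case False
    then have "wdeg deg u > 0" by (simp flip: wdeg_eq_0_iff)
    with wdeg_coprod[OF that] Suc.prems show ?thesis by (simp add: Suc.IH)
  qed (simp add: aug_proj_basis)
  then have "conv aug_proj (cpow aug_proj k) (basis w) = lin_ext (\<lambda>_. 0) (\<Delta> (basis w))"
    unfolding conv_def by (intro lin_ext_cong) auto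
  then show ?case by (simp add: lin_ext_def)
qed simp

lemma wdeg_cpow:
  assumes "\<And>u z. z \<in> keys (f (basis u)) \<Longrightarrow> wdeg deg z = wdeg deg u"
  shows "z \<in> keys (cpow f k (basis w)) \<Longrightarrow> wdeg deg z = wdeg deg w"
proof (induction k arbitrary: w z)
  case 0
  then show ?case by (auto simp: conv_unit_basis zero_list_def split: if_splits)
next
  case (Suc k)
  then have "z \<in> keys (lin_ext (\<lambda>(u, v). f (basis u) * cpow f k (basis v)) (\<Delta> (basis w)))"
    by (simp add: conv_def)
  then obtain u v where uv: "(u, v) \<in> keys (\<Delta> (basis w))" "z \<in> keys (f (basis u) * cpow f k (basis v))"
    using keys_lin_ext by fastforce
  from uv(2) show ?case
    by (elim keys_mult_wordE) (use wdeg_coprod[OF uv(1)] assms Suc.IH in auto)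
qed

lemma length_cpow_aug_proj: "z \<in> keys (cpow aug_proj k (basis w)) \<Longrightarrow> k \<le> length z"
proof (induction k arbitrary: w z)
  case (Suc k)
  then have "z \<in> keys (lin_ext (\<lambda>(u, v). aug_proj (basis u) * cpow aug_proj k (basis v)) (\<Delta> (basis w)))"
    by (simp add: conv_def)
  then obtain u v where uv: "(u, v) \<in> keys (\<Delta> (basis w))" 
      "z \<in> keys (aug_proj (basis u) * cpow aug_proj k (basis v))"
    using keys_lin_ext by fastforce
  from uv(2) show ?case
    by (elim keys_mult_wordE)
      (auto simp: aug_proj_basis dest!: Suc.IH split: if_splits simp flip: length_greater_0_conv)
qed simp

lemma wdeg_cpow_id: "z \<in> keys (\<Psi> k (basis w)) \<Longrightarrow> wdeg deg z = wdeg deg w"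
  by (rule wdeg_cpow) auto

lemma finite_words: "finite (words deg n)"
proof -
  obtain B :: "('c, 'k) free_alg set" where B: "finite B" "pmv.span B = homog deg n"
    using finite_dim by blast
  have "basis ` words deg n \<subseteq> pmv.span B" unfolding B(2) by (auto simp: homog_def)
  then have "finite (basis ` words deg n :: ('c, 'k) free_alg set)"
    using pmv.independent_span_bound[OF B(1) conjunct2[OF independent_basis]] by blast
  then show ?thesis
    using conjunct1[OF independent_basis[where 'k='k]] by (rule finite_imageD)
qed

end

section \<open>Primitivity of the Eulerian idempotent\<close>

definition binomial_poly :: "nat \<Rightarrow> 'k::field_char_0 poly" where
  "binomial_poly k = Polynomial.smult (1 / fact k) (\<Prod>i<k. [:- of_nat i, 1:])"

lemma poly_binomial_poly: "poly (binomial_poly k) (of_nat n) = of_nat (n choose k)"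
  by (simp add: binomial_poly_def poly_prod binomial_gbinomial gbinomial_prod_rev lessThan_atLeast0)

lemma coeff_binomial_poly_0: "coeff (binomial_poly k) 0 = (if k = 0 then 1 else 0)"
  using poly_binomial_poly[of k 0] by (cases k) (simp_all add: poly_0_coeff_0)

text \<open>The origin of the coefficients of the Eulerian idempotent: the factor with
  \<open>i = 0\<close> supplies the variable, and the constant terms of the others multiply to a
  sign times the factorial of \<open>k - 1\<close>, to be divided by that of
  \<open>k\<close>.\<close>

lemma coeff_binomial_poly_1: "coeff (binomial_poly k :: 'k::field_char_0 poly) (Suc 0)
    = (if k = 0 then 0 else (-1) ^ (k - 1) / of_nat k)"
proof (cases k)
  case (Suc m)
  define P where "P = (\<Prod>i<m. [:- of_nat (Suc i), 1 :: 'k:])"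
  have "(\<Prod>i<Suc m. [:- of_nat i, 1:]) = [:0, 1:] * P"
    unfolding P_def by (subst prod.lessThan_Suc_shift) simp
  then have "binomial_poly k = Polynomial.smult (1 / (of_nat k * fact m)) (pCons 0 P)"
    using Suc by (simp add: binomial_poly_def)
  moreover have "coeff P 0 = (-1) ^ m * fact m"
    unfolding P_def by (induction m) (simp_all add: coeff_mult algebra_simps)
  ultimately show ?thesis
    using Suc by simp
qed (simp add: binomial_poly_def)

text \<open>Stated for an arbitrary infinite set of exponents, since besides all naturals also the
  positive ones and the powers of two are used.\<close>

lemma poly_eq_of_nat:
  fixes p q :: "'k::field_char_0 poly"
  assumes "infinite A" "\<And>n. n \<in> A \<Longrightarrow> poly p (of_nat n) = poly q (of_nat n)"
  shows "p = q"
proof (rule ccontr)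
  assume "p \<noteq> q"
  then have "finite {x. poly (p - q) x = 0}" by (intro poly_roots_finite) simp
  moreover have "of_nat ` A \<subseteq> {x. poly (p - q) x = 0}" using assms(2) by auto
  ultimately have "finite (of_nat ` A :: 'k set)" by (rule rev_finite_subset)
  then have "finite A" by (rule finite_imageD) (simp add: inj_on_def)
  with assms(1) show False by simp
qed

lemma coeff_mult_1: "coeff (p * q) (Suc 0) = coeff p 0 * coeff q (Suc 0) + coeff p (Suc 0) * coeff q 0"
  by (simp add: coeff_mult)

context hopf_char0
begin

text \<open>The identity is \<open>conv_unit\<close> plus \<open>aug_proj\<close>, and
  \<open>conv_unit\<close> is neutral for convolution; so this is the binomial theorem, proved by
  Pascal's rule.\<close>

lemma cpow_id_binomial:
  "\<Psi> n x = (\<Sum>k\<le>n. scale_pm (of_nat (n choose k)) (cpow aug_proj k x))"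
proof (induction n arbitrary: x)
  case (Suc n)
  let ?J = "\<lambda>k. cpow aug_proj k x"
  have conv_sum: "conv f (\<Psi> n) x = (\<Sum>k\<le>n. scale_pm (of_nat (n choose k)) (conv f (cpow aug_proj k) x))"
    for f
  proof -
    have "conv f (\<Psi> n) x
        = lin_ext (\<lambda>(u, v). \<Sum>k\<le>n. scale_pm (of_nat (n choose k)) (f (basis u) * cpow aug_proj k (basis v))) (\<Delta> x)"
      unfolding conv_def by (intro lin_ext_cong) (auto simp: Suc.IH sum_distrib_left)
    also have "\<dots> = (\<Sum>k\<le>n. scale_pm (of_nat (n choose k)) (conv f (cpow aug_proj k) x))"
      unfolding conv_def lin_ext_def case_prod_unfold
      by (simp add: pmv.scale_sum_right mult.commute) (rule sum.swap)
    finally show ?thesis .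
  qed
  have "\<Psi> (Suc n) x = conv (\<lambda>x. conv_unit x + aug_proj x) (\<Psi> n) x"
    by (simp add: aug_proj_def)
  also have "\<dots> = \<Psi> n x + conv aug_proj (\<Psi> n) x"
    unfolding conv_plus_left by (simp add: conv_unit_left[OF lin_cpow'])
  also have "\<dots> = (\<Sum>k\<le>n. scale_pm (of_nat (n choose k)) (?J k))
      + (\<Sum>k\<le>n. scale_pm (of_nat (n choose k)) (?J (Suc k)))"
    by (simp add: conv_sum Suc.IH)
  also have "(\<Sum>k\<le>n. scale_pm (of_nat (n choose k)) (?J k))
      = (\<Sum>k\<le>Suc n. scale_pm (of_nat (n choose k)) (?J k))" by simp
  also have "\<dots> = ?J 0 + (\<Sum>k\<le>n. scale_pm (of_nat (n choose Suc k)) (?J (Suc k)))"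
    by (subst sum.atMost_Suc_shift) simp
  also have "\<dots> + (\<Sum>k\<le>n. scale_pm (of_nat (n choose k)) (?J (Suc k)))
      = ?J 0 + (\<Sum>k\<le>n. scale_pm (of_nat (Suc n choose Suc k)) (?J (Suc k)))"
    by (simp add: pmv.scale_left_distrib sum.distrib algebra_simps)
  also have "\<dots> = (\<Sum>k\<le>Suc n. scale_pm (of_nat (Suc n choose k)) (?J k))"
    by (subst sum.atMost_Suc_shift) simp
  finally show ?case .
qed simp

text \<open>The coefficient of \<open>z\<close> in \<open>\<Psi> n (basis w)\<close> as a polynomial
  in \<open>n\<close>. By \<open>cpow_aug_proj_eq_0\<close> the cutoff at the degree of
  \<open>w\<close> loses nothing, and it makes the range of summation independent of
  \<open>n\<close>.\<close>

definition hopf_power_poly :: "'c list \<Rightarrow> 'c list \<Rightarrow> 'k poly" where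
  "hopf_power_poly w z =
     (\<Sum>k\<le>wdeg deg w. Polynomial.smult (lookup (cpow aug_proj k (basis w)) z) (binomial_poly k))"

lemma poly_hopf_power_poly:
  "poly (hopf_power_poly w z) (of_nat n) = lookup (\<Psi> n (basis w)) z"
proof -
  let ?t = "\<lambda>k. of_nat (n choose k) * lookup (cpow aug_proj k (basis w)) z"
  have "lookup (\<Psi> n (basis w)) z = (\<Sum>k\<le>n. ?t k)"
    by (simp add: cpow_id_binomial lookup_sum)
  also have "\<dots> = (\<Sum>k\<le>max n (wdeg deg w). ?t k)"
    by (rule sum.mono_neutral_left) (auto simp: binomial_eq_0)
  also have "\<dots> = (\<Sum>k\<le>wdeg deg w. ?t k)"
    by (rule sum.mono_neutral_right) (auto simp: cpow_aug_proj_eq_0)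
  finally show ?thesis
    by (simp add: hopf_power_poly_def poly_sum poly_binomial_poly mult.commute)
qed

lemma coeff_hopf_power_poly_0: "coeff (hopf_power_poly w z) 0 = (if w = [] \<and> z = [] then 1 else 0)"
  using poly_hopf_power_poly[of w z 0]
  by (simp add: poly_0_coeff_0 conv_unit_basis lookup_one zero_list_def when_def)

text \<open>The Eulerian series carries exactly the linear coefficients of the binomial polynomials.
  The empty word is set apart, since there the series does not terminate.\<close>

lemma coeff_hopf_power_poly_1:
  "coeff (hopf_power_poly w z) (Suc 0) = (if w = [] then 0 else lookup (eulerian \<Delta> (basis w)) z)"
proof (cases "w = []")
  case False
  let ?s = "\<lambda>k. scale_pm ((-1) ^ (k - 1) / of_nat k) (cpow aug_proj k (basis w))"
  have eq: "(if k \<ge> 1 then scale_pm ((-1) ^ (k - 1) / of_nat k)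
      (iter_mult (iter_coprod (reduced_coprod \<Delta>) k (basis w))) else 0)
      = (if k \<in> {1..wdeg deg w} then ?s k else 0)" for k
  proof (cases k)
    case (Suc m)
    show ?thesis
      using iter_reduced_coprod[OF False, of m] cpow_aug_proj_eq_0[of w k] Suc
      by (auto simp del: cpow.simps)
  qed simp
  have "eulerian \<Delta> (basis w) = (\<Sum>k\<in>{1..wdeg deg w}. ?s k)"
    unfolding eulerian_def eq
    by (subst Sum_any.expand_superset[of "{1..wdeg deg w}"]) (auto intro: sum.cong)
  then have "lookup (eulerian \<Delta> (basis w)) z
      = (\<Sum>k\<in>{1..wdeg deg w}. (-1) ^ (k - 1) / of_nat k * lookup (cpow aug_proj k (basis w)) z)"
    by (simp add: lookup_sum)
  also have "\<dots> = (\<Sum>k\<le>wdeg deg w. coeff (binomial_poly k) (Suc 0) * lookup (cpow aug_proj k (basis w)) z)"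
    by (rule sum.mono_neutral_cong_left) (auto simp: coeff_binomial_poly_1)
  finally show ?thesis
    using False by (simp add: hopf_power_poly_def coeff_sum mult.commute)
qed (simp add: hopf_power_poly_def binomial_poly_def)

text \<open>A coefficient that vanishes in all positive Hopf powers is a polynomial with infinitely
  many zeros, so its linear coefficient vanishes too.\<close>

lemma keys_eulerian:
  assumes "w \<noteq> []" "z \<in> keys (eulerian \<Delta> (basis w))"
  shows "\<exists>n\<ge>1. z \<in> keys (hopf_power \<Delta> n (basis w))" "wdeg deg z = wdeg deg w"
proof -
  show *: "\<exists>n\<ge>1. z \<in> keys (hopf_power \<Delta> n (basis w))"
  proof (rule ccontr)
    assume "\<not> ?thesis"
    then have "hopf_power_poly w z = 0"
      by (intro poly_eq_of_nat[of "{1..}"])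
         (auto simp: poly_hopf_power_poly hopf_power_eq_cpow in_keys_iff infinite_Ici)
    with coeff_hopf_power_poly_1[of w z] assms show False by (auto simp: in_keys_iff)
  qed
  then show "wdeg deg z = wdeg deg w" by (auto simp: hopf_power_eq_cpow dest: wdeg_cpow_id)
qed

text \<open>The coproduct is the convolution of the embeddings \<open>i1\<close> and
  \<open>i2\<close> into the tensor square, and cocommutativity says that these commute under
  convolution. As the coproduct is an algebra homomorphism, the left side is its convolution power,
  which therefore splits into those of \<open>i1\<close> and \<open>i2\<close>.\<close>

lemma coprod_cpow_id: "\<Delta> (\<Psi> n x)
  = lin_ext (\<lambda>(u, v). tensor (\<Psi> n (basis u)) (\<Psi> n (basis v))) (\<Delta> x)"
proof -
  define i1 i2 :: "('c, 'k) free_alg \<Rightarrow> ('c list \<times> 'c list \<Rightarrow>\<^sub>0 'k)"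
    where i: "i1 = (\<lambda>x. tensor x 1)" "i2 = (\<lambda>x. tensor 1 x)"
  have lin: "lin i1" "lin i2" unfolding i by (intro lin_intros)+
  have \<Delta>: "\<Delta> = conv i1 i2"
    by (rule ext, subst lin_eq_lin_ext[of "\<lambda>x. x", OF lin_id])
       (auto simp: conv_def i tensor_mult_tensor intro!: lin_ext_cong)
  have "conv i2 i1 x = tensor_swap (\<Delta> x)" for x
    unfolding conv_def tensor_swap_def by (auto simp: i tensor_mult_tensor intro!: lin_ext_cong)
  then have comm: "conv i1 i2 = conv i2 i1"
    by (simp add: fun_eq_iff cocommutative flip: \<Delta>)
  have "\<Delta> (\<Psi> n x) = cpow \<Delta> n x"
    by (subst cpow_hom[OF coprod_linear coprod_one coprod_mult]) simp
  also have "\<dots> = conv (cpow i1 n) (cpow i2 n) x"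
    by (subst \<Delta>, subst cpow_conv[OF lin comm]) simp
  also have "cpow i1 n = (\<lambda>x. tensor (\<Psi> n x) 1)"
    unfolding i using cpow_hom[of "\<lambda>x. tensor x (1 :: ('c, 'k) free_alg)" "\<lambda>x. x" n]
    by (simp add: fun_eq_iff lin_intros tensor_one_one tensor_mult_tensor)
  also have "cpow i2 n = (\<lambda>x. tensor 1 (\<Psi> n x))"
    unfolding i using cpow_hom[of "\<lambda>x. tensor (1 :: ('c, 'k) free_alg) x" "\<lambda>x. x" n]
    by (simp add: fun_eq_iff lin_tensor_right[OF lin_id] tensor_one_one tensor_mult_tensor)
  finally show ?thesis by (simp add: conv_def tensor_mult_tensor)
qed

definition primitive :: "('c, 'k) free_alg \<Rightarrow> bool" where
  "primitive x \<longleftrightarrow> \<Delta> x = tensor x 1 + tensor 1 x"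

lemma primitive_eulerian:
  assumes "w \<noteq> []"
  shows "primitive (eulerian \<Delta> (basis w))"
  unfolding primitive_def
proof (rule poly_mapping_eqI, clarify)
  fix z1 z2
  let ?W = "words deg (wdeg deg w)" and ?K = "keys (\<Delta> (basis w))"
  let ?e = "eulerian \<Delta> (basis w)"
  \<comment> \<open>\<open>p\<close> and \<open>q\<close> are the coefficients at
    \<open>(z1, z2)\<close> of the two sides of \<open>coprod_cpow_id\<close>, as polynomials in the
    exponent.\<close>
  define p where "p = (\<Sum>z\<in>?W. Polynomial.smult (lookup (\<Delta> (basis z)) (z1, z2)) (hopf_power_poly w z))"
  define q where "q = (\<Sum>b\<in>?K. Polynomial.smult (lookup (\<Delta> (basis w)) b)
    (hopf_power_poly (fst b) z1 * hopf_power_poly (snd b) z2))"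
  have lookup_coprod: "lookup (\<Delta> y) (z1, z2) = (\<Sum>z\<in>?W. lookup (\<Delta> (basis z)) (z1, z2) * lookup y z)"
    if "keys y \<subseteq> ?W" for y
    by (subst lin_eq_lin_ext[OF coprod_linear], subst lin_ext_superset[OF finite_words that])
       (simp add: lookup_sum mult.commute)
  have "p = q"
  proof (rule poly_eq_of_nat[of UNIV])
    fix n
    have "keys (\<Psi> n (basis w)) \<subseteq> ?W"
      by (auto simp: words_def dest: wdeg_cpow_id)
    then have "poly p (of_nat n) = lookup (\<Delta> (\<Psi> n (basis w))) (z1, z2)"
      by (subst lookup_coprod) (simp_all add: p_def poly_sum poly_hopf_power_poly)
    also have "\<dots> = poly q (of_nat n)"
      by (simp add: coprod_cpow_id q_def poly_sum poly_hopf_power_poly lookup_lin_ext lookup_tensor case_prod_unfold)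
    finally show "poly p (of_nat n) = poly q (of_nat n)" .
  qed simp
  moreover have "keys ?e \<subseteq> ?W" using keys_eulerian[OF assms] by (auto simp: words_def)
  then have "coeff p (Suc 0) = lookup (\<Delta> ?e) (z1, z2)"
    using assms by (subst lookup_coprod) (simp_all add: p_def coeff_sum coeff_hopf_power_poly_1)
  moreover have "coeff q (Suc 0) = lookup (tensor ?e 1 + tensor 1 ?e) (z1, z2)"
  proof -
    \<comment> \<open>The linear coefficient of a product needs a constant coefficient from one
      factor, and that is nonzero only between empty words. So only the two trivial terms of the
      coproduct of \<open>w\<close> survive.\<close>
    have "coeff q (Suc 0) = (\<Sum>b\<in>?K. (if b = ([], w) then if z1 = [] then lookup ?e z2 else 0 else 0)
       + (if b = (w, []) then if z2 = [] then lookup ?e z1 else 0 else 0))"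
      unfolding q_def coeff_sum
    proof (rule sum.cong[OF refl], clarify)
      fix u v
      assume "(u, v) \<in> ?K"
      moreover have "lookup (\<Delta> (basis w)) ([], v) = (if v = w then 1 else 0)"
         "lookup (\<Delta> (basis w)) (u, []) = (if u = w then 1 else 0)"
        by (auto simp: lookup_coprod_Nil_left lookup_coprod_Nil_right lookup_basis)
      ultimately show "coeff (Polynomial.smult (lookup (\<Delta> (basis w)) (u, v))
            (hopf_power_poly (fst (u, v)) z1 * hopf_power_poly (snd (u, v)) z2)) (Suc 0) =
          (if (u, v) = ([], w) then if z1 = [] then lookup ?e z2 else 0 else 0) +
          (if (u, v) = (w, []) then if z2 = [] then lookup ?e z1 else 0 else 0)"
        using assms unfolding coeff_smult coeff_mult_1 coeff_hopf_power_poly_0 coeff_hopf_power_poly_1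
        by (auto simp: in_keys_iff split: if_splits)
    qed
    moreover have "([], w) \<in> ?K" "(w, []) \<in> ?K"
      by (simp_all add: in_keys_iff lookup_coprod_Nil_left lookup_coprod_Nil_right)
    ultimately show ?thesis
      by (simp add: sum.distrib sum.delta lookup_add lookup_tensor lookup_one zero_list_def when_def)
  qed
  ultimately show "lookup (\<Delta> ?e) (z1, z2) = lookup (tensor ?e 1 + tensor 1 ?e) (z1, z2)" by simp
qed

end

section \<open>Lyndon words\<close>

lemma list_less_cases:
  assumes "u < (v :: 'c::linorder list)"
  obtains (prefix) a s where "v = u @ a # s"
  | (mismatch) p a b s t where "a < b" "u = p @ a # s" "v = p @ b # t"
  using assms unfolding list_less_def lexord_def by blast

lemma list_less_appendI: "w \<noteq> [] \<Longrightarrow> u < u @ (w :: 'c::linorder list)"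
  by (induction u) (auto simp: neq_Nil_conv)

lemma list_less_append_same [simp]: "u @ v < u @ w \<longleftrightarrow> v < (w :: 'c::linorder list)"
  by (induction u) auto

lemma list_less_append_mono:
  assumes "u < (v :: 'c::linorder list)" "length v \<le> length u"
  shows "u @ x < v @ y"
  using assms by (cases rule: list_less_cases) auto

lemma list_le_append_mono:
  assumes "u \<le> (u' :: 'c::linorder list)" "length u = length u'" "v \<le> v'"
  shows "u @ v \<le> u' @ v'"
  using assms list_less_append_mono[of u u' v v'] by (cases "u = u'") (auto simp: order.order_iff_strict)

text \<open>The classical equivalence of the rotation and suffix descriptions; later arguments use
  the suffix form.\<close>

lemma lyndon_iff_suffix:
  "lyndon w \<longleftrightarrow> w \<noteq> [] \<and> (\<forall>u v. w = u @ v \<longrightarrow> u \<noteq> [] \<longrightarrow> v \<noteq> [] \<longrightarrow> w < v)"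
proof (intro iffI conjI allI impI)
  assume "lyndon w"
  then show "w \<noteq> []" by (simp add: lyndon_def)
next
  fix u v assume "lyndon w" and w: "w = u @ v" and ne: "u \<noteq> []" "v \<noteq> []"
  then have nonempty: "w \<noteq> []" by (simp add: lyndon_def)
  have rot: "w < v @ u" if "w = u @ v" "u \<noteq> []" "v \<noteq> []" for u v
  proof -
    have "w < rotate (length u) w"
      using \<open>lyndon w\<close> that by (auto simp: lyndon_def)
    then show ?thesis by (simp add: that(1) rotate_append)
  qed
  show "w < v"
  proof (rule ccontr)
    assume "\<not> w < v"
    then have "v < u @ v" using w ne by (auto simp: not_less list_le_def)
    then show False
    proof (cases rule: list_less_cases)
      \<comment> \<open>Here \<open>v\<close> is both a prefix and a suffix of \<open>w\<close>.
        Comparing \<open>w\<close> with its rotation \<open>v @ u\<close> gives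
        \<open>u' < u\<close>, and comparing it with the rotation \<open>u' @ v\<close> gives the
        opposite.\<close>
      case (prefix a s)
      define u' where "u' = a # s"
      have eq: "u @ v = v @ u'" using prefix by (simp add: u'_def)
      have "v @ u' < v @ u" using rot[OF w ne] w eq by simp
      then have "u' < u" by simp
      moreover have "length u' = length u" using arg_cong[OF eq, of length] by simp
      ultimately have "u' @ v < u @ v" by (intro list_less_append_mono) simp_all
      moreover have "w < u' @ v" using rot[of v u'] eq w ne by (simp add: u'_def)
      ultimately show False using w by simp
    next
      case (mismatch p a b s t)
      have "v @ u < u @ v"
        unfolding mismatch(3) by (simp add: mismatch(2) mismatch(1))
      with rot[OF w ne] w show False by simp
    qed
  qed
next
  assume "w \<noteq> [] \<and> (\<forall>u v. w = u @ v \<longrightarrow> u \<noteq> [] \<longrightarrow> v \<noteq> [] \<longrightarrow> w < v)"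
  then have *: "w \<noteq> []" "\<forall>u v. w = u @ v \<longrightarrow> u \<noteq> [] \<longrightarrow> v \<noteq> [] \<longrightarrow> w < v" by auto
  show "lyndon w"
    unfolding lyndon_def
  proof (intro conjI allI impI)
    fix i assume i: "0 < i \<and> i < length w"
    have "w < drop i w" using *(1) *(2)[rule_format, of "take i w" "drop i w"] i by auto
    then have "w @ [] < drop i w @ take i w"
      by (intro list_less_append_mono) auto
    then show "w < rotate i w" using i by (simp add: rotate_drop_take)
  qed (use * in simp)
qed

lemma lyndonD: "lyndon (u @ v) \<Longrightarrow> u \<noteq> [] \<Longrightarrow> v \<noteq> [] \<Longrightarrow> u @ v < v"
  by (simp add: lyndon_iff_suffix)

lemma lyndon_nonempty: "lyndon w \<Longrightarrow> w \<noteq> []"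
  by (simp add: lyndon_def)

lemma lyndon_singleton: "lyndon [c]"
  by (auto simp: lyndon_iff_suffix Cons_eq_append_conv)

text \<open>The crucial suffix is \<open>v\<close>: once \<open>u @ v < v\<close> is known, proper
  suffixes of \<open>v\<close> are larger still, and those starting inside \<open>u\<close> are
  decided by \<open>u\<close> being Lyndon.\<close>

lemma lyndon_append:
  assumes "lyndon u" "lyndon v" "u < v"
  shows "lyndon (u @ v)"
proof -
  have less: "u @ v < v"
    using assms(3)
  proof (cases rule: list_less_cases)
    \<comment> \<open>\<open>v = u @ a # s\<close> is Lyndon, so \<open>v < a # s\<close>; putting
      \<open>u\<close> in front of both gives the claim.\<close>
    case (prefix a s)
    then have "v < a # s" using lyndonD[of u "a # s"] assms lyndon_nonempty[of u] by simp
    then show ?thesis using prefix by (metis list_less_append_same)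
  next
    case (mismatch p a b s t)
    then show ?thesis by simp
  qed
  show ?thesis
    unfolding lyndon_iff_suffix
  proof (intro conjI allI impI)
    fix x y assume xy: "u @ v = x @ y" "x \<noteq> []" "y \<noteq> []"
    then consider (1) z where "u = x @ z" "y = z @ v" | (2) z where "x = u @ z" "v = z @ y"
      by (auto simp: append_eq_append_conv2)
    then show "u @ v < y"
    proof cases
      case 1
      show ?thesis
      proof (cases "z = []")
        case False
        then have "u < z" using lyndonD[of x z] 1 xy assms by simp
        then have "u @ v < z @ v" using 1 by (intro list_less_append_mono) auto
        then show ?thesis using 1 by simp
      qed (use less 1 in simp)
    next
      case 2
      show ?thesis
      proof (cases "z = []")
        case False
        then show ?thesis using lyndonD[of z y] 2 xy assms less by simp
      qed (use less 2 in simp)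
    qed
  qed (use lyndon_nonempty[OF assms(1)] in simp)
qed

section \<open>Existence and uniqueness of the Lyndon factorization\<close>

definition lyndon_factorization :: "'c::linorder list list \<Rightarrow> bool" where
  "lyndon_factorization bs \<longleftrightarrow> (\<forall>l\<in>set bs. lyndon l) \<and> sorted_wrt (\<ge>) bs"

text \<open>The new word is merged with the head of the list as long as it is smaller; once it is
  not, it can stand in front.\<close>

lemma lyndon_factorization_insert:
  assumes "lyndon l" "lyndon_factorization bs"
  shows "\<exists>cs. concat cs = l @ concat bs \<and> lyndon_factorization cs"
  using assms
proof (induction bs arbitrary: l)
  case Nil
  then show ?case by (intro exI[of _ "[l]"]) (simp add: lyndon_factorization_def)
next
  case (Cons b bs)
  show ?case
  proof (cases "l < b")
    case True
    then have "lyndon (l @ b)" "lyndon_factorization bs"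
      using Cons.prems by (auto simp: lyndon_factorization_def lyndon_append)
    from Cons.IH[OF this] show ?thesis by simp
  next
    case False
    then have "lyndon_factorization (l # b # bs)"
      using Cons.prems by (auto simp: lyndon_factorization_def)
    then show ?thesis by (intro exI[of _ "l # b # bs"]) simp
  qed
qed

lemma lyndon_factorization_exists: "\<exists>bs. concat bs = w \<and> lyndon_factorization bs"
proof (induction w)
  case (Cons c w)
  then show ?case using lyndon_factorization_insert[OF lyndon_singleton[of c]] by auto
qed (auto simp: lyndon_factorization_def intro: exI[of _ "[]"])

text \<open>The prefix stops inside or at the end of some factor; \<open>s\<close> is the part of
  that factor which it covers.\<close>

lemma prefix_of_concat:
  assumes "r @ t = concat cs" "r \<noteq> []" "\<forall>c\<in>set cs. c \<noteq> []"
  shows "\<exists>r' s s'. r = r' @ s \<and> s \<noteq> [] \<and> s @ s' \<in> set cs"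
  using assms
proof (induction cs arbitrary: r)
  case (Cons c cs)
  from Cons.prems(1) consider (1) z where "r = c @ z" "z @ t = concat cs" | (2) z where "c = r @ z"
    by (auto simp: append_eq_append_conv2)
  then show ?case
  proof cases
    case 1
    show ?thesis
    proof (cases "z = []")
      case True
      with 1 Cons.prems show ?thesis by (intro exI[of _ "[]"] exI[of _ c]) auto
    next
      case False
      from Cons.IH[OF 1(2) this] Cons.prems obtain r' s s' where
        "z = r' @ s" "s \<noteq> []" "s @ s' \<in> set cs" by auto
      with 1 show ?thesis by (intro exI[of _ "c @ r'"] exI[of _ s] exI[of _ s']) simp
    qed
  next
    case 2
    with Cons.prems show ?thesis by (intro exI[of _ "[]"] exI[of _ r] exI[of _ z]) simp
  qed
qed simp

text \<open>If \<open>b\<close> were longer than \<open>c\<close>, it would end with a nonempty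
  prefix \<open>s\<close> of some later factor \<open>d\<close> of the other list. Then
  \<open>b < s \<le> d \<le> c < b\<close>: the first because \<open>b\<close> is Lyndon, the last
  because \<open>c\<close> is a proper prefix of \<open>b\<close>.\<close>

lemma lyndon_factorization_unique_aux:
  assumes "lyndon_factorization (b # bs)" "lyndon_factorization (c # cs)"
    and "b @ concat bs = c @ concat cs"
  shows "length b \<le> length c"
proof (rule ccontr)
  assume "\<not> length b \<le> length c"
  then obtain r where r: "b = c @ r" "r \<noteq> []" "r @ concat bs = concat cs"
    using assms(3) by (auto simp: append_eq_append_conv2)
  from r(3,2) have "\<exists>r' s s'. r = r' @ s \<and> s \<noteq> [] \<and> s @ s' \<in> set cs"
    by (rule prefix_of_concat) (use assms(2) in \<open>auto simp: lyndon_factorization_def lyndon_nonempty\<close>)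
  then obtain r' s s' d where d: "r = r' @ s" "s \<noteq> []" "d \<in> set cs" "d = s @ s'" by blast
  have "lyndon b" "lyndon c" "d \<le> c"
    using assms(1,2) d(3) by (auto simp: lyndon_factorization_def)
  then have "b < s"
    using lyndonD[of "c @ r'" s] r d lyndon_nonempty[of c] by simp
  also have "s \<le> d" using d list_less_appendI[of s' s] by (cases "s' = []") auto
  also have "d \<le> c" by fact
  also have "c < b" using r list_less_appendI[of r c] by simp
  finally show False .
qed

lemma lyndon_factorization_unique:
  assumes "lyndon_factorization bs" "lyndon_factorization cs" "concat bs = concat cs"
  shows "bs = cs"
  using assms
proof (induction bs arbitrary: cs)
  case Nil
  then show ?case using lyndon_nonempty by (cases cs) (auto simp: lyndon_factorization_def)
next
  case (Cons b bs)
  have "cs \<noteq> []"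
    using Cons.prems lyndon_nonempty[of b] by (auto simp: lyndon_factorization_def)
  then obtain c cs' where cs: "cs = c # cs'" by (cases cs) auto
  have eq: "b @ concat bs = c @ concat cs'" using Cons.prems(3) cs by simp
  have ly: "lyndon_factorization (b # bs)" "lyndon_factorization (c # cs')"
    using Cons.prems(1,2) cs by simp_all
  have "length b = length c"
    using lyndon_factorization_unique_aux[OF ly eq] lyndon_factorization_unique_aux[OF ly(2,1) eq[symmetric]]
    by (rule antisym)
  with eq have "b = c" "concat bs = concat cs'" by simp_all
  moreover have "lyndon_factorization bs" "lyndon_factorization cs'"
    using Cons.prems cs by (auto simp: lyndon_factorization_def)
  ultimately show ?case using Cons.IH[of cs'] by (simp only: cs)
qed

lemma lyndon_factors_eqI:
  assumes "concat bs = b" "lyndon_factorization bs"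
  shows "lyndon_factors b = bs"
  unfolding lyndon_factors_def
  by (rule the_equality) (use assms lyndon_factorization_unique in \<open>auto simp: lyndon_factorization_def\<close>)

lemma lyndon_factorization_factors: "lyndon_factorization (lyndon_factors b)"
  and concat_lyndon_factors [simp]: "concat (lyndon_factors b) = b"
  using lyndon_factorization_exists[of b] lyndon_factors_eqI by metis+

lemma lyndon_lyndon_factors: "l \<in> set (lyndon_factors b) \<Longrightarrow> lyndon l"
  using lyndon_factorization_factors[of b] by (simp add: lyndon_factorization_def)

lemma inj_mset_lyndon_factors:
  assumes "mset (lyndon_factors b) = mset (lyndon_factors b')"
  shows "b = b'"
proof -
  have "sorted (rev (lyndon_factors b))" for b :: "'a list"
    using lyndon_factorization_factors[of b]
    by (simp add: lyndon_factorization_def sorted_wrt_rev)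
  then have "rev (lyndon_factors b) = rev (lyndon_factors b')"
    using assms by (metis mset_rev properties_for_sort)
  then show ?thesis by (metis concat_lyndon_factors rev_rev_ident)
qed

text \<open>If the front part had several Lyndon factors, the last of them, \<open>z\<close>, could
  not be smaller than the suffix \<open>v\<close>, or \<open>z @ v\<close> would be a longer proper
  Lyndon suffix. Appending \<open>v\<close> would then give a Lyndon factorization of
  \<open>l\<close> into more than one word, against uniqueness.\<close>

lemma lyndon_std_factors:
  assumes "lyndon l" "length l \<ge> 2"
  shows "lyndon (take (std_pos l) l)" "lyndon (drop (std_pos l) l)"
proof -
  have "drop (length l - 1) l = [last l]"
    using assms by (cases l rule: rev_cases) auto
  then have "0 < length l - 1 \<and> length l - 1 < length l \<and> lyndon (drop (length l - 1) l)"
    using assms(2) by (simp add: lyndon_singleton)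
  then have pos: "0 < std_pos l \<and> std_pos l < length l \<and> lyndon (drop (std_pos l) l)"
    unfolding std_pos_def by (rule LeastI)
  then show ly: "lyndon (drop (std_pos l) l)" by simp
  have least: "std_pos l \<le> i" if "0 < i" "i < length l" "lyndon (drop i l)" for i
    unfolding std_pos_def using that by (intro Least_le) simp
  define u v where "u = take (std_pos l) l" and "v = drop (std_pos l) l"
  have l: "l = u @ v" by (simp add: u_def v_def)
  have len: "length u = std_pos l" using pos by (simp add: u_def)
  obtain cs where cs: "concat cs = u" "lyndon_factorization cs"
    using lyndon_factorization_exists by blast
  have "cs \<noteq> []" using cs(1) len pos by auto
  then obtain ds z where ds: "cs = ds @ [z]" by (cases cs rule: rev_cases) auto
  show "lyndon (take (std_pos l) l)"
  proof (cases "ds = []")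
    case True
    with ds cs show ?thesis by (simp add: lyndon_factorization_def u_def)
  next
    case False
    then obtain d ds' where d: "ds = d # ds'" by (cases ds) auto
    have z: "lyndon z" "lyndon d" using cs ds d by (auto simp: lyndon_factorization_def)
    have "\<not> z < v"
    proof
      assume "z < v"
      then have "lyndon (z @ v)" using z ly by (intro lyndon_append) (simp_all add: v_def)
      moreover have "l = concat ds @ z @ v" using cs ds l by auto
      ultimately have "lyndon (drop (length (concat ds)) l)" by simp
      moreover have "concat ds \<noteq> []" using z d lyndon_nonempty[of d] by simp
      moreover have "length (concat ds) < std_pos l"
      proof -
        have "length (concat ds) + length z = std_pos l" using len cs ds by (simp flip: cs(1))
        moreover have "length z > 0" using lyndon_nonempty[OF z(1)] by simp
        ultimately show ?thesis by linarith
      qed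
      ultimately show False using least[of "length (concat ds)"] pos by simp
    qed
    then have "lyndon_factorization (cs @ [v])"
      using cs(2) ds ly by (fastforce simp: lyndon_factorization_def sorted_wrt_append v_def)
    moreover have "lyndon_factorization [l]" using assms by (simp add: lyndon_factorization_def)
    ultimately have "cs @ [v] = [l]"
      by (rule lyndon_factorization_unique) (simp add: cs l)
    then show ?thesis using ds by simp
  qed
qed

section \<open>Polarization\<close>

lemma power_sum_eq_sum_lists:
  fixes x :: "'i \<Rightarrow> 'r::ring_1"
  assumes "finite A"
  shows "(\<Sum>i\<in>A. x i) ^ n = (\<Sum>l | set l \<subseteq> A \<and> length l = n. prod_list (map x l))"
proof (induction n)
  case 0
  have "{l. set l \<subseteq> A \<and> length l = 0} = {[]}" by auto
  then show ?case by simp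
next
  case (Suc n)
  let ?L = "{l. set l \<subseteq> A \<and> length l = n}"
  have "(\<Sum>i\<in>A. x i) ^ Suc n = (\<Sum>i\<in>A. \<Sum>l\<in>?L. x i * prod_list (map x l))"
    by (simp add: Suc sum_product)
  also have "\<dots> = (\<Sum>(l, i)\<in>?L \<times> A. x i * prod_list (map x l))"
    by (subst sum.swap) (simp add: sum.cartesian_product)
  also have "\<dots> = (\<Sum>l | set l \<subseteq> A \<and> length l = Suc n. prod_list (map x l))"
    unfolding lists_length_Suc_eq
    by (subst sum.reindex) (auto simp: inj_on_def intro!: sum.cong)
  finally show ?case .
qed

text \<open>Inclusion-exclusion, by expanding the product of \<open>1 + ?g i\<close>: a term of the
  expansion is nonzero only if \<open>A\<close> contains \<open>T\<close>, while the product
  vanishes as soon as some element of \<open>K\<close> lies outside \<open>T\<close>.\<close>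

lemma sum_signs_supersets:
  assumes "finite K" "T \<subseteq> K"
  shows "(\<Sum>A | T \<subseteq> A \<and> A \<subseteq> K. (-1) ^ (card K - card A)) = (if T = K then 1 else 0 :: 'r::comm_ring_1)"
proof -
  let ?g = "\<lambda>i. if i \<in> T then 0 else -1 :: 'r"
  have "(\<Prod>i\<in>K. 1 + ?g i) = (\<Sum>A\<in>Pow K. (\<Prod>i\<in>A. 1) * (\<Prod>i\<in>K - A. ?g i))"
    by (rule prod_add[OF assms(1)])
  also have "\<dots> = (\<Sum>A\<in>Pow K. if T \<subseteq> A then (-1) ^ (card K - card A) else 0)"
  proof (rule sum.cong[OF refl])
    fix A assume A: "A \<in> Pow K"
    then have fin: "finite (K - A)" "finite A" using assms(1) by (auto intro: finite_subset)
    show "(\<Prod>i\<in>A. 1) * (\<Prod>i\<in>K - A. ?g i) = (if T \<subseteq> A then (-1) ^ (card K - card A) else 0)"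
    proof (cases "T \<subseteq> A")
      case True
      then have "(\<Prod>i\<in>K - A. ?g i) = (\<Prod>i\<in>K - A. -1)" by (intro prod.cong) auto
      then show ?thesis using True A fin by (simp add: card_Diff_subset)
    next
      case False
      then obtain i where "i \<in> T" "i \<notin> A" by blast
      with fin assms(2) have "(\<Prod>i\<in>K - A. ?g i) = 0" by (intro prod_zero) auto
      then show ?thesis using False by simp
    qed
  qed
  also have "\<dots> = (\<Sum>A | T \<subseteq> A \<and> A \<subseteq> K. (-1) ^ (card K - card A))"
    using assms(1) by (subst sum.inter_filter[symmetric]) (auto intro: sum.cong)
  finally have "(\<Sum>A | T \<subseteq> A \<and> A \<subseteq> K. (-1) ^ (card K - card A)) = (\<Prod>i\<in>K. 1 + ?g i)" ..
  also have "\<dots> = (if T = K then 1 else 0)"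
  proof (cases "T = K")
    case False
    then obtain i where "i \<in> K" "i \<notin> T" using assms(2) by blast
    then have "(\<Prod>i\<in>K. 1 + ?g i) = 0" using assms(1) by (intro prod_zero) auto
    then show ?thesis using False by simp
  qed simp
  finally show ?thesis .
qed

text \<open>Expanding the powers gives words of length \<open>k\<close> in the indices; by
  \<open>sum_signs_supersets\<close> only those that use all \<open>k\<close> indices survive, and
  these are the permutations. Symmetrized products thus become combinations of powers of single
  elements, where primitivity can be exploited.\<close>

lemma polarization:
  fixes x :: "nat \<Rightarrow> 'r::ring_1"
  shows "(\<Sum>\<sigma> | \<sigma> permutes {..<k}. prod_list (map (\<lambda>i. x (\<sigma> i)) [0..<k]))
    = (\<Sum>A\<in>Pow {..<k}. of_int ((-1) ^ (k - card A)) * (\<Sum>i\<in>A. x i) ^ k)"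
proof -
  let ?K = "{..<k}"
  let ?L = "{l. set l \<subseteq> ?K \<and> length l = k}"
  have fin: "finite ?L" by (rule finite_lists_length_eq) simp
  have "(\<Sum>A\<in>Pow ?K. of_int ((-1) ^ (k - card A)) * (\<Sum>i\<in>A. x i) ^ k)
      = (\<Sum>A\<in>Pow ?K. \<Sum>l\<in>?L. if set l \<subseteq> A then of_int ((-1) ^ (k - card A)) * prod_list (map x l) else 0)"
  proof (rule sum.cong[OF refl])
    fix A assume A: "A \<in> Pow ?K"
    then have "{l \<in> ?L. set l \<subseteq> A} = {l. set l \<subseteq> A \<and> length l = k}" by auto
    moreover have "finite A" using A by (auto intro: finite_subset)
    ultimately show "of_int ((-1) ^ (k - card A)) * (\<Sum>i\<in>A. x i) ^ k
        = (\<Sum>l\<in>?L. if set l \<subseteq> A then of_int ((-1) ^ (k - card A)) * prod_list (map x l) else 0)"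
      by (simp add: power_sum_eq_sum_lists sum_distrib_left sum.inter_filter[OF fin, symmetric])
  qed
  also have "\<dots> = (\<Sum>l\<in>?L. \<Sum>A\<in>Pow ?K. if set l \<subseteq> A then of_int ((-1) ^ (k - card A)) * prod_list (map x l) else 0)"
    by (rule sum.swap)
  also have "\<dots> = (\<Sum>l\<in>?L. if set l = ?K then prod_list (map x l) else 0)"
  proof (rule sum.cong[OF refl])
    fix l assume "l \<in> ?L"
    then have "(\<Sum>A | set l \<subseteq> A \<and> A \<subseteq> ?K. (-1) ^ (card ?K - card A)) = (if set l = ?K then 1 else 0 :: int)"
      by (intro sum_signs_supersets) auto
    moreover have "(\<Sum>A\<in>Pow ?K. if set l \<subseteq> A then of_int ((-1) ^ (k - card A)) * prod_list (map x l) else 0)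
        = of_int (\<Sum>A | set l \<subseteq> A \<and> A \<subseteq> ?K. (-1) ^ (card ?K - card A)) * prod_list (map x l)"
      unfolding of_int_sum sum_distrib_right card_lessThan
      by (subst sum.inter_filter[symmetric]) (auto intro: sum.cong)
    ultimately show "(\<Sum>A\<in>Pow ?K. if set l \<subseteq> A then of_int ((-1) ^ (k - card A)) * prod_list (map x l) else 0)
        = (if set l = ?K then prod_list (map x l) else 0)"
      by simp
  qed
  also have "\<dots> = (\<Sum>l | l \<in> ?L \<and> set l = ?K. prod_list (map x l))"
    by (rule sum.inter_filter[OF fin, symmetric])
  also have "\<dots> = (\<Sum>\<sigma> | \<sigma> permutes ?K. prod_list (map (\<lambda>i. x (\<sigma> i)) [0..<k]))"
  proof (rule sum.reindex_bij_witness[where j="\<lambda>l i. if i < k then l ! i else i" and i="\<lambda>\<sigma>. map \<sigma> [0..<k]"])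
    fix l assume l: "l \<in> {l. l \<in> ?L \<and> set l = ?K}"
    show "map (\<lambda>i. if i < k then l ! i else i) [0..<k] = l"
      using l by (auto intro: nth_equalityI)
    have "distinct l" using l by (simp add: card_distinct)
    then have "bij_betw ((!) l) ?K ?K" by (rule bij_betw_nth) (use l in auto)
    then have "bij_betw (\<lambda>i. if i < k then l ! i else i) ?K ?K"
      by (subst bij_betw_cong[where g="(!) l"]) auto
    then show "(\<lambda>i. if i < k then l ! i else i) \<in> {\<sigma>. \<sigma> permutes ?K}"
      unfolding mem_Collect_eq by (rule bij_imp_permutes) simp
    show "prod_list (map (\<lambda>i. x (if i < k then l ! i else i)) [0..<k]) = prod_list (map x l)"
    proof -
      have "map (\<lambda>i. x (if i < k then l ! i else i)) [0..<k] = map x l"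
        using l by (auto intro: nth_equalityI)
      then show ?thesis by simp
    qed
  next
    fix \<sigma> assume \<sigma>: "\<sigma> \<in> {\<sigma>. \<sigma> permutes ?K}"
    show "(\<lambda>i. if i < k then map \<sigma> [0..<k] ! i else i) = \<sigma>"
      using \<sigma> by (auto simp: fun_eq_iff permutes_not_in)
    have "set (map \<sigma> [0..<k]) = ?K" using \<sigma> by (simp add: permutes_image lessThan_atLeast0)
    then show "map \<sigma> [0..<k] \<in> {l. l \<in> ?L \<and> set l = ?K}" by simp
  qed
  finally show ?thesis ..
qed

lemma sym_bracket_eq:
  "sym_bracket \<phi> b = (\<Sum>A\<in>Pow {..<length (lyndon_factors b)}. of_int ((-1) ^ (length (lyndon_factors b) - card A)) *
     (\<Sum>i\<in>A. std_bracket \<phi> (lyndon_factors b ! i)) ^ length (lyndon_factors b))"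
  unfolding sym_bracket_def Let_def by (rule polarization)

section \<open>Leading words\<close>

lemma lookup_mult_word:
  "lookup (x * y :: ('c, 'k::field) free_alg) z = (\<Sum>i\<le>length z. lookup x (take i z) * lookup y (drop i z))"
proof -
  let ?t = "\<lambda>l. lookup x l * (\<Sum>q. lookup y q when z = l + q)"
  have inj: "inj_on (\<lambda>i. take i z) {..length z}"
    by (rule inj_onI) (metis atMost_iff length_take min.absorb2)
  have "lookup (x * y) z = (\<Sum>l. ?t l)" by (rule lookup_mult)
  also have "\<dots> = (\<Sum>l\<in>(\<lambda>i. take i z) ` {..length z}. ?t l)"
  proof (rule Sum_any.expand_superset)
    show "{l. ?t l \<noteq> 0} \<subseteq> (\<lambda>i. take i z) ` {..length z}"
    proof
      fix l assume "l \<in> {l. ?t l \<noteq> 0}"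
      then have *: "(\<Sum>q. lookup y q when z = l + q) \<noteq> 0" by auto
      have "\<exists>q. z = l @ q"
      proof (rule ccontr)
        assume "\<nexists>q. z = l @ q"
        then have "z = l + q \<longleftrightarrow> False" for q by (simp add: plus_list_def)
        then show False using * by simp
      qed
      then obtain q where "z = l @ q" ..
      then show "l \<in> (\<lambda>i. take i z) ` {..length z}" by (intro image_eqI[of _ _ "length l"]) auto
    qed
  qed simp
  also have "\<dots> = (\<Sum>i\<le>length z. ?t (take i z))"
    by (subst sum.reindex[OF inj]) simp
  also have "\<dots> = (\<Sum>i\<le>length z. lookup x (take i z) * lookup y (drop i z))"
  proof (rule sum.cong[OF refl])
    fix i
    have "z = take i z @ q \<longleftrightarrow> drop i z = q" for q by (metis append_take_drop_id same_append_eq)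
    then show "?t (take i z) = lookup x (take i z) * lookup y (drop i z)"
      by (simp add: plus_list_def)
  qed
  finally show ?thesis .
qed

text \<open>Only a lower bound for the words of \<open>x\<close>: \<open>u\<close> itself may be
  absent, so 0 is \<open>leading\<close> for every \<open>u\<close>. This makes the notion stable
  under differences.\<close>

definition leading :: "'c::linorder list \<Rightarrow> ('c, 'k::field) free_alg \<Rightarrow> bool" where
  "leading u x \<longleftrightarrow> (\<forall>z\<in>keys x. length u \<le> length z \<and> (length z = length u \<longrightarrow> u \<le> z))"

lemma leadingD: "leading u x \<Longrightarrow> z \<in> keys x \<Longrightarrow> length u \<le> length z"
  and leadingD': "leading u x \<Longrightarrow> z \<in> keys x \<Longrightarrow> length z = length u \<Longrightarrow> u \<le> z"
  by (auto simp: leading_def)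

lemma lookup_eq_0: "z \<notin> keys x \<Longrightarrow> lookup x z = 0"
  by (simp add: in_keys_iff)

text \<open>Cutting \<open>u @ v\<close> anywhere but after \<open>u\<close> makes one of the two
  pieces too short to occur.\<close>

lemma lookup_mult_leading:
  assumes "leading u x" "leading v y"
  shows "lookup (x * y) (u @ v) = lookup x u * lookup y v"
proof -
  have "lookup x (take i (u @ v)) * lookup y (drop i (u @ v)) = 0" if "i \<noteq> length u" "i \<le> length (u @ v)" for i
  proof (cases "i < length u")
    case True
    then have "take i (u @ v) \<notin> keys x" using leadingD[OF assms(1), of "take i (u @ v)"] by auto
    then show ?thesis by (simp add: lookup_eq_0)
  next
    case False
    with that have "drop i (u @ v) \<notin> keys y" using leadingD[OF assms(2), of "drop i (u @ v)"] by auto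
    then show ?thesis by (simp add: lookup_eq_0)
  qed
  then have "lookup (x * y) (u @ v) = (\<Sum>i\<in>{length u}. lookup x (take i (u @ v)) * lookup y (drop i (u @ v)))"
    unfolding lookup_mult_word by (intro sum.mono_neutral_right) auto
  then show ?thesis by simp
qed

lemma leading_mult:
  assumes "leading u x" "leading v y"
  shows "leading (u @ v) (x * y)"
  unfolding leading_def
proof
  fix z assume "z \<in> keys (x * y)"
  then obtain a b where ab: "z = a @ b" "a \<in> keys x" "b \<in> keys y" by (rule keys_mult_wordE)
  note len = leadingD[OF assms(1) ab(2)] leadingD[OF assms(2) ab(3)]
  show "length (u @ v) \<le> length z \<and> (length z = length (u @ v) \<longrightarrow> u @ v \<le> z)"
  proof (intro conjI impI)
    assume "length z = length (u @ v)"
    with len ab(1) have "length a = length u" "length b = length v" by auto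
    then show "u @ v \<le> z"
      using leadingD'[OF assms(1) ab(2)] leadingD'[OF assms(2) ab(3)] ab(1)
      by (simp add: list_le_append_mono)
  qed (use len ab(1) in auto)
qed

lemma leading_minus: "leading u x \<Longrightarrow> leading u y \<Longrightarrow> leading u (x - y)"
  using keys_minus_subset[of x y] by (auto simp: leading_def)

lemma leading_mono:
  assumes "leading u x" "length v = length u" "v \<le> u"
  shows "leading v x"
  using assms by (auto simp: leading_def)

text \<open>For a Lyndon word \<open>u @ v < v\<close>, hence \<open>u @ v < v @ u\<close>. So the
  second product of the commutator has a strictly larger leading word and cannot disturb the
  first.\<close>

lemma std_bracket_leading:
  assumes "\<And>c. leading [c] (\<phi> c)" "\<And>c. lookup (\<phi> c) [c] = 1" "lyndon l"
  shows "leading l (std_bracket \<phi> l) \<and> lookup (std_bracket \<phi> l) l = 1"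
  using assms(3)
proof (induction l rule: measure_induct_rule[of length])
  case (less l)
  show ?case
  proof (cases "length l < 2")
    case True
    with lyndon_nonempty[OF less.prems] obtain c where "l = [c]"
      by (cases l) (auto simp: numeral_2_eq_2 less_Suc_eq_0_disj)
    then show ?thesis using assms(1,2)[of c] by (simp add: std_bracket.simps)
  next
    case False
    define u v where "u = take (std_pos l) l" and "v = drop (std_pos l) l"
    have l: "l = u @ v" by (simp add: u_def v_def)
    have len: "length u < length l" "length v < length l" 
      using std_pos_bounds[of l] False by (auto simp: u_def v_def)
    then have ne: "u \<noteq> []" "v \<noteq> []" using l by auto
    have ly: "lyndon u" "lyndon v"
      using lyndon_std_factors[OF less.prems] False by (simp_all add: u_def v_def)
    note IH = less.IH[OF len(1) ly(1)] less.IH[OF len(2) ly(2)]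
    let ?x = "std_bracket \<phi> u" and ?y = "std_bracket \<phi> v"
    have br: "std_bracket \<phi> l = ?x * ?y - ?y * ?x"
      using False by (subst std_bracket.simps) (simp add: Let_def u_def v_def)
    have "u @ v < v" using lyndonD[of u v] less.prems l ne by simp
    then have "(u @ v) @ [] < v @ u" by (intro list_less_append_mono) auto
    then have less_vu: "u @ v < v @ u" by simp
    have 1: "leading (u @ v) (?x * ?y)" and 2: "leading (v @ u) (?y * ?x)"
      using IH by (simp_all add: leading_mult)
    have 3: "leading (u @ v) (?y * ?x)"
      using 2 less_vu by (intro leading_mono[OF 2]) simp_all
    have "u @ v \<notin> keys (?y * ?x)"
      using leadingD'[OF 2, of "u @ v"] less_vu by auto
    then have "lookup (?x * ?y - ?y * ?x) (u @ v) = 1"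
      using IH by (simp add: lookup_minus lookup_mult_leading lookup_eq_0)
    then show ?thesis using leading_minus[OF 1 3] unfolding br by (simp add: l)
  qed
qed

text \<open>Among the indices with nonzero coefficient take the shortest and then the smallest,
  \<open>w\<close>. No other member of the relation contains the word \<open>w\<close>, so its
  coefficient is isolated there.\<close>

lemma leading_independent:
  assumes "\<And>w. w \<in> W \<Longrightarrow> leading w (g w)" "\<And>w. w \<in> W \<Longrightarrow> lookup (g w) w = 1"
  shows "inj_on g W \<and> pmv.independent (g ` W)"
proof (rule independent_family, rule ccontr)
  fix F c b
  assume F: "finite F" "F \<subseteq> W" "(\<Sum>b\<in>F. scale_pm (c b) (g b)) = 0" "b \<in> F" "c b \<noteq> 0"
  define F' where "F' = {b \<in> F. c b \<noteq> 0}"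
  define m where "m = Min (length ` F')"
  define F'' where "F'' = {b \<in> F'. length b = m}"
  define w where "w = Min F''"
  have "finite F'" "F' \<noteq> {}" using F by (auto simp: F'_def)
  then have "m \<in> length ` F'" unfolding m_def by (intro Min_in) auto
  then have "finite F''" "F'' \<noteq> {}" using \<open>finite F'\<close> by (auto simp: F''_def)
  then have w: "w \<in> F''" unfolding w_def by (rule Min_in)
  have "c v * lookup (g v) w = 0" if "v \<in> F" "v \<noteq> w" for v
  proof (rule ccontr)
    assume *: "c v * lookup (g v) w \<noteq> 0"
    then have v: "v \<in> F'" "w \<in> keys (g v)" "v \<in> W" using that F(2) by (auto simp: F'_def in_keys_iff)
    have "m \<le> length v" using v(1) \<open>finite F'\<close> by (simp add: m_def)
    moreover have "length v \<le> length w" "length w = m"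
      using leadingD[OF assms(1) v(2)] v w by (auto simp: F''_def)
    ultimately have "length v = m" by simp
    then have "v \<in> F''" using v by (simp add: F''_def)
    then have "w \<le> v" using \<open>finite F''\<close> by (simp add: w_def)
    moreover have "v \<le> w" using leadingD'[OF assms(1) v(2)] v \<open>length v = m\<close> \<open>length w = m\<close> by simp
    ultimately show False using that(2) by simp
  qed
  then have "(\<Sum>v\<in>F. c v * lookup (g v) w) = (\<Sum>v\<in>{w}. c v * lookup (g v) w)"
    using F(1) w by (intro sum.mono_neutral_right) (auto simp: F''_def F'_def)
  moreover have "(\<Sum>v\<in>F. c v * lookup (g v) w) = lookup (\<Sum>b\<in>F. scale_pm (c b) (g b)) w"
    by (simp add: lookup_sum)
  ultimately have "c w * lookup (g w) w = 0" using F(3) by simp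
  then show False using w F(2) assms(2)[of w] by (auto simp: F''_def F'_def)
qed

section \<open>Eigenvectors\<close>

context hopf_char0
begin

lemma primitiveD: "primitive x \<Longrightarrow> \<Delta> x = tensor x 1 + tensor 1 x"
  by (simp add: primitive_def)

lemma primitive_add: "primitive x \<Longrightarrow> primitive y \<Longrightarrow> primitive (x + y)"
  by (simp add: primitive_def lin_add[OF coprod_linear] lin_add[OF lin_tensor_left[OF lin_id]]
      lin_add[OF lin_tensor_right[OF lin_id]])

lemma primitive_zero: "primitive 0"
  by (simp add: primitive_def lin_zero[OF coprod_linear] lin_zero[OF lin_tensor_left[OF lin_id]]
      lin_zero[OF lin_tensor_right[OF lin_id]])

lemma primitive_sum: "(\<And>i. i \<in> I \<Longrightarrow> primitive (x i)) \<Longrightarrow> primitive (\<Sum>i\<in>I. x i)"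
  by (induction I rule: infinite_finite_induct) (simp_all add: primitive_zero primitive_add)

lemma primitive_commutator:
  assumes "primitive x" "primitive y" shows "primitive (x * y - y * x)"
  using assms
  by (simp add: primitive_def lin_diff[OF coprod_linear] coprod_mult distrib_left distrib_right
      tensor_mult_tensor lin_diff[OF lin_tensor_left[OF lin_id]] lin_diff[OF lin_tensor_right[OF lin_id]])

lemma counit_eq_lookup: "\<epsilon> x = lookup x []"
proof -
  have "\<epsilon> x = (\<Sum>b\<in>keys x. lookup x b * \<epsilon> (basis b))"
  proof -
    have "\<epsilon> (\<Sum>b\<in>A. h b) = (\<Sum>b\<in>A. \<epsilon> (h b))" for A :: "'c list set" and h
      using counit_scale[of 0 0] by (induction A rule: infinite_finite_induct) (simp_all add: counit_add)
    then have "\<epsilon> (lin_ext basis x) = (\<Sum>b\<in>keys x. lookup x b * \<epsilon> (basis b))"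
      unfolding lin_ext_def by (simp only: counit_scale)
    then show ?thesis by simp
  qed
  also have "\<dots> = (\<Sum>b\<in>keys x. if b = [] then lookup x b else 0)"
    by (rule sum.cong) (simp_all add: counit_basis)
  also have "\<dots> = lookup x []" by (simp add: sum.delta in_keys_iff)
  finally show ?thesis .
qed

lemma counit_primitive:
  assumes "primitive x" shows "\<epsilon> x = 0"
proof -
  have "lookup x [] = lookup (\<Delta> x) ([], [])" by (simp add: lookup_coprod_Nil_left)
  also have "\<dots> = lookup x [] + lookup x []"
    using assms by (simp add: primitive_def lookup_add lookup_tensor flip: basis_Nil)
  finally show ?thesis by (simp add: counit_eq_lookup)
qed

text \<open>\<open>tensor x 1\<close> and \<open>tensor 1 x\<close> commute, so this is the binomial
  theorem in the tensor square.\<close>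

lemma coprod_primitive_power:
  assumes "primitive x"
  shows "\<Delta> (x ^ n) = (\<Sum>j\<le>n. scale_pm (of_nat (n choose j)) (tensor (x ^ j) (x ^ (n - j))))"
proof (induction n)
  case 0
  then show ?case by (simp add: coprod_one tensor_one_one)
next
  case (Suc n)
  let ?t = "\<lambda>i j. tensor (x ^ i) (x ^ j)"
  have "\<Delta> (x ^ Suc n) = (tensor x 1 + tensor 1 x) * (\<Sum>j\<le>n. scale_pm (of_nat (n choose j)) (?t j (n - j)))"
    using assms by (simp add: coprod_mult Suc primitiveD)
  also have "\<dots> = (\<Sum>j\<le>n. scale_pm (of_nat (n choose j)) (?t (Suc j) (n - j)))
      + (\<Sum>j\<le>n. scale_pm (of_nat (n choose j)) (?t j (Suc n - j)))"
    by (simp add: distrib_right sum_distrib_left tensor_mult_tensor Suc_diff_le sum.distrib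
        pmv.scale_right_distrib)
  also have "(\<Sum>j\<le>n. scale_pm (of_nat (n choose j)) (?t j (Suc n - j)))
      = (\<Sum>j\<le>Suc n. scale_pm (of_nat (n choose j)) (?t j (Suc n - j)))" by simp
  also have "\<dots> = ?t 0 (Suc n) + (\<Sum>j\<le>n. scale_pm (of_nat (n choose Suc j)) (?t (Suc j) (n - j)))"
    by (subst sum.atMost_Suc_shift) simp
  also have "(\<Sum>j\<le>n. scale_pm (of_nat (n choose j)) (?t (Suc j) (n - j))) + \<dots>
      = ?t 0 (Suc n) + (\<Sum>j\<le>n. scale_pm (of_nat (Suc n choose Suc j)) (?t (Suc j) (n - j)))"
    by (simp add: pmv.scale_left_distrib sum.distrib algebra_simps)
  also have "\<dots> = (\<Sum>j\<le>Suc n. scale_pm (of_nat (Suc n choose j)) (?t j (Suc n - j)))"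
    by (subst sum.atMost_Suc_shift) simp
  finally show ?case .
qed

lemma conv_primitive_power:
  assumes "lin f" "lin g" "primitive x"
  shows "conv f g (x ^ n) = (\<Sum>j\<le>n. scale_pm (of_nat (n choose j)) (f (x ^ j) * g (x ^ (n - j))))"
  unfolding conv_def coprod_primitive_power[OF assms(3)]
  by (simp add: lin_sum[OF lin_lin_ext] lin_scale[OF lin_lin_ext] conv_primitive_tensor[OF assms(1,2)])

lemma conv_unit_primitive_power:
  assumes "primitive x"
  shows "conv_unit (x ^ n) = (if n = 0 then 1 else 0)"
  by (cases n) (simp_all add: conv_unit_def counit_one counit_mult counit_primitive[OF assms])

lemma hopf_power_primitive_power:
  assumes "primitive x"
  shows "\<Psi> a (x ^ n) = scale_pm (of_nat a ^ n) (x ^ n)"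
proof (induction a arbitrary: n)
  case 0
  then show ?case by (simp add: conv_unit_primitive_power[OF assms] zero_power)
next
  case (Suc a)
  have "\<Psi> (Suc a) (x ^ n)
      = (\<Sum>j\<le>n. scale_pm (of_nat (n choose j) * of_nat a ^ (n - j)) (x ^ n))"
    by (simp add: conv_primitive_power[OF lin_id lin_cpow' assms] Suc flip: power_add)
  also have "\<dots> = scale_pm ((1 + of_nat a) ^ n) (x ^ n)"
    unfolding binomial_ring by (simp add: pmv.scale_sum_left)
  finally show ?case by simp
qed

text \<open>Only exponent 1 in the first convolution factor survives: exponent 0 gives
  \<open>f 1 = 0\<close>, and exponent at least 2 leaves too small a power for the remaining
  convolution. The binomial coefficients at exponent 1 accumulate to the factorial.\<close>

lemma cpow_primitive_power:
  assumes "primitive x" "lin f" "f 1 = 0" "n \<le> m"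
  shows "cpow f m (x ^ n) = (if n = m then scale_pm (fact m) (f x ^ m) else 0)"
  using assms(4)
proof (induction m arbitrary: n)
  case 0
  then show ?case by (simp add: conv_unit_def counit_one)
next
  case (Suc m)
  show ?case
  proof (cases n)
    case 0
    have "cpow f (Suc m) (x ^ 0) = f 1 * cpow f m 1"
      using conv_primitive_power[OF assms(2) lin_cpow' assms(1), of f m 0] by simp
    then show ?thesis using 0 assms(3) by simp
  next
    case (Suc n')
    have "cpow f (Suc m) (x ^ n) = (\<Sum>j\<le>n. scale_pm (of_nat (n choose j)) (f (x ^ j) * cpow f m (x ^ (n - j))))"
      by (simp add: conv_primitive_power[OF assms(2) lin_cpow' assms(1)])
    also have "\<dots> = (\<Sum>j\<in>{1}. scale_pm (of_nat (n choose j)) (f (x ^ j) * cpow f m (x ^ (n - j))))"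
    proof (rule sum.mono_neutral_right)
      show "\<forall>i\<in>{..n} - {1}. scale_pm (of_nat (n choose i)) (f (x ^ i) * cpow f m (x ^ (n - i))) = 0"
      proof
        fix i assume "i \<in> {..n} - {1}"
        then consider "i = 0" | "i \<ge> 2" "i \<le> n" by force
        then show "scale_pm (of_nat (n choose i)) (f (x ^ i) * cpow f m (x ^ (n - i))) = 0"
        proof cases
          case 2
          then have "cpow f m (x ^ (n - i)) = 0" using Suc.prems by (subst Suc.IH) auto
          then show ?thesis by simp
        qed (simp add: assms(3))
      qed
    qed (use Suc in auto)
    also have "\<dots> = scale_pm (of_nat n) (f x * cpow f m (x ^ n'))" using Suc by simp
    also have "\<dots> = (if n = Suc m then scale_pm (fact (Suc m)) (f x ^ Suc m) else 0)"
      using Suc Suc.prems by (subst Suc.IH) auto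
    finally show ?thesis .
  qed
qed

end

lemma of_int_mult_eq_scale:
  "of_int n * x = scale_pm (of_int n) (x :: 'd::monoid_add \<Rightarrow>\<^sub>0 'k::field)"
  by (simp add: scale_pm_eq_mult)

locale lyndon_hopf = hopf_char0 deg \<Delta> \<epsilon> S
  for deg :: "'c::linorder \<Rightarrow> nat"
    and \<Delta> :: "('c, 'k::field_char_0) free_alg \<Rightarrow> ('c list \<times> 'c list \<Rightarrow>\<^sub>0 'k)"
    and \<epsilon> :: "('c, 'k) free_alg \<Rightarrow> 'k"
    and S :: "('c, 'k) free_alg \<Rightarrow> ('c, 'k) free_alg"
begin

abbreviation prim :: "'c \<Rightarrow> ('c, 'k) free_alg" where
  "prim c \<equiv> eulerian \<Delta> (basis [c])"

lemma primitive_std_bracket: "primitive (std_bracket prim l)"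
proof (induction l rule: measure_induct_rule[of length])
  case (less l)
  show ?case
  proof (cases "length l < 2")
    case True
    \<comment> \<open>The empty word falls under this case too; its bracket is
      \<open>prim (hd [])\<close>, which is primitive as well.\<close>
    then show ?thesis by (simp add: std_bracket.simps primitive_eulerian)
  next
    case False
    then show ?thesis
      using std_pos_bounds[of l] 
      by (subst std_bracket.simps) (simp add: Let_def primitive_commutator less)
  qed
qed

lemma gvec_eq:
  fixes b defines "bs \<equiv> lyndon_factors b"
  shows "gvec \<Delta> b = (\<Sum>A\<in>Pow {..<length bs}. scale_pm (of_int ((-1) ^ (length bs - card A)))
     ((\<Sum>i\<in>A. std_bracket prim (bs ! i)) ^ length bs))"
  unfolding gvec_def sym_bracket_eq bs_def of_int_mult_eq_scale ..

lemma primitive_sum_std_bracket: "primitive (\<Sum>i\<in>A. std_bracket prim (bs ! i))"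
  by (intro primitive_sum primitive_std_bracket)

lemma cpow_id_gvec:
  "\<Psi> a (gvec \<Delta> b) = scale_pm (of_nat a ^ length (lyndon_factors b)) (gvec \<Delta> b)"
  unfolding gvec_eq lin_sum[OF lin_cpow'] lin_scale[OF lin_cpow']
    hopf_power_primitive_power[OF primitive_sum_std_bracket]
  by (simp add: pmv.scale_sum_right mult.commute)

lemma cpow_gvec:
  assumes "lin f" "f 1 = 0" "length (lyndon_factors b) \<le> m"
  shows "cpow f m (gvec \<Delta> b) = (if length (lyndon_factors b) = m
    then scale_pm (fact m) (\<Sum>\<sigma> | \<sigma> permutes {..<m}.
      prod_list (map (\<lambda>i. f (std_bracket prim (lyndon_factors b ! \<sigma> i))) [0..<m])) else 0)"
  unfolding gvec_eq lin_sum[OF lin_cpow'] lin_scale[OF lin_cpow']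
    cpow_primitive_power[OF primitive_sum_std_bracket assms] lin_sum[OF assms(1)]
    polarization[of "\<lambda>i. f (std_bracket prim (lyndon_factors b ! i))" m] of_int_mult_eq_scale
  by (simp add: pmv.scale_sum_right mult.commute)

section \<open>Short words in the Eulerian image of a letter\<close>

lemma lookup_cpow_aug_proj_letter:
  assumes "length z \<le> 1"
  shows "lookup (cpow aug_proj k (basis [c])) z = (if k = 1 then lookup (basis [c]) z else 0)"
proof -
  have "lookup (cpow aug_proj k (basis [c])) z = 0" if "k \<ge> 2"
    using length_cpow_aug_proj[of z k "[c]"] assms that by (intro lookup_eq_0) auto
  moreover have "cpow aug_proj 1 (basis [c]) = basis [c]"
    using lin_aug_proj[OF lin_id] by (simp add: conv_unit_right aug_proj_basis)
  moreover have "cpow aug_proj 0 (basis [c]) = (0 :: ('c, 'k) free_alg)"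
    by (simp add: conv_unit_basis)
  moreover have "k = 0 \<or> k = 1 \<or> k \<ge> 2" by linarith
  ultimately show ?thesis by (auto simp del: cpow.simps)
qed

text \<open>A word in the \<open>k\<close>-th convolution power of \<open>aug_proj\<close> has at
  least \<open>k\<close> letters, so the Eulerian idempotent alters a letter only by words of length
  at least 2.\<close>

lemma lookup_prim_length_1:
  assumes "length z \<le> 1"
  shows "lookup (prim c) z = lookup (basis [c]) z"
proof -
  have "lookup (cpow aug_proj k (basis [c])) z * coeff (binomial_poly k :: 'k poly) (Suc 0)
      = (if k = 1 then lookup (basis [c]) z else 0)" for k
    by (simp add: lookup_cpow_aug_proj_letter[OF assms] coeff_binomial_poly_1 del: cpow.simps)
  then have "coeff (hopf_power_poly [c] z) (Suc 0) = lookup (basis [c]) z"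
    using deg_pos[of c] by (simp add: hopf_power_poly_def coeff_sum sum.delta)
  then show ?thesis by (simp add: coeff_hopf_power_poly_1)
qed

lemma leading_prim: "leading [c] (prim c)" "lookup (prim c) [c] = 1"
proof -
  show "leading [c] (prim c)"
    unfolding leading_def
  proof
    fix z assume z: "z \<in> keys (prim c)"
    show "length [c] \<le> length z \<and> (length z = length [c] \<longrightarrow> [c] \<le> z)"
    proof (cases "length z \<le> 1")
      case True
      then have "z = [c]"
        using z lookup_prim_length_1[of z c] by (auto simp: in_keys_iff lookup_basis split: if_splits)
      then show ?thesis by simp
    qed simp
  qed
qed (simp add: lookup_prim_length_1)

text \<open>The unit is included as the value at the empty word, so that one linear map can be
  prescribed to vanish at 1 and to take given values at the brackets.\<close>

definition bracket_family :: "'c list \<Rightarrow> ('c, 'k) free_alg" where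
  "bracket_family w = (if w = [] then 1 else std_bracket prim w)"

section \<open>Linear independence of the eigenvectors\<close>

lemma independent_bracket_family:
  "inj_on bracket_family (insert [] {l. lyndon l}) \<and>
   pmv.independent (bracket_family ` insert [] {l. lyndon l})"
proof (rule leading_independent)
  fix w :: "'c list" assume "w \<in> insert [] {l. lyndon l}"
  then show "leading w (bracket_family w)" "lookup (bracket_family w) w = 1"
    using std_bracket_leading[of prim w, OF leading_prim] lyndon_nonempty[of w]
    by (auto simp: bracket_family_def leading_def zero_list_def lookup_one)
qed

text \<open>Multisets of words are the monomials of a polynomial ring, in which the brackets become
  variables. \<open>f\<close> is merely linear; products are dealt with by its convolution
  powers.\<close>

lemma dual_of_brackets:
  "\<exists>f :: ('c, 'k) free_alg \<Rightarrow> ('c list multiset \<Rightarrow>\<^sub>0 'k).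
     lin f \<and> f 1 = 0 \<and> (\<forall>l. lyndon l \<longrightarrow> f (std_bracket prim l) = basis {#l#})"
proof -
  let ?W = "insert [] {l :: 'c list. lyndon l}"
  define h :: "'c list \<Rightarrow> ('c list multiset \<Rightarrow>\<^sub>0 'k)" where "h w = (if w = [] then 0 else basis {#w#})" for w
  obtain f where f: "lin f" "\<forall>x\<in>bracket_family ` ?W. f x = h (inv_into ?W bracket_family x)"
    using pmp.linear_independent_extend[OF conjunct2[OF independent_bracket_family],
        of "\<lambda>x. h (inv_into ?W bracket_family x)"] by blast
  then have eq: "f (bracket_family w) = h w" if "w \<in> ?W" for w
  proof -
    have "f (bracket_family w) = h (inv_into ?W bracket_family (bracket_family w))"
      using f(2) that by blast
    then show ?thesis by (simp only: inv_into_f_f[OF conjunct1[OF independent_bracket_family] that])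
  qed
  show ?thesis
  proof (intro exI[of _ f] conjI allI impI f(1))
    show "f 1 = 0" using eq[of "[]"] by (simp add: bracket_family_def h_def)
    fix l :: "'c list" assume "lyndon l"
    then show "f (std_bracket prim l) = basis {#l#}"
      using eq[of l] lyndon_nonempty[of l] by (simp add: bracket_family_def h_def)
  qed
qed

lemma prod_list_basis_singleton:
  "prod_list (map (\<lambda>l. basis {#l#}) ls) = (basis (mset ls) :: 'b multiset \<Rightarrow>\<^sub>0 'k)"
proof (induction ls)
  case Nil
  show ?case by (simp add: basis_zero)
next
  case (Cons l ls)
  then show ?case by (simp add: basis_mult)
qed

text \<open>One factorial comes from the convolution power of a power of a primitive element, the
  other from the permutations, all of which give the same commutative monomial.\<close>

lemma cpow_dual_gvec:
  assumes "lin f" "f 1 = 0" "\<And>l. lyndon l \<Longrightarrow> f (std_bracket prim l) = basis {#l#}"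
    and "length (lyndon_factors b) = m"
  shows "cpow f m (gvec \<Delta> b) = scale_pm (fact m * fact m) (basis (mset (lyndon_factors b)))"
proof -
  let ?bs = "lyndon_factors b"
  have "prod_list (map (\<lambda>i. f (std_bracket prim (?bs ! \<sigma> i))) [0..<m]) = basis (mset ?bs)"
    if "\<sigma> permutes {..<m}" for \<sigma>
  proof -
    have "f (std_bracket prim (?bs ! \<sigma> i)) = basis {#?bs ! \<sigma> i#}" if "i < m" for i
    proof (rule assms(3), rule lyndon_lyndon_factors, rule nth_mem)
      show "\<sigma> i < length ?bs" using permutes_in_image[OF \<open>\<sigma> permutes {..<m}\<close>, of i] that assms(4) by simp
    qed
    then have "map (\<lambda>i. f (std_bracket prim (?bs ! \<sigma> i))) [0..<m] = map (\<lambda>l. basis {#l#}) (permute_list \<sigma> ?bs)"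
      unfolding permute_list_def assms(4) by simp
    then show ?thesis
      using that assms(4) by (simp add: prod_list_basis_singleton)
  qed
  then have "(\<Sum>\<sigma> | \<sigma> permutes {..<m}. prod_list (map (\<lambda>i. f (std_bracket prim (?bs ! \<sigma> i))) [0..<m]))
      = of_nat (fact m) * basis (mset ?bs)"
    using card_permutations[of "{..<m}" m] by simp
  then show ?thesis
    by (subst cpow_gvec[OF assms(1,2)]) (simp_all add: assms(4) of_nat_mult_eq_scale del: of_nat_fact, simp)
qed

lemma gvec_coefficients_eq_0:
  assumes "finite F" "(\<Sum>b\<in>F. scale_pm (c b) (gvec \<Delta> b)) = 0" "b \<in> F"
  shows "c b = 0"
proof (rule ccontr)
  assume "c b \<noteq> 0"
  note F = assms this
  obtain f :: "('c, 'k) free_alg \<Rightarrow> ('c list multiset \<Rightarrow>\<^sub>0 'k)" where f: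
    "lin f" "f 1 = 0" "\<And>l. lyndon l \<Longrightarrow> f (std_bracket prim l) = basis {#l#}"
    using dual_of_brackets by blast
  define F' where "F' = {b \<in> F. c b \<noteq> 0}"
  \<comment> \<open>With the largest number of Lyndon factors as exponent, \<open>cpow f m\<close>
    kills every term with fewer factors; the surviving monomials are distinct because a word is
    determined by the multiset of its factors.\<close>
  define m where "m = Max ((\<lambda>b. length (lyndon_factors b)) ` F')"
  have F': "finite F'" "F' \<noteq> {}" using F by (auto simp: F'_def)
  then have "m \<in> (\<lambda>b. length (lyndon_factors b)) ` F'" unfolding m_def by (intro Max_in) auto
  then obtain w where w: "w \<in> F'" "length (lyndon_factors w) = m" by auto
  have le: "length (lyndon_factors v) \<le> m" if "v \<in> F'" for v
    unfolding m_def using that F' by (intro Max_ge) auto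
  have "c v * lookup (cpow f m (gvec \<Delta> v)) (mset (lyndon_factors w))
      = (if v = w then c w * (fact m * fact m) else 0)" if "v \<in> F" for v
  proof (cases "c v \<noteq> 0 \<and> length (lyndon_factors v) = m")
    case True
    then show ?thesis
      using cpow_dual_gvec[OF f, of v m] inj_mset_lyndon_factors[of v w] by (auto simp: lookup_basis)
  next
    case False
    have "cpow f m (gvec \<Delta> v) = 0" if "c v \<noteq> 0"
    proof -
      have "length (lyndon_factors v) \<le> m" using le[of v] \<open>v \<in> F\<close> that by (simp add: F'_def)
      then show ?thesis using cpow_gvec[OF f(1,2), of v m] False that by simp
    qed
    then show ?thesis using False w by (cases "c v = 0") (auto simp: F'_def)
  qed
  then have "(\<Sum>v\<in>F. c v * lookup (cpow f m (gvec \<Delta> v)) (mset (lyndon_factors w))) = c w * (fact m * fact m)"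
    using F(1) w by (simp add: sum.delta F'_def)
  moreover have "(\<Sum>v\<in>F. c v * lookup (cpow f m (gvec \<Delta> v)) (mset (lyndon_factors w)))
      = lookup (cpow f m (\<Sum>b\<in>F. scale_pm (c b) (gvec \<Delta> b))) (mset (lyndon_factors w))"
    by (simp add: lookup_sum lin_sum[OF lin_cpow'] lin_scale[OF lin_cpow'])
  ultimately have "c w * (fact m * fact m) = 0"
    using F(2) by (simp add: lin_zero[OF lin_cpow'])
  then show False using w by (simp add: F'_def)
qed

lemma independent_gvec: "inj_on (gvec \<Delta>) W \<and> pmv.independent (gvec \<Delta> ` W)"
  by (rule independent_family) (rule gvec_coefficients_eq_0)

lemma gvec_nonzero: "gvec \<Delta> b \<noteq> 0"
  using pmv.dependent_zero[of "gvec \<Delta> ` {b}"] independent_gvec[of "{b}"] by auto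

lemma eigenvector_gvec:
  "a \<ge> 1 \<Longrightarrow> eigenvector (hopf_power \<Delta> a) (of_nat a ^ length (lyndon_factors b)) (gvec \<Delta> b)"
  by (simp add: eigenvector_def gvec_nonzero hopf_power_eq_cpow cpow_id_gvec)

end

section \<open>Counting words by Lyndon factors\<close>

lemma wdeg_concat: "wdeg deg (concat bs) = sum_list (map (wdeg deg) bs)"
  by (induction bs) (simp_all add: wdeg_def)

definition lyndon_multisets :: "('c::linorder \<Rightarrow> nat) \<Rightarrow> 'c list set \<Rightarrow> nat \<Rightarrow> nat \<Rightarrow> 'c list multiset set" where
  "lyndon_multisets deg L n k = {M. set_mset M \<subseteq> L \<and> (\<Sum>l\<in>#M. wdeg deg l) = n \<and> size M = k}"

lemma bij_betw_lyndon_multisets: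
  "bij_betw (\<lambda>b. mset (lyndon_factors b)) {b \<in> words deg n. length (lyndon_factors b) = k}
     (lyndon_multisets deg {l. lyndon l} n k)"
  unfolding bij_betw_def
proof
  show "inj_on (\<lambda>b. mset (lyndon_factors b)) {b \<in> words deg n. length (lyndon_factors b) = k}"
    using inj_mset_lyndon_factors by (auto simp: inj_on_def)
  have deg_sum: "(\<Sum>l\<in>#mset (lyndon_factors b). wdeg deg l) = wdeg deg b" for b
    using wdeg_concat[of deg "lyndon_factors b"] by (simp add: sum_mset_sum_list flip: mset_map)
  show "(\<lambda>b. mset (lyndon_factors b)) ` {b \<in> words deg n. length (lyndon_factors b) = k}
      = lyndon_multisets deg {l. lyndon l} n k"
  proof (intro equalityI subsetI)
    fix M assume "M \<in> (\<lambda>b. mset (lyndon_factors b)) ` {b \<in> words deg n. length (lyndon_factors b) = k}"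
    then show "M \<in> lyndon_multisets deg {l. lyndon l} n k"
      by (auto simp: lyndon_multisets_def words_def deg_sum lyndon_lyndon_factors simp del: mset_map)
  next
    fix M :: "'a list multiset" assume M: "M \<in> lyndon_multisets deg {l. lyndon l} n k"
    define bs where "bs = rev (sorted_list_of_multiset M)"
    have "lyndon_factorization bs"
      using M by (auto simp: bs_def lyndon_factorization_def lyndon_multisets_def sorted_wrt_rev)
    then have "lyndon_factors (concat bs) = bs" by (rule lyndon_factors_eqI[OF refl])
    moreover have "mset bs = M" by (simp add: bs_def)
    ultimately show "M \<in> (\<lambda>b. mset (lyndon_factors b)) ` {b \<in> words deg n. length (lyndon_factors b) = k}"
      using M deg_sum[of "concat bs"]
      by (intro image_eqI[of _ _ "concat bs"]) (auto simp: lyndon_multisets_def words_def simp flip: size_mset)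
  qed
qed

lemma finite_lyndon_multisets:
  assumes "finite L" shows "finite (lyndon_multisets deg L n k)"
proof (rule finite_subset)
  show "lyndon_multisets deg L n k \<subseteq> mset ` {xs. set xs \<subseteq> L \<and> length xs = k}"
  proof
    fix M assume M: "M \<in> lyndon_multisets deg L n k"
    obtain xs where "M = mset xs" using ex_mset[of M] by auto
    with M show "M \<in> mset ` {xs. set xs \<subseteq> L \<and> length xs = k}" by (auto simp: lyndon_multisets_def)
  qed
qed (simp add: finite_lists_length_eq assms)

definition multiset_series :: "('c::linorder \<Rightarrow> nat) \<Rightarrow> 'c list set \<Rightarrow> rat fps fps" where
  "multiset_series deg L = Abs_fps (\<lambda>n. Abs_fps (\<lambda>k. of_nat (card (lyndon_multisets deg L n k))))"

abbreviation geometric_factor :: "nat \<Rightarrow> rat fps fps" where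
  "geometric_factor d \<equiv> 1 - fps_const fps_X * fps_X ^ d"

lemma nth_geometric_factor_mult:
  "fps_nth (fps_nth (geometric_factor d * F) n) k
   = fps_nth (fps_nth F n) k - (if n < d \<or> k = 0 then 0 else fps_nth (fps_nth F (n - d)) (k - 1))"
proof -
  have "fps_const fps_X * fps_X ^ d * F = fps_const fps_X * (fps_X ^ d * F)" by (simp add: mult.assoc)
  then have "geometric_factor d * F = F - fps_const fps_X * (fps_X ^ d * F)"
    by (simp add: left_diff_distrib)
  then show ?thesis by (simp add: fps_X_power_mult_nth)
qed

text \<open>A multiset either avoids \<open>l\<close> or arises from exactly one smaller multiset by
  adding a copy of \<open>l\<close>. Multiplication by the geometric factor encodes this
  recursion.\<close>

lemma card_lyndon_multisets_insert:
  assumes "finite L" "l \<notin> L"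
  shows "card (lyndon_multisets deg (insert l L) n k) = card (lyndon_multisets deg L n k)
    + (if n < wdeg deg l \<or> k = 0 then 0 else card (lyndon_multisets deg (insert l L) (n - wdeg deg l) (k - 1)))"
proof -
  let ?A = "{M \<in> lyndon_multisets deg (insert l L) n k. l \<in># M}"
  have fin: "finite (lyndon_multisets deg (insert l L) n' k')" for n' k'
    using assms(1) by (intro finite_lyndon_multisets) simp
  have "lyndon_multisets deg (insert l L) n k = lyndon_multisets deg L n k \<union> ?A"
    by (auto simp: lyndon_multisets_def)
  moreover have "lyndon_multisets deg L n k \<inter> ?A = {}"
    using assms(2) by (auto simp: lyndon_multisets_def)
  ultimately have "card (lyndon_multisets deg (insert l L) n k) = card (lyndon_multisets deg L n k) + card ?A"
    using fin[of n k] by (metis card_Un_disjoint finite_Un)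
  also have "card ?A = (if n < wdeg deg l \<or> k = 0 then 0
      else card (lyndon_multisets deg (insert l L) (n - wdeg deg l) (k - 1)))"
  proof (cases "n < wdeg deg l \<or> k = 0")
    case True
    have A: "?A = {}"
    proof (rule ccontr)
      assume "?A \<noteq> {}"
      then obtain M where M: "M \<in> ?A" by blast
      then obtain N where "M = add_mset l N" by (auto dest: multi_member_split)
      with M True show False by (auto simp: lyndon_multisets_def)
    qed
    show ?thesis unfolding A using True by simp
  next
    case False
    have "bij_betw (add_mset l) (lyndon_multisets deg (insert l L) (n - wdeg deg l) (k - 1)) ?A"
      unfolding bij_betw_def
    proof (intro conjI equalityI subsetI)
      fix M assume M: "M \<in> ?A"
      then obtain N where "M = add_mset l N" by (auto dest: multi_member_split)
      with M show "M \<in> add_mset l ` lyndon_multisets deg (insert l L) (n - wdeg deg l) (k - 1)"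
        by (auto simp: lyndon_multisets_def)
    qed (use False in \<open>auto simp: lyndon_multisets_def inj_on_def\<close>)
    with False show ?thesis by (simp add: bij_betw_same_card)
  qed
  finally show ?thesis .
qed

lemma multiset_series_insert:
  assumes "finite L" "l \<notin> L"
  shows "geometric_factor (wdeg deg l) * multiset_series deg (insert l L) = multiset_series deg L"
  by (intro fps_ext, subst nth_geometric_factor_mult)
     (simp add: multiset_series_def card_lyndon_multisets_insert[OF assms])

lemma multiset_series_empty: "multiset_series deg {} = 1"
proof -
  have "lyndon_multisets deg {} n k = (if n = 0 \<and> k = 0 then {{#}} else {})" for n k
    by (auto simp: lyndon_multisets_def)
  then show ?thesis by (auto simp: multiset_series_def intro!: fps_ext)
qed

text \<open>The coefficients are themselves power series and form no field, so invertibility is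
  drawn from the constant coefficient being 1.\<close>

lemma geometric_factor_inverse:
  assumes "d > 0" shows "geometric_factor d * inverse (geometric_factor d) = 1"
  unfolding fps_inverse_def
  using assms by (intro fps_right_inverse) (simp add: fps_X_power_nth)

lemma multiset_series_eq_prod:
  assumes "finite L" "\<And>l. l \<in> L \<Longrightarrow> wdeg deg l > 0"
  shows "multiset_series deg L = (\<Prod>l\<in>L. inverse (geometric_factor (wdeg deg l)))"
  using assms
proof (induction L rule: finite_induct)
  case (insert l L)
  have "geometric_factor (wdeg deg l) * multiset_series deg (insert l L)
      = (\<Prod>l\<in>L. inverse (geometric_factor (wdeg deg l)))"
    using insert by (simp add: multiset_series_insert del: geometric_factor_inverse)
  then have "inverse (geometric_factor (wdeg deg l)) * (geometric_factor (wdeg deg l) * multiset_series deg (insert l L))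
      = (\<Prod>l\<in>insert l L. inverse (geometric_factor (wdeg deg l)))"
    using insert.hyps by simp
  moreover have "inverse (geometric_factor (wdeg deg l)) * geometric_factor (wdeg deg l) = 1"
    using geometric_factor_inverse[of "wdeg deg l"] insert.prems by (subst mult.commute) simp
  ultimately show ?case by (simp only: mult.assoc[symmetric] mult_1_left)
qed (simp add: multiset_series_empty)

text \<open>A partial product counts multisets of Lyndon words of bounded degree. A multiset of
  total degree \<open>n\<close> contains no word of larger degree, so each coefficient is eventually
  constant.\<close>

lemma nth_lyndon_series:
  assumes deg_pos: "\<And>c. deg c > 0" and fin: "\<And>n. finite (words deg n)"
  shows "fps_nth (fps_nth (lyndon_series deg) n) k =
    of_nat (card {b \<in> words deg n. length (lyndon_factors b) = k})"
proof -
  define L where "L = (\<lambda>j. {l. lyndon l \<and> wdeg deg l = j})"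
  define LL where "LL = (\<lambda>N. {l. lyndon l \<and> wdeg deg l \<le> N})"
  have finL: "finite (L j)" for j
    using fin[of j] by (rule finite_subset[rotated]) (auto simp: L_def words_def)
  have LL: "LL N = (\<Union>j\<in>{1..N}. L j)" for N
  proof -
    have "wdeg deg l \<ge> 1" if "lyndon l" for l
      using that deg_pos lyndon_nonempty[OF that] by (cases l) (auto simp: wdeg_def Suc_le_eq)
    then show ?thesis by (auto simp: LL_def L_def)
  qed
  then have finLL: "finite (LL N)" for N using finL by simp
  let ?f = "\<lambda>j. inverse (geometric_factor (Suc j)) ^ num_lyndon deg (Suc j)"
  have part: "(\<Prod>j\<le>m. ?f j) = multiset_series deg (LL (Suc m))" for m
  proof -
    have "multiset_series deg (LL (Suc m)) = (\<Prod>l\<in>LL (Suc m). inverse (geometric_factor (wdeg deg l)))"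
      by (rule multiset_series_eq_prod[OF finLL]) (auto simp: LL L_def)
    also have "\<dots> = (\<Prod>j\<in>{1..Suc m}. \<Prod>l\<in>L j. inverse (geometric_factor (wdeg deg l)))"
      unfolding LL using finL by (subst prod.UNION_disjoint) (auto simp: L_def)
    also have "\<dots> = (\<Prod>j\<in>{1..Suc m}. inverse (geometric_factor j) ^ num_lyndon deg j)"
      by (intro prod.cong) (auto simp: L_def num_lyndon_def)
    also have "\<dots> = (\<Prod>j\<le>m. ?f j)"
      by (rule prod.reindex_bij_witness[where i=Suc and j="\<lambda>j. j - 1"]) auto
    finally show ?thesis ..
  qed
  define G where "G = multiset_series deg {l. lyndon l}"
  have stable: "fps_nth (multiset_series deg (LL N)) n = fps_nth G n" if "N \<ge> n" for N n
  proof -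
    have "lyndon_multisets deg (LL N) n k = lyndon_multisets deg {l. lyndon l} n k" for k
    proof -
      have "wdeg deg l \<le> (\<Sum>l\<in>#M. wdeg deg l)" if "l \<in># M" for l M
        using that by (auto dest!: multi_member_split)
      then show ?thesis using \<open>N \<ge> n\<close> by (fastforce simp: lyndon_multisets_def LL_def)
    qed
    then show ?thesis by (simp add: G_def multiset_series_def)
  qed
  have "(\<lambda>m. \<Prod>j\<le>m. ?f j) \<longlonglongrightarrow> G"
  proof (rule tendsto_fpsI)
    fix n
    show "\<forall>\<^sub>F m in sequentially. fps_nth (\<Prod>j\<le>m. ?f j) n = fps_nth G n"
      unfolding part using stable by (intro eventually_sequentiallyI[of n]) simp
  qed
  \<comment> \<open>Convergence in the sense of \<open>has_prod\<close> demands a nonzero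
    limit.\<close>
  moreover have "G \<noteq> 0"
  proof -
    have "lyndon_multisets deg {l. lyndon l} 0 0 = {{#}}" by (auto simp: lyndon_multisets_def)
    then have "fps_nth (fps_nth G 0) 0 = 1" by (simp add: G_def multiset_series_def)
    then show ?thesis by auto
  qed
  ultimately have "?f has_prod G" by (simp add: has_prod_def raw_has_prod_def)
  then have "lyndon_series deg = G"
    unfolding lyndon_series_def by (rule has_prod_unique[symmetric])
  then show ?thesis
    using bij_betw_same_card[OF bij_betw_lyndon_multisets[of deg n k]]
    by (simp add: G_def multiset_series_def)
qed

section \<open>The eigenbasis in terms of words\<close>

lemma std_bracket_hom:
  fixes \<theta> :: "'r::ring_1 \<Rightarrow> 's::ring_1"
  assumes "\<And>x y. \<theta> (x * y) = \<theta> x * \<theta> y" "\<And>x y. \<theta> (x - y) = \<theta> x - \<theta> y"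
  shows "\<theta> (std_bracket \<phi> l) = std_bracket (\<lambda>c. \<theta> (\<phi> c)) l"
proof (induction l rule: measure_induct_rule[of length])
  case (less l)
  show ?case
  proof (cases "length l < 2")
    case True
    then show ?thesis by (simp add: std_bracket.simps)
  next
    case False
    then show ?thesis
      using std_pos_bounds[of l]
      by (subst (1 2) std_bracket.simps) (simp add: Let_def assms less)
  qed
qed

lemma sym_bracket_hom:
  fixes \<theta> :: "('b::monoid_add \<Rightarrow>\<^sub>0 'k::field) \<Rightarrow> ('d::monoid_add \<Rightarrow>\<^sub>0 'k)"
  assumes "lin \<theta>" "\<theta> 1 = 1" "\<And>x y. \<theta> (x * y) = \<theta> x * \<theta> y"
  shows "\<theta> (sym_bracket \<phi> b) = sym_bracket (\<lambda>c. \<theta> (\<phi> c)) b"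
proof -
  have "\<theta> (prod_list xs) = prod_list (map \<theta> xs)" for xs
    by (induction xs) (simp_all add: assms(2,3))
  moreover have "\<theta> (std_bracket \<phi> l) = std_bracket (\<lambda>c. \<theta> (\<phi> c)) l" for l
    using assms(3) lin_diff[OF assms(1)] by (rule std_bracket_hom)
  ultimately show ?thesis
    unfolding sym_bracket_def Let_def by (simp add: lin_sum[OF assms(1)] o_def)
qed

lemma keys_std_bracket_basis:
  assumes "l \<noteq> []" "z \<in> keys (std_bracket (\<lambda>c. basis [c] :: ('c::linorder, 'k::field) free_alg) l)"
  shows "mset z = mset l"
  using assms
proof (induction l arbitrary: z rule: measure_induct_rule[of length])
  case (less l)
  let ?br = "std_bracket (\<lambda>c. basis [c] :: ('c, 'k) free_alg)"
  show ?case
  proof (cases "length l < 2")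
    case True
    with less.prems(1) obtain c where "l = [c]"
      by (cases l) (auto simp: numeral_2_eq_2 less_Suc_eq_0_disj)
    then show ?thesis using less.prems(2) by (simp add: std_bracket.simps)
  next
    case False
    let ?u = "take (std_pos l) l" and ?v = "drop (std_pos l) l"
    have len: "length ?u < length l" "length ?v < length l" "?u \<noteq> []" "?v \<noteq> []"
      using std_pos_bounds[of l] False by auto
    have "?br l = ?br ?u * ?br ?v - ?br ?v * ?br ?u"
      using False by (subst std_bracket.simps) (simp add: Let_def)
    then have "z \<in> keys (?br ?u * ?br ?v) \<union> keys (?br ?v * ?br ?u)"
      using less.prems(2) keys_minus_subset by fastforce
    then have "\<exists>x y. mset z = mset x + mset y \<and> x \<in> keys (?br ?u) \<and> y \<in> keys (?br ?v)"
    proof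
      assume "z \<in> keys (?br ?u * ?br ?v)"
      then obtain x y where "z = x @ y" "x \<in> keys (?br ?u)" "y \<in> keys (?br ?v)"
        by (rule keys_mult_wordE)
      then show ?thesis by (intro exI[of _ x] exI[of _ y]) simp
    next
      assume "z \<in> keys (?br ?v * ?br ?u)"
      then obtain y x where "z = y @ x" "y \<in> keys (?br ?v)" "x \<in> keys (?br ?u)"
        by (rule keys_mult_wordE)
      then show ?thesis by (intro exI[of _ x] exI[of _ y]) simp
    qed
    then obtain x y where "mset z = mset x + mset y" "x \<in> keys (?br ?u)" "y \<in> keys (?br ?v)" by blast
    then have "mset z = mset ?u + mset ?v" using less.IH[OF len(1,3)] less.IH[OF len(2,4)] by simp
    also have "\<dots> = mset l" by (simp only: mset_append[symmetric] append_take_drop_id)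
    finally show ?thesis .
  qed
qed

lemma keys_sym_word:
  assumes "z \<in> keys (sym_word b :: ('c::linorder, 'k::field) free_alg)"
  shows "mset z = mset b"
proof -
  let ?bs = "lyndon_factors b" and ?br = "std_bracket (\<lambda>c. basis [c] :: ('c, 'k) free_alg)"
  have prod: "mset z = (\<Sum>l\<leftarrow>ls. mset l)"
    if "z \<in> keys (prod_list (map ?br ls))" "\<And>l. l \<in> set ls \<Longrightarrow> l \<noteq> []" for z ls
    using that
  proof (induction ls arbitrary: z)
    case Nil
    then show ?case by (simp add: zero_list_def)
  next
    case (Cons l ls)
    from Cons.prems(1) have "z \<in> keys (?br l * prod_list (map ?br ls))" by simp
    then obtain x y where "z = x @ y" "x \<in> keys (?br l)" "y \<in> keys (prod_list (map ?br ls))"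
      by (rule keys_mult_wordE)
    then show ?case using keys_std_bracket_basis[of l x] Cons.IH[of y] Cons.prems(2) by simp
  qed
  obtain \<sigma> where \<sigma>: "\<sigma> permutes {..<length ?bs}" 
      "z \<in> keys (prod_list (map (\<lambda>i. ?br (?bs ! \<sigma> i)) [0..<length ?bs]))"
    using subsetD[OF keys_sum_subset assms[unfolded sym_word_def sym_bracket_def Let_def]]
    by (elim UN_E CollectE)
  have "map (\<lambda>i. ?br (?bs ! \<sigma> i)) [0..<length ?bs] = map ?br (permute_list \<sigma> ?bs)"
    by (simp add: permute_list_def)
  then have "mset z = (\<Sum>l\<leftarrow>permute_list \<sigma> ?bs. mset l)"
    using \<sigma> lyndon_nonempty lyndon_lyndon_factors set_permute_list[OF \<sigma>(1)] by (intro prod) auto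
  also have "\<dots> = (\<Sum>l\<in>#mset (permute_list \<sigma> ?bs). mset l)"
    by (simp only: sum_mset_sum_list[symmetric] mset_map)
  also have "mset (permute_list \<sigma> ?bs) = mset ?bs" by (rule mset_permute_list[OF \<sigma>(1)])
  also have "(\<Sum>l\<in>#mset ?bs. mset l) = mset (concat ?bs)"
    by (simp only: mset_concat sum_mset_sum_list[symmetric] mset_map)
  finally show ?thesis by simp
qed

context lyndon_hopf
begin

section \<open>Substituting Eulerian images for letters\<close>

definition pword :: "'c list \<Rightarrow> ('c, 'k) free_alg" where
  "pword u = prod_list (map prim u)"

lemma pword_Nil [simp]: "pword [] = 1"
  and pword_Cons: "pword (c # u) = prim c * pword u"
  and pword_append: "pword (u @ v) = pword u * pword v"
  by (simp_all add: pword_def)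

lemma lin_ext_pword_mult: "lin_ext pword (x * y) = lin_ext pword x * lin_ext pword y"
proof -
  have "lin_ext pword (basis u * y) = pword u * lin_ext pword y" for u
    by (rule lin_eqI[where x=y]) (intro lin_intros | simp add: pword_append flip: basis_append)+
  then show ?thesis
    by (intro lin_eqI[where x=x and f="\<lambda>x. lin_ext pword (x * y)", rotated 2]) (intro lin_intros | simp)+
qed

text \<open>Brackets and symmetrization commute with algebra homomorphisms, here the endomorphism
  that sends each letter to its Eulerian image. As \<open>sym_word b\<close> consists of
  rearrangements of \<open>b\<close>, all words of \<open>gvec \<Delta> b\<close> come from
  expanding the letters of such rearrangements.\<close>

lemma gvec_eq_lin_ext: "gvec \<Delta> b = lin_ext pword (sym_word b)"
  unfolding sym_word_def gvec_def
proof (subst sym_bracket_hom[OF lin_lin_ext _ lin_ext_pword_mult])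
  show "lin_ext pword 1 = 1" unfolding basis_Nil[symmetric] lin_ext_basis by (simp add: basis_Nil)
qed (simp add: pword_def)

lemma wdeg_prim: "z \<in> keys (prim c) \<Longrightarrow> wdeg deg z = deg c"
  using keys_eulerian(2)[of "[c]" z] by simp

lemma wdeg_pword: "z \<in> keys (pword u) \<Longrightarrow> wdeg deg z = wdeg deg u"
proof (induction u arbitrary: z)
  case Nil
  then show ?case by (simp add: zero_list_def)
next
  case (Cons c u)
  then show ?case by (auto simp: pword_Cons wdeg_prim elim!: keys_mult_wordE)
qed

lemma pword_leading:
  "z \<in> keys (pword u) \<Longrightarrow> length u \<le> length z \<and> (length z = length u \<longrightarrow> z = u)"
  "lookup (pword u) u = 1"
proof (induction u arbitrary: z)
  case Nil
  { case 1 then show ?case by (simp add: zero_list_def) next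
    case 2 then show ?case by (simp flip: basis_Nil) }
next
  case (Cons c u)
  have c: "1 \<le> length x \<and> (length x = 1 \<longrightarrow> x = [c])" if "x \<in> keys (prim c)" for x
  proof -
    have "x = [c]" if "length x \<le> 1"
      using \<open>x \<in> keys (prim c)\<close> lookup_prim_length_1[OF that, of c]
      by (simp add: in_keys_iff lookup_basis split: if_splits)
    then show ?thesis using leadingD[OF leading_prim(1) that] by auto
  qed
  { case 1
    then show ?case
      by (fastforce simp: pword_Cons elim!: keys_mult_wordE dest!: c Cons.IH(1)) 
  next
    case 2
    have "lookup (pword (c # u)) ([c] @ u) = lookup (prim c) [c] * lookup (pword u) u"
      unfolding pword_Cons using Cons.IH(1)
      by (intro lookup_mult_leading leading_prim(1)) (auto simp: leading_def)
    then show ?case using Cons.IH(2) leading_prim(2) by simp }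
qed

lemma lookup_pword_short: "length z \<le> length u \<Longrightarrow> lookup (pword u) z = lookup (basis u) z"
  using pword_leading(1)[of z u] pword_leading(2)[of u]
  by (cases "z \<in> keys (pword u)") (auto simp: lookup_basis lookup_eq_0)

text \<open>All words of \<open>sym_word b\<close> have the length of \<open>b\<close>, and
  expanding their letters adds only longer words.\<close>

lemma lookup_gvec_short:
  assumes "length z \<le> length b"
  shows "lookup (gvec \<Delta> b) z = lookup (sym_word b) z"
proof -
  have "lookup (gvec \<Delta> b) z = (\<Sum>u\<in>keys (sym_word b :: ('c, 'k) free_alg). lookup (sym_word b) u * lookup (basis u) z)"
    unfolding gvec_eq_lin_ext lookup_lin_ext
    using assms by (intro sum.cong) (auto dest!: keys_sym_word mset_eq_length simp: lookup_pword_short)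
  also have "\<dots> = lookup (lin_ext basis (sym_word b)) z" by (simp only: lookup_lin_ext)
  finally show ?thesis by simp
qed

lemma lookup_sum_basis:
  assumes "finite A"
  shows "lookup (\<Sum>b\<in>A. scale_pm (h b) (basis b)) z = (if z \<in> A then h z else 0)"
  using assms by (simp add: lookup_sum lookup_basis mult_delta_right sum.delta)

lemma gvec_eq_sym_word_plus_longer:
  "gvec \<Delta> b = sym_word b + (\<Sum>b' | b' \<in> keys (gvec \<Delta> b) \<and> length b' > length b.
      scale_pm (lookup (gvec \<Delta> b) b') (basis b'))"
proof (rule poly_mapping_eqI)
  fix z
  show "lookup (gvec \<Delta> b) z = lookup (sym_word b + (\<Sum>b' | b' \<in> keys (gvec \<Delta> b) \<and> length b' > length b.
      scale_pm (lookup (gvec \<Delta> b) b') (basis b'))) z"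
  proof (cases "length z \<le> length b")
    case True
    then show ?thesis by (simp add: lookup_add lookup_sum_basis lookup_gvec_short)
  next
    case False
    then have "z \<notin> keys (sym_word b :: ('c, 'k) free_alg)" by (auto dest!: keys_sym_word mset_eq_length)
    then show ?thesis using False by (simp add: lookup_add lookup_sum_basis lookup_eq_0 in_keys_iff)
  qed
qed

lemma gvec_eq_sum_keys:
  assumes "\<And>b'. b' \<in> keys (gvec \<Delta> b) \<Longrightarrow> P b'"
  shows "gvec \<Delta> b = (\<Sum>b' | b' \<in> keys (gvec \<Delta> b) \<and> P b'. scale_pm (lookup (gvec \<Delta> b) b') (basis b'))"
  by (rule poly_mapping_eqI) (use assms in \<open>auto simp: lookup_sum_basis in_keys_iff\<close>)

lemma keys_gvec:
  assumes "z \<in> keys (gvec \<Delta> b)"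
  obtains u where "mset u = mset b" "z \<in> keys (pword u)"
  using assms keys_lin_ext[of pword "sym_word b"] keys_sym_word[of _ b]
  unfolding gvec_eq_lin_ext by blast

lemma wdeg_mset: "mset u = mset v \<Longrightarrow> wdeg deg u = wdeg deg v"
  unfolding wdeg_def by (metis mset_map sum_mset_sum_list)

lemma gvec_in_homog: "gvec \<Delta> b \<in> homog deg (wdeg deg b)"
  by (auto simp: homog_def words_def elim!: keys_gvec dest!: wdeg_pword wdeg_mset)

section \<open>Span and dimension of the eigenspaces\<close>

lemma subspace_homog: "pmv.subspace (homog deg n)"
  using keys_add by (fastforce simp: pmv.subspace_def homog_def keys_scale_pm)

text \<open>A dimension count: there are as many independent vectors \<open>gvec \<Delta> b\<close>
  of degree \<open>n\<close> as words spanning that component.\<close>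

lemma span_gvec: "pmv.span (gvec \<Delta> ` words deg n) = homog deg n"
proof (rule antisym)
  show "pmv.span (gvec \<Delta> ` words deg n) \<subseteq> homog deg n"
    using gvec_in_homog by (intro pmv.span_minimal subspace_homog) (auto simp: words_def)
  show "homog deg n \<subseteq> pmv.span (gvec \<Delta> ` words deg n)"
  proof (rule ccontr)
    let ?G = "gvec \<Delta> ` words deg n" and ?B = "basis ` words deg n :: ('c, 'k) free_alg set"
    assume "\<not> homog deg n \<subseteq> pmv.span ?G"
    then obtain x where x: "x \<in> homog deg n" "x \<notin> pmv.span ?G" by blast
    have homog_span: "homog deg n \<subseteq> pmv.span ?B"
    proof
      fix y :: "('c, 'k) free_alg" assume "y \<in> homog deg n"
      then have "lin_ext basis y \<in> pmv.span ?B"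
        unfolding lin_ext_def homog_def by (intro pmv.span_sum pmv.span_scale pmv.span_base) auto
      then show "y \<in> pmv.span ?B" by simp
    qed
    have "pmv.independent (insert x ?G)"
      using x independent_gvec by (intro pmv.independent_insertI) auto
    moreover have "insert x ?G \<subseteq> pmv.span ?B"
      using x homog_span gvec_in_homog by (auto simp: words_def)
    ultimately have "card (insert x ?G) \<le> card ?B"
      using pmv.independent_span_bound[of ?B] finite_words by blast
    moreover have "card (insert x ?G) = Suc (card (words deg n))"
      using x pmv.span_base[of x ?G] finite_words independent_gvec[of "words deg n"]
      by (subst card_insert_disjoint) (auto simp: card_image)
    moreover have "card ?B \<le> card (words deg n)" using finite_words by (rule card_image_le)
    ultimately show False by simp
  qed
qed

text \<open>For \<open>a \<ge> 2\<close> the powers of \<open>a\<close> are pairwise distinct in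
  characteristic zero, so an eigenvector involves only the members of the eigenbasis with its own
  eigenvalue.\<close>

lemma dim_eigenspace:
  assumes "a \<ge> 2"
  shows "pmv.dim {x \<in> homog deg n. hopf_power \<Delta> a x = scale_pm (of_nat a ^ k) x}
    = card {b \<in> words deg n. length (lyndon_factors b) = k}"
proof -
  let ?E = "{x \<in> homog deg n. hopf_power \<Delta> a x = scale_pm (of_nat a ^ k) x}"
  let ?W = "{b \<in> words deg n. length (lyndon_factors b) = k}"
  have hp: "hopf_power \<Delta> a = \<Psi> a" using assms by (simp add: hopf_power_eq_cpow)
  have "pmv.subspace ?E"
    using subspace_homog[of n] unfolding hp pmv.subspace_def
    by (auto simp: lin_add[OF lin_cpow'] lin_zero[OF lin_cpow'] lin_scale[OF lin_cpow']
        pmv.scale_right_distrib mult.commute)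
  then have "pmv.span (gvec \<Delta> ` ?W) \<subseteq> ?E"
    using gvec_in_homog by (intro pmv.span_minimal) (auto simp: hp cpow_id_gvec words_def)
  moreover have "?E \<subseteq> pmv.span (gvec \<Delta> ` ?W)"
  proof
    fix x assume x: "x \<in> ?E"
    then have "x \<in> pmv.span (gvec \<Delta> ` words deg n)" by (simp add: span_gvec)
    then obtain u where "x = (\<Sum>v\<in>gvec \<Delta> ` words deg n. scale_pm (u v) v)"
      using finite_words by (auto simp: pmv.span_finite)
    then have x_eq: "x = (\<Sum>b\<in>words deg n. scale_pm (u (gvec \<Delta> b)) (gvec \<Delta> b))"
      using independent_gvec[of "words deg n"] by (simp add: sum.reindex)
    let ?c = "\<lambda>b. u (gvec \<Delta> b)"
    \<comment> \<open>Applying \<open>\<Psi> a\<close> minus the eigenvalue to the expansion of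
      \<open>x\<close> multiplies each coefficient by a difference of eigenvalues.\<close>
    have "(\<Sum>b\<in>words deg n. scale_pm (?c b * (of_nat a ^ length (lyndon_factors b) - of_nat a ^ k)) (gvec \<Delta> b))
        = \<Psi> a x - scale_pm (of_nat a ^ k) x"
      by (simp add: x_eq lin_sum[OF lin_cpow'] lin_scale[OF lin_cpow'] cpow_id_gvec pmv.scale_sum_right
          right_diff_distrib pmv.scale_left_diff_distrib sum_subtractf mult.commute)
    also have "\<dots> = 0" using x by (simp add: hp)
    finally have zero: "?c b * (of_nat a ^ length (lyndon_factors b) - of_nat a ^ k) = 0" if "b \<in> words deg n" for b
      using that by (rule gvec_coefficients_eq_0[OF finite_words])
    have "of_nat a ^ i \<noteq> (of_nat a ^ k :: 'k)" if "i \<noteq> k" for i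
    proof -
      have "a ^ i \<noteq> a ^ k" using that assms by (simp add: power_inject_exp)
      then show ?thesis by (metis of_nat_eq_iff of_nat_power)
    qed
    with zero have "?c b = 0" if "b \<in> words deg n" "length (lyndon_factors b) \<noteq> k" for b
      using that by auto
    then have "x = (\<Sum>b\<in>?W. scale_pm (?c b) (gvec \<Delta> b))"
      unfolding x_eq using finite_words by (intro sum.mono_neutral_right) auto
    then show "x \<in> pmv.span (gvec \<Delta> ` ?W)"
      by (simp only:) (intro pmv.span_sum pmv.span_scale pmv.span_base imageI)
  qed
  ultimately have "?E = pmv.span (gvec \<Delta> ` ?W)" by blast
  then have "pmv.dim ?E = card (gvec \<Delta> ` ?W)"
    using independent_gvec[of ?W] by (simp add: pmv.dim_span pmv.dim_eq_card_independent)
  also have "\<dots> = card ?W" using independent_gvec[of ?W] by (simp add: card_image)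
  finally show ?thesis .
qed

end

section \<open>Positivity and rearrangements\<close>

lemma mult_eq_lin_ext:
  "x * y = lin_ext (\<lambda>a. lin_ext (\<lambda>b. basis (a + b)) y) (x :: 'd::monoid_add \<Rightarrow>\<^sub>0 'k::field)"
proof -
  have "basis a * y = lin_ext (\<lambda>b. basis (a + b)) y" for a
    by (rule lin_eqI[where x=y]) (intro lin_intros | simp add: basis_mult)+
  then show ?thesis
    by (intro lin_eqI[where x=x and f="\<lambda>x. x * y", rotated 2]) (intro lin_intros | simp)+
qed

text \<open>A substitute for the positive elements of an ordered field: sums of members never
  cancel. It is used both for the scalars provided by \<open>nonneg_coprod\<close> and for the
  positive integers in characteristic zero.\<close>

locale positive_cone =
  fixes P :: "'k::field set"
  assumes zero_notin: "0 \<notin> P" and one_in: "1 \<in> P"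
    and plus_in: "x \<in> P \<Longrightarrow> y \<in> P \<Longrightarrow> x + y \<in> P"
    and times_in: "x \<in> P \<Longrightarrow> y \<in> P \<Longrightarrow> x * y \<in> P"
begin

definition nonneg :: "('b \<Rightarrow>\<^sub>0 'k) \<Rightarrow> bool" where
  "nonneg x \<longleftrightarrow> (\<forall>b. lookup x b \<in> insert 0 P)"

lemma sum_nonneg:
  assumes "finite A" "\<And>a. a \<in> A \<Longrightarrow> h a \<in> insert 0 P"
  shows "sum h A \<in> insert 0 P \<and> (\<forall>a\<in>A. h a \<noteq> 0 \<longrightarrow> sum h A \<noteq> 0)"
  using assms
proof (induction A rule: finite_induct)
  case (insert a A)
  then have IH: "sum h A \<in> insert 0 P" "\<forall>a\<in>A. h a \<noteq> 0 \<longrightarrow> sum h A \<noteq> 0" by auto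
  have ha: "h a \<in> insert 0 P" using insert by auto
  have sum: "sum h (insert a A) = h a + sum h A" using insert by simp
  show ?case
  proof (cases "h a = 0 \<or> sum h A = 0")
    case True
    then show ?thesis unfolding sum using IH ha by auto
  next
    case False
    then have "h a + sum h A \<in> P" using IH ha plus_in by auto
    then show ?thesis unfolding sum using zero_notin by auto
  qed
qed simp

lemma nonneg_basis: "nonneg (basis b)"
  using one_in by (simp add: nonneg_def lookup_basis)

text \<open>The second fact is the absence of cancellation: a word of any single term survives in
  the sum.\<close>

lemma lin_ext_nonneg:
  assumes "nonneg x" "\<And>b. b \<in> keys x \<Longrightarrow> nonneg (f b)"
  shows "nonneg (lin_ext f x)"
    and "b \<in> keys x \<Longrightarrow> z \<in> keys (f b) \<Longrightarrow> z \<in> keys (lin_ext f x)"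
proof -
  have *: "lookup x b * lookup (f b) z \<in> insert 0 P" if "b \<in> keys x" for b z
    using assms that times_in by (fastforce simp: nonneg_def)
  show "nonneg (lin_ext f x)"
    unfolding nonneg_def lookup_lin_ext by (rule allI, rule conjunct1[OF sum_nonneg[OF finite_keys *]])
  have "\<forall>a\<in>keys x. lookup x a * lookup (f a) z \<noteq> 0 \<longrightarrow> lookup (lin_ext f x) z \<noteq> 0"
    unfolding lookup_lin_ext by (rule conjunct2[OF sum_nonneg[OF finite_keys *]])
  moreover assume "b \<in> keys x" "z \<in> keys (f b)"
  ultimately show "z \<in> keys (lin_ext f x)" by (auto simp: in_keys_iff)
qed

lemma mult_nonneg:
  fixes x y :: "'d::monoid_add \<Rightarrow>\<^sub>0 'k"
  assumes "nonneg x" "nonneg y"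
  shows "nonneg (x * y)" and "a \<in> keys x \<Longrightarrow> b \<in> keys y \<Longrightarrow> a + b \<in> keys (x * y)"
proof -
  have inner: "nonneg (lin_ext (\<lambda>b. basis (a + b)) y)" for a
    using assms(2) nonneg_basis by (rule lin_ext_nonneg)
  show "nonneg (x * y)"
    unfolding mult_eq_lin_ext using assms(1) inner by (rule lin_ext_nonneg)
  assume ab: "a \<in> keys x" "b \<in> keys y"
  have "a + b \<in> keys (lin_ext (\<lambda>b. basis (a + b)) y)"
    by (rule lin_ext_nonneg(2)[OF assms(2) nonneg_basis ab(2)]) simp
  then show "a + b \<in> keys (x * y)"
    unfolding mult_eq_lin_ext by (rule lin_ext_nonneg(2)[OF assms(1) inner ab(1)])
qed

text \<open>Send \<open>c\<close> to the left tensor factor and everything else to the right;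
  nothing cancels this term. \<open>D\<close> is kept abstract because both the coproduct and
  \<open>shuffle_coprod\<close> are inserted for it.\<close>

lemma key_move_front:
  assumes "\<And>w. nonneg (D w)" "\<And>u v. D (u @ v) = D u * D v"
    and "\<And>w. ([], w) \<in> keys (D w)" "([c], []) \<in> keys (D [c])"
  shows "([c], s @ t) \<in> keys (D (s @ c # t) :: 'c list \<times> 'c list \<Rightarrow>\<^sub>0 'k)"
proof -
  have "([c], []) + ([], t) \<in> keys (D [c] * D t)" using assms by (intro mult_nonneg) auto
  then have "([], s) + (([c], []) + ([], t)) \<in> keys (D s * (D [c] * D t))"
    using assms by (intro mult_nonneg) auto
  moreover have "D (s @ c # t) = D s * (D [c] * D t)"
    using assms(2)[of s "[c] @ t"] assms(2)[of "[c]" t] by simp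
  ultimately show ?thesis by (simp add: plus_list_def)
qed

end

text \<open>The filtration of the tensor square by total word length.\<close>

definition tensor_order :: "nat \<Rightarrow> ('c list \<times> 'c list \<Rightarrow>\<^sub>0 'k::field) \<Rightarrow> bool" where
  "tensor_order n T \<longleftrightarrow> (\<forall>(u, v)\<in>keys T. n \<le> length u + length v)"

lemma tensor_order_mult:
  assumes "tensor_order m T" "tensor_order n T'"
  shows "tensor_order (m + n) (T * T')"
  unfolding tensor_order_def
proof clarify
  fix u v assume "(u, v) \<in> keys (T * T')"
  then obtain a b where "(u, v) = a + b" "a \<in> keys T" "b \<in> keys T'"
    using keys_mult_subset by blast
  then show "m + n \<le> length u + length v"
    using assms by (cases a; cases b) (fastforce simp: tensor_order_def plus_list_def)
qed

lemma tensor_order_plus: "tensor_order n T \<Longrightarrow> tensor_order n T' \<Longrightarrow> tensor_order n (T + T')"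
  using keys_add[of T T'] by (fastforce simp: tensor_order_def)

context lyndon_hopf
begin

section \<open>Reachability in one step under a sign condition\<close>

lemma coprod_basis_append: "\<Delta> (basis (u @ v)) = \<Delta> (basis u) * \<Delta> (basis v)"
  by (simp add: basis_append coprod_mult)

lemma keys_coprod_trivial: "([], w) \<in> keys (\<Delta> (basis w))" "(w, []) \<in> keys (\<Delta> (basis w))"
  by (simp_all add: in_keys_iff lookup_coprod_Nil_left lookup_coprod_Nil_right)

text \<open>Without cancellation a word can be assembled piece by piece: for the first letter
  \<open>c\<close> of a rearrangement of \<open>b\<close>, the coproduct detaches \<open>c\<close>
  from \<open>b\<close>, one Hopf power expands it, another treats the rest, and the exponents
  add.\<close>

lemma leads_to_of_nonneg:
  assumes "nonneg_coprod \<Delta>" "z \<in> keys (gvec \<Delta> b)"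
  shows "leads_to \<Delta> b z"
proof -
  obtain P where P: "0 \<notin> P" "\<forall>x\<in>P. \<forall>y\<in>P. x + y \<in> P \<and> x * y \<in> P"
      "\<forall>w u v. lookup (\<Delta> (basis w)) (u, v) \<in> insert 0 P"
    using assms(1) unfolding nonneg_coprod_def by blast
  have "lookup (\<Delta> (basis [])) ([], []) = 1" by (simp add: coprod_basis_Nil)
  with P(3) have "1 \<in> P" by (metis insert_iff zero_neq_one)
  then interpret positive_cone P using P by unfold_locales auto
  have nn\<Delta>: "nonneg (\<Delta> (basis w))" for w using P(3) by (simp add: nonneg_def)
  have nn: "nonneg (\<Psi> n (basis w))" for n w
  proof (induction n arbitrary: w)
    case 0
    have "nonneg (basis [] :: ('c, 'k) free_alg)" by (rule nonneg_basis)
    then show ?case by (auto simp: conv_unit_basis nonneg_def basis_Nil)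
  next
    case (Suc n)
    show ?case unfolding cpow.simps conv_def
      by (rule lin_ext_nonneg[OF nn\<Delta>]) (auto intro: mult_nonneg nonneg_basis Suc)
  qed
  have step: "x @ y \<in> keys (\<Psi> (m + n) (basis w))"
    if "(u, v) \<in> keys (\<Delta> (basis w))" "x \<in> keys (\<Psi> m (basis u))"
      "y \<in> keys (\<Psi> n (basis v))" for x y m n w u v
    unfolding cpow_add[OF lin_id] conv_def
  proof (rule lin_ext_nonneg(2)[OF nn\<Delta> _ that(1)])
    show "x @ y \<in> keys (case (u, v) of (u, v) \<Rightarrow> \<Psi> m (basis u) * \<Psi> n (basis v))"
      using mult_nonneg(2)[OF nn nn that(2,3)] by (simp add: plus_list_def)
  qed (auto intro: mult_nonneg nn)
  have main: "\<exists>n. z \<in> keys (\<Psi> n (basis b))" if "mset u = mset b" "z \<in> keys (pword u)" for u b z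
    using that
  proof (induction u arbitrary: b z)
    case Nil
    then show ?case by (intro exI[of _ 0]) (simp add: conv_unit_basis)
  next
    case (Cons c u)
    then obtain x y where z: "z = x @ y" "x \<in> keys (prim c)" "y \<in> keys (pword u)"
      by (auto simp: pword_Cons elim: keys_mult_wordE)
    have "c \<in> set b" using Cons.prems(1) by (metis list.set_intros(1) set_mset_mset)
    then obtain s t where b: "b = s @ c # t" by (auto simp: in_set_conv_decomp)
    obtain m where m: "x \<in> keys (\<Psi> m (basis [c]))"
      using keys_eulerian(1)[of "[c]" x] z(2) by (auto simp: hopf_power_eq_cpow simp del: cpow.simps)
    obtain n where n: "y \<in> keys (\<Psi> n (basis (s @ t)))"
      using Cons.IH[of "s @ t" y] Cons.prems(1) z(3) b by auto
    have "([c], s @ t) \<in> keys (\<Delta> (basis (s @ c # t)))"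
      by (rule key_move_front[of "\<lambda>w. \<Delta> (basis w)"]) 
        (simp_all add: nn\<Delta> coprod_basis_append keys_coprod_trivial)
    from step[OF this m n] show ?case unfolding b z(1) by blast
  qed
  obtain u where "mset u = mset b" "z \<in> keys (pword u)" using assms(2) by (rule keys_gvec)
  then obtain n where "z \<in> keys (\<Psi> n (basis b))" using main by blast
  \<comment> \<open>\<open>main\<close> may deliver the exponent 0; splitting off an empty factor
    makes it positive, as \<open>leads_to\<close> demands.\<close>
  moreover have "[] \<in> keys (\<Psi> 1 (basis []) :: ('c, 'k) free_alg)"
    by (simp add: conv_unit_right lin_id)
  ultimately have "z @ [] \<in> keys (\<Psi> (n + 1) (basis b))"
    by (rule step[OF keys_coprod_trivial(2)])
  then have "lookup (hopf_power \<Delta> (n + 1) (basis b)) z \<noteq> 0"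
    by (simp add: hopf_power_eq_cpow in_keys_iff del: cpow.simps)
  then show ?thesis unfolding leads_to_def by (intro exI[of _ "n + 1"]) simp
qed

section \<open>Rearranging letters by the second Hopf power\<close>

definition hp2 :: "('c, 'k) free_alg \<Rightarrow> ('c, 'k) free_alg" where
  "hp2 x = tensor_mult (\<Delta> x)"

lemma lin_hp2 [lin_intros]: "lin f \<Longrightarrow> lin (\<lambda>x. hp2 (f x))"
  unfolding hp2_def by (intro lin_intros)

lemma lin_hp2': "lin hp2"
  using lin_hp2[OF lin_id] by simp

text \<open>The coproduct for which all letters are primitive; it agrees with \<Delta> in lowest
  total length.\<close>

definition shuffle_coprod :: "'c list \<Rightarrow> ('c list \<times> 'c list \<Rightarrow>\<^sub>0 'k)" where
  "shuffle_coprod w = prod_list (map (\<lambda>c. basis ([c], []) + basis ([], [c])) w)"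

lemma shuffle_coprod_append: "shuffle_coprod (u @ v) = shuffle_coprod u * shuffle_coprod v"
  by (simp add: shuffle_coprod_def)

lemma coprod_letter: "\<Delta> (basis [c]) = basis ([c], []) + basis ([], [c]) + reduced_coprod \<Delta> (basis [c])"
proof -
  have "tensor 1 (basis [c]) = (basis ([], [c]) :: 'c list \<times> 'c list \<Rightarrow>\<^sub>0 'k)"
    "tensor (basis [c]) 1 = (basis ([c], []) :: 'c list \<times> 'c list \<Rightarrow>\<^sub>0 'k)"
    by (simp_all flip: basis_Nil)
  then show ?thesis by (simp add: reduced_coprod_def)
qed

text \<open>The reduced coproduct of a letter has two nonempty factors and so adds at least one to
  the total length that a primitive letter would give. The bound for \<open>shuffle_coprod\<close>
  supports the induction.\<close>

lemma coprod_minus_shuffle_coprod: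
  "tensor_order (Suc (length w)) (\<Delta> (basis w) - shuffle_coprod w) \<and> tensor_order (length w) (shuffle_coprod w)"
proof (induction w)
  case Nil
  have "(\<Delta> (basis []) - shuffle_coprod []) = 0"
    by (simp add: shuffle_coprod_def basis_Nil coprod_one)
  then show ?case by (simp add: tensor_order_def)
next
  case (Cons c w)
  let ?d = "basis ([c], []) + basis ([], [c]) :: 'c list \<times> 'c list \<Rightarrow>\<^sub>0 'k"
  have 1: "tensor_order 2 (reduced_coprod \<Delta> (basis [c]))"
    unfolding tensor_order_def
  proof clarify
    fix u v assume "(u, v) \<in> keys (reduced_coprod \<Delta> (basis [c]))"
    then have "length u > 0 \<and> length v > 0" using keys_reduced_coprod[of "[c]" u v] by simp
    then show "2 \<le> length u + length v" by linarith
  qed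
  have 2: "tensor_order 1 ?d"
    by (rule tensor_order_plus) (simp_all add: tensor_order_def)
  have "\<Delta> (basis w) = (\<Delta> (basis w) - shuffle_coprod w) + shuffle_coprod w" by simp
  moreover have "tensor_order (length w) (\<Delta> (basis w) - shuffle_coprod w)"
    using Cons by (fastforce simp: tensor_order_def)
  ultimately have 3: "tensor_order (length w) (\<Delta> (basis w))"
    using Cons by (metis tensor_order_plus)
  have "\<Delta> (basis (c # w)) = \<Delta> (basis [c]) * \<Delta> (basis w)"
    using coprod_basis_append[of "[c]" w] by simp
  moreover have "shuffle_coprod (c # w) = ?d * shuffle_coprod w"
    by (simp add: shuffle_coprod_def)
  ultimately have "\<Delta> (basis (c # w)) - shuffle_coprod (c # w)
      = reduced_coprod \<Delta> (basis [c]) * \<Delta> (basis w) + ?d * (\<Delta> (basis w) - shuffle_coprod w)"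
    by (simp add: coprod_letter algebra_simps)
  moreover have "tensor_order (2 + length w) (reduced_coprod \<Delta> (basis [c]) * \<Delta> (basis w))"
    by (rule tensor_order_mult[OF 1 3])
  moreover have "tensor_order (1 + Suc (length w)) (?d * (\<Delta> (basis w) - shuffle_coprod w))"
    using Cons by (intro tensor_order_mult[OF 2]) simp
  moreover have "tensor_order (1 + length w) (?d * shuffle_coprod w)"
    using Cons by (intro tensor_order_mult[OF 2]) simp
  ultimately show ?case
    by (simp add: tensor_order_plus shuffle_coprod_def)
qed

lemma lookup_tensor_mult:
  "lookup (tensor_mult T) z = (\<Sum>k\<in>keys T. if fst k @ snd k = z then lookup T k else 0)"
  unfolding tensor_mult_def lookup_lin_ext
  by (rule sum.cong) (auto simp: lookup_basis)

text \<open>Words of the original length see only \<open>shuffle_coprod\<close>, whose coefficients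
  are natural numbers and hence do not cancel in characteristic zero.\<close>

lemma hp2_move_front: "c # s @ t \<in> keys (hp2 (basis (s @ c # t)))"
proof -
  let ?w = "s @ c # t" and ?z = "c # s @ t"
  define P :: "'k set" where "P = of_nat ` {1..}"
  interpret positive_cone P
    unfolding P_def
  proof
    show "(0 :: 'k) \<notin> of_nat ` {1..}" by (auto simp: image_iff)
    show "(1 :: 'k) \<in> of_nat ` {1..}" by (rule image_eqI[of _ _ 1]) simp_all
    fix x y :: 'k assume "x \<in> of_nat ` {1..}" "y \<in> of_nat ` {1..}"
    then obtain m n where mn: "x = of_nat m" "y = of_nat n" "m \<ge> 1" "n \<ge> 1" by auto
    show "x + y \<in> of_nat ` {1..}" by (rule image_eqI[of _ _ "m + n"]) (use mn in simp_all)
    show "x * y \<in> of_nat ` {1..}" by (rule image_eqI[of _ _ "m * n"]) (use mn in simp_all)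
  qed
  have letter: "nonneg (basis ([c], []) + basis ([], [c]) :: 'c list \<times> 'c list \<Rightarrow>\<^sub>0 'k)" for c
    unfolding nonneg_def lookup_add lookup_basis using one_in by auto
  have nn: "nonneg (shuffle_coprod w)" for w
  proof (induction w)
    case Nil
    have "nonneg (basis 0 :: 'c list \<times> 'c list \<Rightarrow>\<^sub>0 'k)" by (rule nonneg_basis)
    then show ?case by (simp add: shuffle_coprod_def basis_zero)
  next
    case (Cons c w)
    then show ?case using mult_nonneg(1)[OF letter] by (simp add: shuffle_coprod_def)
  qed
  have triv: "([], w) \<in> keys (shuffle_coprod w)" for w
  proof (induction w)
    case Nil
    show ?case by (simp add: shuffle_coprod_def zero_prod_def zero_list_def)
  next
    case (Cons c w)
    have "([], [c]) + ([], w) \<in> keys ((basis ([c], []) + basis ([], [c])) * shuffle_coprod w)"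
      by (rule mult_nonneg(2)[OF letter nn _ Cons]) (simp add: in_keys_iff lookup_add lookup_basis)
    then show ?case by (simp add: shuffle_coprod_def plus_list_def)
  qed
  have "([c], s @ t) \<in> keys (shuffle_coprod ?w)"
    using nn shuffle_coprod_append triv
    by (rule key_move_front) (simp add: shuffle_coprod_def in_keys_iff lookup_add lookup_basis)
  then have "?z \<in> keys (tensor_mult (shuffle_coprod ?w))"
    unfolding tensor_mult_def by (rule lin_ext_nonneg(2)[OF nn, rotated]) (auto intro: nonneg_basis)
  moreover have "lookup (tensor_mult (\<Delta> (basis ?w) - shuffle_coprod ?w)) ?z = 0"
    using coprod_minus_shuffle_coprod[of ?w] unfolding lookup_tensor_mult
    by (intro sum.neutral) (fastforce simp: tensor_order_def dest: arg_cong[where f=length])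
  then have "lookup (hp2 (basis ?w)) ?z = lookup (tensor_mult (shuffle_coprod ?w)) ?z"
    by (simp add: hp2_def lin_diff[OF lin_tensor_mult[OF lin_id]] lookup_minus)
  ultimately show ?thesis by (simp add: in_keys_iff)
qed

definition hp2_closed :: "'c list set \<Rightarrow> bool" where
  "hp2_closed R \<longleftrightarrow> (\<forall>w\<in>R. keys (hp2 (basis w)) \<subseteq> R)"

definition perm_closed :: "'c list set \<Rightarrow> bool" where
  "perm_closed R \<longleftrightarrow> (\<forall>w\<in>R. \<forall>w'. mset w' = mset w \<longrightarrow> w' \<in> R)"

lemma perm_closedD: "perm_closed R \<Longrightarrow> w \<in> R \<Longrightarrow> mset w' = mset w \<Longrightarrow> w' \<in> R"
  by (simp add: perm_closed_def)

lemma hp2_closed_keys: "hp2_closed R \<Longrightarrow> keys x \<subseteq> R \<Longrightarrow> keys (hp2 x) \<subseteq> R"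
  using lin_keys[OF lin_hp2', of x] by (fastforce simp: hp2_closed_def)

text \<open>\<open>w'\<close> is built from its last letter to its first, each letter being brought
  to the front by \<open>hp2_move_front\<close>.\<close>

lemma hp2_closed_imp_perm_closed:
  assumes "hp2_closed R" shows "perm_closed R"
  unfolding perm_closed_def
proof (intro ballI allI impI)
  fix w w' assume w: "w \<in> R" "mset w' = mset w"
  have "\<exists>t. s @ t \<in> R \<and> mset (s @ t) = mset w" if "w' = r @ s" for r s
    using that
  proof (induction s arbitrary: r)
    case Nil
    then show ?case using w(1) by auto
  next
    case (Cons c s)
    then obtain t where t: "s @ t \<in> R" "mset (s @ t) = mset w"
      using Cons.IH[of "r @ [c]"] by auto
    have "mset (s @ t) = mset (r @ c # s)" using t(2) w(2) Cons.prems by simp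
    then have "mset t = mset r + {#c#}" by simp
    then have "c \<in> set t" by (metis set_mset_mset union_single_eq_member add_mset_add_single)
    then obtain t1 t2 where t12: "t = t1 @ c # t2" by (auto simp: in_set_conv_decomp)
    have "c # (s @ t1) @ t2 \<in> R"
      using hp2_move_front[of c "s @ t1" t2] assms t(1) t12 by (auto simp: hp2_closed_def)
    then show ?case using t(2) t12 by (intro exI[of _ "t1 @ t2"]) auto
  qed
  from this[of "[]" w'] obtain t where "w' @ t \<in> R" "mset (w' @ t) = mset w" by auto
  then show "w' \<in> R" using w(2) by simp
qed

end

section \<open>Words occurring in the eigenvectors\<close>

lemma mset_split_letter: "mset (filter (\<lambda>a. a \<noteq> e) v @ replicate (count_list v e) e) = mset v"
  by (induction v) auto

lemma lookup_mult_basis: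
  fixes x :: "'d::monoid_add \<Rightarrow>\<^sub>0 'k::field"
  shows "lookup (x * basis b) z = (\<Sum>a\<in>keys x. if a + b = z then lookup x a else 0)"
  unfolding mult_eq_lin_ext by (auto simp: lookup_lin_ext lookup_basis intro!: sum.cong)

lemma lookup_mult_basis_eq:
  assumes "\<And>a'. a' + b = a + b \<Longrightarrow> a' = a"
  shows "lookup (x * basis b) (a + b) = lookup (x :: 'd::monoid_add \<Rightarrow>\<^sub>0 'k::field) a"
proof -
  have "(\<Sum>a'\<in>keys x. if a' + b = a + b then lookup x a' else 0) = (\<Sum>a'\<in>keys x. if a' = a then lookup x a' else 0)"
    using assms by (intro sum.cong) auto
  then show ?thesis by (simp add: lookup_mult_basis sum.delta in_keys_iff)
qed

lemma lookup_mult_basis_0: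
  "(\<And>a. a \<in> keys x \<Longrightarrow> a + b \<noteq> z) \<Longrightarrow> lookup (x * basis b) z = (0 :: 'k::field)"
  by (auto simp: lookup_mult_basis intro: sum.neutral)

lemma snoc_eq_replicate_Suc: "replicate (Suc t) e = replicate t e @ [e]"
  by (simp add: replicate_append_same)

lemma eq_replicate_iff: "l = replicate n s \<longleftrightarrow> length l = n \<and> (\<forall>x\<in>set l. x = s)"
  by (auto intro: replicate_eqI)

lemma basis_replicate: "basis (replicate t e) = (basis [e] ^ t :: ('c, 'k::field) free_alg)"
proof (induction t)
  case (Suc t)
  then show ?case by (simp add: basis_append[of "[e]" "replicate t e", simplified])
qed (simp add: basis_Nil)

text \<open>An occurrence of \<open>e\<close> in such a word lies in the final run, since
  \<open>z\<close> contains none.\<close>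

lemma append_Cons_eq_append_replicate:
  assumes "e \<notin> set z"
  shows "a @ e # b = z @ replicate (Suc t) e \<longleftrightarrow> (\<exists>i\<le>t. a = z @ replicate i e \<and> b = replicate (t - i) e)"
proof
  assume eq: "a @ e # b = z @ replicate (Suc t) e"
  have "length z \<le> length a"
  proof (rule ccontr)
    assume "\<not> length z \<le> length a"
    then have "z ! length a = (z @ replicate (Suc t) e) ! length a" by (simp add: nth_append)
    also have "\<dots> = e" unfolding eq[symmetric] by simp
    finally have "e \<in> set z" using \<open>\<not> length z \<le> length a\<close> nth_mem[of "length a" z] by simp
    with assms show False by simp
  qed
  then obtain a' where a': "a = z @ a'" "a' @ e # b = replicate (Suc t) e"
    using eq by (auto simp: append_eq_append_conv2)
  have "set (a' @ e # b) \<subseteq> {e}" "length (a' @ e # b) = Suc t"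
    by (simp_all only: a'(2) length_replicate) auto
  then have "set a' \<subseteq> {e}" "set b \<subseteq> {e}" "length a' + length b = t" by simp_all
  then have "a' = replicate (length a') e" "b = replicate (t - length a') e"
    by (auto simp: replicate_length_same subset_iff intro!: replicate_eqI)
  then show "\<exists>i\<le>t. a = z @ replicate i e \<and> b = replicate (t - i) e"
    using a'(1) \<open>length a' + length b = t\<close> by (intro exI[of _ "length a'"]) auto
next
  assume "\<exists>i\<le>t. a = z @ replicate i e \<and> b = replicate (t - i) e"
  then obtain i where i: "i \<le> t" "a = z @ replicate i e" "b = replicate (t - i) e" by blast
  have "replicate i e @ e # replicate (t - i) e = replicate (i + Suc (t - i)) e"
    by (simp add: replicate_add replicate_append_same)
  with i show "a @ e # b = z @ replicate (Suc t) e" by simp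
qed

context lyndon_hopf
begin

section \<open>Letters and degrees\<close>

lemma letters_of_wdeg:
  assumes "wdeg deg z = d" "c \<in> set z"
  shows "z = [c] \<or> deg c < d"
proof -
  obtain s t where z: "z = s @ c # t" using assms(2) by (auto simp: in_set_conv_decomp)
  show ?thesis
  proof (cases "s @ t = []")
    case False
    then have "wdeg deg s + wdeg deg t \<noteq> 0" by simp
    moreover have "d = wdeg deg s + wdeg deg t + deg c" using assms(1) z by simp
    ultimately have "deg c < d" by linarith
    then show ?thesis ..
  qed (use z in simp)
qed

text \<open>A letter of full degree would be the whole word, and the only one-letter word of
  \<open>prim c\<close> is \<open>[c]\<close>. This is what drives the induction on the
  degree.\<close>

lemma keys_prim:
  assumes "w \<in> keys (prim c)" "w \<noteq> [c]" "x \<in> set w"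
  shows "deg x < deg c"
proof (rule ccontr)
  assume "\<not> deg x < deg c"
  then have "w = [x]" using letters_of_wdeg[OF wdeg_prim[OF assms(1)] assms(3)] by simp
  then show False
    using assms(1,2) lookup_prim_length_1[of w c] by (simp add: in_keys_iff lookup_basis split: if_splits)
qed

lemma keys_reduced_coprod_letter:
  assumes "(u, v) \<in> keys (reduced_coprod \<Delta> (basis [e]))"
  shows "u \<noteq> []" "v \<noteq> []" "\<And>x. x \<in> set u \<union> set v \<Longrightarrow> deg x < deg e"
proof -
  show ne: "u \<noteq> []" "v \<noteq> []" using keys_reduced_coprod[OF _ assms] by simp_all
  have "(u, v) \<in> keys (\<Delta> (basis [e]))" using keys_reduced_coprod(3)[OF _ assms] by simp
  from wdeg_coprod[OF this] have sum: "wdeg deg u + wdeg deg v = deg e" by simp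
  fix x assume x: "x \<in> set u \<union> set v"
  have "wdeg deg u > 0" "wdeg deg v > 0" using ne wdeg_eq_0_iff by (metis gr0I)+
  have "deg x \<le> wdeg deg w" if "x \<in> set w" for w
    using member_le_sum_list[of "deg x" "map deg w"] that by (simp add: wdeg_def)
  then have "deg x \<le> wdeg deg u \<or> deg x \<le> wdeg deg v" using x by blast
  with \<open>wdeg deg u > 0\<close> \<open>wdeg deg v > 0\<close> sum show "deg x < deg e" by linarith
qed

text \<open>A reduced coproduct splits the degree of a letter between two nonempty words, so new
  letters have smaller degree than the one they come from.\<close>

lemma letters_coprod:
  "(u, v) \<in> keys (\<Delta> (basis w)) \<Longrightarrow> x \<in> set u \<union> set v \<Longrightarrow> \<exists>y\<in>set w. x = y \<or> deg x < deg y"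
proof (induction w arbitrary: u v)
  case Nil
  then show ?case by (simp add: coprod_basis_Nil)
next
  case (Cons c w)
  have "(u, v) \<in> keys (\<Delta> (basis [c]) * \<Delta> (basis w))"
    using Cons.prems(1) coprod_basis_append[of "[c]" w] by simp
  then obtain k1 k2 where "(u, v) = k1 + k2" "k1 \<in> keys (\<Delta> (basis [c]))" "k2 \<in> keys (\<Delta> (basis w))"
    using keys_mult_subset by blast
  then obtain u1 v1 u2 v2 where k: "u = u1 @ u2" "v = v1 @ v2"
      "(u1, v1) \<in> keys (\<Delta> (basis [c]))" "(u2, v2) \<in> keys (\<Delta> (basis w))"
    by (cases k1; cases k2) (auto simp: plus_list_def)
  show ?case
  proof (cases "x \<in> set u2 \<union> set v2")
    case True
    then show ?thesis using Cons.IH[OF k(4)] by auto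
  next
    case False
    then have x: "x \<in> set u1 \<union> set v1" using Cons.prems(2) k by auto
    have "(u1, v1) \<in> {([c], []), ([], [c])} \<union> keys (reduced_coprod \<Delta> (basis [c]))"
      using k(3) unfolding coprod_letter
      by (auto simp: in_keys_iff lookup_add lookup_basis split: if_splits)
    then have "x = c \<or> deg x < deg c"
      using x keys_reduced_coprod_letter(3)[of u1 v1 c x] by auto
    then show ?thesis by auto
  qed
qed

lemma letters_hp2:
  assumes "z \<in> keys (hp2 (basis w))" "x \<in> set z"
  shows "\<exists>y\<in>set w. x = y \<or> deg x < deg y"
proof -
  obtain u v where "(u, v) \<in> keys (\<Delta> (basis w))" "z = u @ v"
    using subsetD[OF keys_lin_ext assms(1)[unfolded hp2_def tensor_mult_def]] by auto
  then show ?thesis using letters_coprod[of u v w x] assms(2) by auto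
qed

lemma wdeg_hp2:
  assumes "z \<in> keys (hp2 x)" "x \<in> homog deg d" shows "wdeg deg z = d"
proof -
  obtain u v where "(u, v) \<in> keys (\<Delta> x)" "z = u @ v"
    using subsetD[OF keys_lin_ext assms(1)[unfolded hp2_def tensor_mult_def]] by auto
  then show ?thesis using coprod_graded[OF assms(2)] by simp
qed

section \<open>Coefficients at words ending in a run of one letter\<close>

lemma keys_tensor_mult_mult:
  assumes "z \<in> keys (tensor_mult (T * T'))"
  obtains a b a' b' where "(a, b) \<in> keys T" "(a', b') \<in> keys T'" "z = a @ a' @ b @ b'"
proof -
  obtain u v where uv: "(u, v) \<in> keys (T * T')" "z = u @ v"
    using subsetD[OF keys_lin_ext assms[unfolded tensor_mult_def]] by auto
  then obtain k k' where "(u, v) = k + k'" "k \<in> keys T" "k' \<in> keys T'"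
    using keys_mult_subset by blast
  then show ?thesis using uv(2) by (cases k; cases k') (auto simp: plus_list_def intro: that)
qed

lemma tensor_mult_mult_right:
  "tensor_mult (T * basis ([], w)) = (tensor_mult T * basis w :: ('c, 'k) free_alg)"
proof (rule lin_eqI[where x=T])
  fix k :: "'c list \<times> 'c list"
  show "tensor_mult (basis k * basis ([], w)) = (tensor_mult (basis k) * basis w :: ('c, 'k) free_alg)"
    by (cases k) (simp add: basis_mult plus_list_def)
qed (intro lin_intros)+

lemma lookup_tensor_mult_mult_left:
  fixes T :: "'c list \<times> 'c list \<Rightarrow>\<^sub>0 'k"
  shows "lookup (tensor_mult (T * basis ([e], []))) z
    = (\<Sum>k\<in>keys T. if fst k @ e # snd k = z then lookup T k else 0)"
proof -
  have "tensor_mult (T * basis ([e], [])) = lin_ext (\<lambda>(a, b). basis (a @ e # b)) T"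
  proof (rule lin_eqI[where x=T and f="\<lambda>T. tensor_mult (T * basis ([e], []))"])
    fix k :: "'c list \<times> 'c list"
    show "tensor_mult (basis k * basis ([e], [])) = (lin_ext (\<lambda>(a, b). basis (a @ e # b)) (basis k) :: ('c, 'k) free_alg)"
      by (cases k) (simp add: basis_mult plus_list_def)
  qed (intro lin_intros)+
  then show ?thesis
    by (simp only: lookup_lin_ext) (intro sum.cong, auto simp: lookup_basis)
qed

text \<open>Only the primitive parts of the factors \<open>\<Delta> (basis [e])\<close> contribute:
  a reduced term would leave letters other than \<open>e\<close> at the end of the right component.
  The binomial coefficient counts which \<open>i\<close> of the \<open>t\<close> factors put their
  \<open>e\<close> on the left.\<close>

lemma lookup_coprod_power:
  assumes "e \<notin> set z" "i + j = t"
  shows "lookup (T * \<Delta> (basis [e]) ^ t) (z @ replicate i e, replicate j e)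
    = of_nat (t choose i) * lookup T (z, [])"
  using assms(2)
proof (induction t arbitrary: i j)
  case (Suc t)
  let ?X = "T * \<Delta> (basis [e]) ^ t" and ?k = "(z @ replicate i e, replicate j e)"
  have X: "T * \<Delta> (basis [e]) ^ Suc t
      = ?X * basis ([e], []) + ?X * basis ([], [e]) + ?X * reduced_coprod \<Delta> (basis [e])"
    by (simp only: power_Suc2 mult.assoc[symmetric] coprod_letter[of e] distrib_left)
  have A: "lookup (?X * basis ([e], [])) ?k = (if i = 0 then 0 else of_nat (t choose (i - 1)) * lookup T (z, []))"
  proof (cases i)
    case 0
    have "lookup (?X * basis ([e], [])) ?k = 0"
      using assms(1) 0 by (intro lookup_mult_basis_0) (auto simp: plus_list_def)
    then show ?thesis using 0 by simp
  next
    case (Suc i')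
    have "?k = (z @ replicate i' e, replicate j e) + ([e], [])"
      using Suc by (simp add: plus_list_def replicate_append_same)
    then have "lookup (?X * basis ([e], [])) ?k = lookup ?X (z @ replicate i' e, replicate j e)"
      by (simp only:) (rule lookup_mult_basis_eq, auto simp: plus_list_def)
    then show ?thesis using Suc Suc.IH[of i' j] Suc.prems by simp
  qed
  have B: "lookup (?X * basis ([], [e])) ?k = (if j = 0 then 0 else of_nat (t choose i) * lookup T (z, []))"
  proof (cases j)
    case 0
    have "lookup (?X * basis ([], [e])) ?k = 0"
      using 0 by (intro lookup_mult_basis_0) (auto simp: plus_list_def)
    then show ?thesis using 0 by simp
  next
    case (Suc j')
    have "?k = (z @ replicate i e, replicate j' e) + ([], [e])"
      using Suc by (simp add: plus_list_def replicate_append_same)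
    then have "lookup (?X * basis ([], [e])) ?k = lookup ?X (z @ replicate i e, replicate j' e)"
      by (simp only:) (rule lookup_mult_basis_eq, auto simp: plus_list_def)
    then show ?thesis using Suc Suc.IH[of i j'] Suc.prems by simp
  qed
  have C: "lookup (?X * reduced_coprod \<Delta> (basis [e])) ?k = 0"
  proof (rule lookup_eq_0, rule notI)
    assume "?k \<in> keys (?X * reduced_coprod \<Delta> (basis [e]))"
    then obtain k1 k2 where k: "?k = k1 + k2" "k2 \<in> keys (reduced_coprod \<Delta> (basis [e]))"
      using keys_mult_subset by blast
    obtain d1 d2 where d: "k2 = (d1, d2)" by (cases k2)
    have "replicate j e = snd k1 @ d2" using k(1) d by (cases k1) (simp add: plus_list_def)
    then have "set d2 \<subseteq> set (replicate j e)" by simp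
    then have "set d2 \<subseteq> {e}" by auto
    moreover have "d2 \<noteq> []" "e \<notin> set d2" using keys_reduced_coprod_letter[OF k(2)[unfolded d]] by auto
    ultimately show False by (cases d2) auto
  qed
  show ?case
    unfolding X lookup_add A B C using Suc.prems
    by (cases i; cases j) (auto simp: algebra_simps binomial_eq_0)
qed simp

text \<open>The constant is the sum of \<open>2 ^ i\<close> for \<open>i < t\<close>. A further
  \<open>e\<close> on the right reproduces the previous coefficient; on the left it forces the right
  component to be a run of \<open>e\<close>, and \<open>lookup_coprod_power\<close> summed over all
  splits gives \<open>2 ^ t\<close>.\<close>

lemma lookup_tensor_mult_coprod_power:
  assumes "e \<notin> set z"
  shows "lookup (tensor_mult (T * \<Delta> (basis [e]) ^ t)) (z @ replicate t e)
    = lookup (tensor_mult T) z + (2 ^ t - 1) * lookup T (z, [])"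
proof (induction t)
  case (Suc t)
  let ?X = "T * \<Delta> (basis [e]) ^ t" and ?z = "z @ replicate (Suc t) e"
  have X: "tensor_mult (T * \<Delta> (basis [e]) ^ Suc t) = tensor_mult (?X * basis ([e], []))
      + tensor_mult (?X * basis ([], [e])) + tensor_mult (?X * reduced_coprod \<Delta> (basis [e]))"
    by (simp only: power_Suc2 mult.assoc[symmetric] coprod_letter[of e] distrib_left
        lin_add[OF lin_tensor_mult[OF lin_id]])
  have A: "lookup (tensor_mult (?X * basis ([], [e]))) ?z = lookup (tensor_mult ?X) (z @ replicate t e)"
    unfolding tensor_mult_mult_right snoc_eq_replicate_Suc append_assoc[symmetric]
    using lookup_mult_basis_eq[of "[e]" "z @ replicate t e" "tensor_mult ?X"] by (simp add: plus_list_def)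
  have B: "lookup (tensor_mult (?X * reduced_coprod \<Delta> (basis [e]))) ?z = 0"
  proof (rule lookup_eq_0, rule notI)
    assume "?z \<in> keys (tensor_mult (?X * reduced_coprod \<Delta> (basis [e])))"
    then obtain a b a' b' where ab: "(a', b') \<in> keys (reduced_coprod \<Delta> (basis [e]))" "?z = a @ a' @ b @ b'"
      by (rule keys_tensor_mult_mult)
    have "b' \<noteq> []" "e \<notin> set b'" using keys_reduced_coprod_letter[OF ab(1)] by auto
    moreover have "last ?z = e" by (simp add: snoc_eq_replicate_Suc del: replicate_Suc)
    ultimately show False unfolding ab(2) by (simp add: last_append split: if_splits) (metis last_in_set)
  qed
  have C: "lookup (tensor_mult (?X * basis ([e], []))) ?z = 2 ^ t * lookup T (z, [])"
  proof -
    have "lookup (tensor_mult (?X * basis ([e], []))) ?z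
        = (\<Sum>k\<in>keys ?X. if fst k @ e # snd k = ?z then lookup ?X k else 0)"
      by (rule lookup_tensor_mult_mult_left)
    also have "\<dots> = (\<Sum>k\<in>(\<lambda>i. (z @ replicate i e, replicate (t - i) e)) ` {..t}. lookup ?X k)"
      by (rule sum.mono_neutral_cong)
         (auto simp: append_Cons_eq_append_replicate[OF assms] in_keys_iff simp del: replicate_Suc)
    also have "\<dots> = (\<Sum>i\<le>t. lookup ?X (z @ replicate i e, replicate (t - i) e))"
      by (subst sum.reindex) (auto simp: inj_on_def)
    also have "\<dots> = (\<Sum>i\<le>t. of_nat (t choose i) * lookup T (z, []))"
      by (intro sum.cong) (auto simp: lookup_coprod_power[OF assms])
    also have "\<dots> = of_nat (\<Sum>i\<le>t. t choose i) * lookup T (z, [])"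
      by (simp add: sum_distrib_right)
    finally show ?thesis by (simp add: choose_row_sum)
  qed
  show ?case unfolding X lookup_add A B C Suc by (simp add: algebra_simps)
qed simp

lemma lookup_hp2_peel:
  assumes "e \<notin> set z"
  shows "lookup (hp2 (x * basis (replicate t e))) (z @ replicate t e)
    = lookup (hp2 x) z + (2 ^ t - 1) * lookup x z"
proof -
  have "\<Delta> (basis [e] ^ t) = \<Delta> (basis [e]) ^ t"
    by (induction t) (simp_all add: coprod_one coprod_mult)
  then have "\<Delta> (x * basis (replicate t e)) = \<Delta> x * \<Delta> (basis [e]) ^ t"
    by (simp add: coprod_mult basis_replicate)
  then show ?thesis
    by (simp add: hp2_def lookup_tensor_mult_coprod_power[OF assms] lookup_coprod_Nil_right)
qed

text \<open>In a power of one letter it does not matter on which side of the tensor an appended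
  \<open>s\<close> lands, hence a factor 2 for each; reduced terms would bring in other
  letters.\<close>

lemma lookup_hp2_pure:
  "lookup (hp2 (x * basis (replicate m s))) (replicate (r + m) s) = 2 ^ m * lookup (hp2 x) (replicate r s)"
proof (induction m)
  case (Suc m)
  let ?T = "\<Delta> (x * basis (replicate m s))" and ?n = "r + m"
  have "\<Delta> (x * basis (replicate (Suc m) s)) = ?T * \<Delta> (basis [s])"
    by (simp only: coprod_mult basis_replicate power_Suc2 mult.assoc)
  then have X: "hp2 (x * basis (replicate (Suc m) s)) = tensor_mult (?T * basis ([s], []))
      + tensor_mult (?T * basis ([], [s])) + tensor_mult (?T * reduced_coprod \<Delta> (basis [s]))"
    by (simp only: hp2_def coprod_letter[of s] distrib_left lin_add[OF lin_tensor_mult[OF lin_id]])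
  let ?z = "replicate (Suc ?n) s"
  have A: "lookup (tensor_mult (?T * basis ([], [s]))) ?z = lookup (tensor_mult ?T) (replicate ?n s)"
    unfolding tensor_mult_mult_right snoc_eq_replicate_Suc
    using lookup_mult_basis_eq[of "[s]" "replicate ?n s" "tensor_mult ?T"] by (simp add: plus_list_def)
  have B: "lookup (tensor_mult (?T * reduced_coprod \<Delta> (basis [s]))) ?z = 0"
  proof (rule lookup_eq_0, rule notI)
    assume "?z \<in> keys (tensor_mult (?T * reduced_coprod \<Delta> (basis [s])))"
    then obtain a b a' b' where ab: "(a', b') \<in> keys (reduced_coprod \<Delta> (basis [s]))" "?z = a @ a' @ b @ b'"
      by (rule keys_tensor_mult_mult)
    have "b' \<noteq> []" "s \<notin> set b'" using keys_reduced_coprod_letter[OF ab(1)] by auto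
    moreover have "set b' \<subseteq> set ?z" unfolding ab(2) by auto
    ultimately show False by (cases b') auto
  qed
  have C: "lookup (tensor_mult (?T * basis ([s], []))) ?z = lookup (tensor_mult ?T) (replicate ?n s)"
  proof -
    have "lookup (tensor_mult (?T * basis ([s], []))) ?z
        = (\<Sum>k\<in>keys ?T. if fst k @ s # snd k = ?z then lookup ?T k else 0)"
      by (rule lookup_tensor_mult_mult_left)
    also have "\<dots> = (\<Sum>k\<in>keys ?T. if fst k @ snd k = replicate ?n s then lookup ?T k else 0)"
    proof (intro sum.cong if_cong refl)
      fix k :: "'c list \<times> 'c list"
      have "a @ s # b = ?z \<longleftrightarrow> a @ b = replicate ?n s" for a b
        by (auto simp only: eq_replicate_iff) auto
      then show "fst k @ s # snd k = ?z \<longleftrightarrow> fst k @ snd k = replicate ?n s" .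
    qed
    finally show ?thesis by (simp add: lookup_tensor_mult)
  qed
  have "lookup (hp2 (x * basis (replicate (Suc m) s))) (replicate (r + Suc m) s)
     = 2 * lookup (hp2 (x * basis (replicate m s))) (replicate ?n s)"
    unfolding X lookup_add add_Suc_right A B C by (simp add: hp2_def)
  then show ?case using Suc by simp
qed (simp add: basis_Nil)

text \<open>Multiplying by \<open>tensor p 1 + tensor 1 p\<close> from the left and from the right,
  the two products that insert \<open>p\<close> between the tensor factors cancel in the
  difference.\<close>

lemma hp2_commutator:
  assumes "primitive p"
  shows "hp2 (p * x - x * p) = p * hp2 x - hp2 x * p"
proof -
  have "tensor_mult ((tensor p 1 + tensor 1 p) * T - T * (tensor p 1 + tensor 1 p))
      = p * tensor_mult T - tensor_mult T * p" for T :: "'c list \<times> 'c list \<Rightarrow>\<^sub>0 'k"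
  proof (rule lin_eqI[where x=T])
    fix k :: "'c list \<times> 'c list"
    obtain u v where k: "k = (u, v)" by (cases k)
    show "tensor_mult ((tensor p 1 + tensor 1 p) * basis k - basis k * (tensor p 1 + tensor 1 p))
      = p * tensor_mult (basis k) - tensor_mult (basis k) * p"
      unfolding k tensor_basis[symmetric]
      by (simp only: distrib_left distrib_right tensor_mult_tensor lin_add[OF lin_tensor_mult[OF lin_id]]
          lin_diff[OF lin_tensor_mult[OF lin_id]] tensor_mult_tensor_eq)
         (simp add: mult.assoc)
  qed (intro lin_intros)+
  then show ?thesis
    using assms by (simp add: hp2_def lin_diff[OF coprod_linear] coprod_mult primitiveD)
qed


text \<open>Only an initial letter is replaced; for sets closed under rearrangement this covers
  every position.\<close>

definition expands :: "'c \<Rightarrow> 'c list set \<Rightarrow> bool" where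
  "expands y R \<longleftrightarrow> (\<forall>v. y # v \<in> R \<longrightarrow> (\<forall>q\<in>keys (prim y). q @ v \<in> R))"

abbreviation residual :: "'c list set \<Rightarrow> 'c list \<Rightarrow> 'c list set" where
  "residual R v \<equiv> {w. w @ v \<in> R}"

lemma perm_closed_residual: "perm_closed R \<Longrightarrow> perm_closed (residual R v)"
  unfolding perm_closed_def by (metis mem_Collect_eq mset_append)

lemma expands_residual: "expands y R \<Longrightarrow> expands y (residual R v)"
  by (simp add: expands_def)

lemma expands_pword:
  assumes "\<And>y. y \<in> set u \<Longrightarrow> expands y R" "perm_closed R" "u @ v \<in> R" "q \<in> keys (pword u)"
  shows "q @ v \<in> R"
  using assms(1,3,4)
proof (induction u arbitrary: v q)
  case Nil
  then show ?case by (simp add: zero_list_def)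
next
  case (Cons y u)
  then obtain q1 q2 where q: "q = q1 @ q2" "q1 \<in> keys (prim y)" "q2 \<in> keys (pword u)"
    by (auto simp: pword_Cons elim: keys_mult_wordE)
  \<comment> \<open>\<open>y\<close> is moved behind \<open>u\<close>, so that the induction
    hypothesis can expand \<open>u\<close>, and then brought back to the front to be expanded
    itself.\<close>
  have "u @ y # v \<in> R"
    using Cons.prems(2) by (intro perm_closedD[OF assms(2) Cons.prems(2)]) simp
  then have "q2 @ y # v \<in> R" using Cons.IH[of "y # v" q2] Cons.prems(1) q(3) by simp
  then have "y # q2 @ v \<in> R" by (rule perm_closedD[OF assms(2)]) simp
  then have "q1 @ q2 @ v \<in> R" using Cons.prems(1)[of y] q(2) unfolding expands_def by simp
  then show ?case using q(1) by simp
qed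

section \<open>Iterated commutators with Eulerian images of letters\<close>

definition commutator :: "'c \<Rightarrow> ('c, 'k) free_alg \<Rightarrow> ('c, 'k) free_alg" where
  "commutator y x = prim y * x - x * prim y"

definition ad :: "'c list \<Rightarrow> ('c, 'k) free_alg \<Rightarrow> ('c, 'k) free_alg" where
  "ad ys x = foldr commutator ys x"

lemma ad_Nil [simp]: "ad [] x = x" and ad_Cons [simp]: "ad (y # ys) x = commutator y (ad ys x)"
  by (simp_all add: ad_def)

lemma ad_append: "ad (ys @ zs) x = ad ys (ad zs x)"
  by (simp add: ad_def)

lemma lin_commutator: "lin (commutator y)"
proof -
  have "lin (\<lambda>x. prim y * x - x * prim y)" by (intro lin_intros)
  then show ?thesis by (simp add: commutator_def[abs_def])
qed

lemma lin_ad: "lin (ad ys)"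
proof (induction ys)
  case Nil
  have "lin (\<lambda>x. x)" by (rule lin_id)
  then show ?case by (simp add: ad_def[abs_def])
next
  case (Cons y ys)
  have "lin (\<lambda>x. commutator y (ad ys x))" using lin_commutator Cons by (rule lin_compose)
  then show ?case by (simp add: ad_def[abs_def])
qed

lemma hp2_ad: "hp2 (ad ys x) = ad ys (hp2 x)"
  by (induction ys) (simp_all add: commutator_def hp2_commutator primitive_eulerian)

lemma keys_commutatorE:
  assumes "z \<in> keys (commutator y x)"
  obtains q w where "q \<in> keys (prim y)" "w \<in> keys x" "z = q @ w \<or> z = w @ q"
proof -
  have "z \<in> keys (prim y * x) \<union> keys (x * prim y)"
    by (rule subsetD[OF keys_minus_subset assms[unfolded commutator_def]])
  then show thesis
  proof
    assume "z \<in> keys (prim y * x)"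
    then show thesis by (rule keys_mult_wordE) (auto intro: that)
  next
    assume "z \<in> keys (x * prim y)"
    then show thesis by (rule keys_mult_wordE) (auto intro: that)
  qed
qed

text \<open>Each commutator trades one letter \<open>y\<close> of the completing word
  \<open>ys\<close> for a word of \<open>prim y\<close>, placed on either side.\<close>

lemma keys_ad:
  assumes "perm_closed R" "\<And>y. y \<in> set ys \<Longrightarrow> expands y R" "keys x \<subseteq> residual R ys"
  shows "keys (ad ys x) \<subseteq> R"
  using assms
proof (induction ys arbitrary: R)
  case (Cons y ys)
  have "keys (ad ys x) \<subseteq> residual R [y]"
  proof (rule Cons.IH)
    show "keys x \<subseteq> residual (residual R [y]) ys"
      using Cons.prems(3) by (auto intro: perm_closedD[OF Cons.prems(1)])
  qed (use Cons.prems in \<open>auto intro: perm_closed_residual expands_residual\<close>)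
  moreover have "expands y R" using Cons.prems(2) by simp
  ultimately show ?case
  proof (intro subsetI)
    fix z assume sub: "keys (ad ys x) \<subseteq> residual R [y]" "expands y R" and "z \<in> keys (ad (y # ys) x)"
    then obtain q w where qw: "q \<in> keys (prim y)" "w \<in> keys (ad ys x)" "z = q @ w \<or> z = w @ q"
      by (auto elim: keys_commutatorE)
    then have "w @ [y] \<in> R" using sub(1) by auto
    then have "y # w \<in> R" by (rule perm_closedD[OF Cons.prems(1)]) simp
    then have "q @ w \<in> R" using sub(2) qw(1) by (simp add: expands_def)
    then show "z \<in> R" by (rule perm_closedD[OF Cons.prems(1)]) (use qw(3) in auto)
  qed
qed simp

lemma letter_keys_ad:
  assumes "\<And>w. w \<in> keys x \<Longrightarrow> c \<in> set w" "z \<in> keys (ad ys x)"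
  shows "c \<in> set z"
  using assms(2)
proof (induction ys arbitrary: z)
  case (Cons y ys)
  then have "z \<in> keys (commutator y (ad ys x))" by simp
  then obtain q w where "q \<in> keys (prim y)" "w \<in> keys (ad ys x)" "z = q @ w \<or> z = w @ q"
    by (rule keys_commutatorE)
  then show ?case using Cons.IH[of w] by auto
qed (use assms(1) in simp)

lemma letters_keys_ad:
  assumes "\<And>w. w \<in> keys x \<Longrightarrow> \<forall>a\<in>set w. deg a < d" "\<And>y. y \<in> set ys \<Longrightarrow> deg y < d" "z \<in> keys (ad ys x)"
  shows "\<forall>a\<in>set z. deg a < d"
  using assms(2,3)
proof (induction ys arbitrary: z)
  case (Cons y ys)
  then have "z \<in> keys (commutator y (ad ys x))" by simp
  then obtain q w where qw: "q \<in> keys (prim y)" "w \<in> keys (ad ys x)" "z = q @ w \<or> z = w @ q"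
    by (rule keys_commutatorE)
  have "deg a < d" if "a \<in> set q" for a
    using keys_prim[OF qw(1) _ that] that Cons.prems(1)[of y] by (cases "q = [y]") auto
  then show ?case using Cons.IH[OF _ qw(2)] Cons.prems(1) qw(3) by auto
qed (use assms(1) in simp)

text \<open>Reading off the powers of a single letter is an algebra homomorphism to a commutative
  polynomial ring, which kills commutators.\<close>

lemma lookup_commutator_pure:
  "lookup (x * y - y * x :: ('c, 'k) free_alg) (replicate n s) = 0"
proof -
  have "(\<Sum>i\<le>n. lookup y (replicate i s) * lookup x (replicate (n - i) s))
      = (\<Sum>i\<le>n. lookup x (replicate i s) * lookup y (replicate (n - i) s))"
    by (rule sum.reindex_bij_witness[of _ "\<lambda>i. n - i" "\<lambda>i. n - i"]) (auto simp: mult.commute)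
  moreover have "lookup (a * b) (replicate n s)
      = (\<Sum>i\<le>n. lookup a (replicate i s) * lookup b (replicate (n - i) s))" for a b :: "('c, 'k) free_alg"
    unfolding lookup_mult_word length_replicate by (rule sum.cong) (auto simp: min_absorb1)
  ultimately show ?thesis by (simp add: lookup_minus)
qed

lemma lookup_prim_Nil: "lookup (prim y) [] = 0"
  by (simp add: lookup_prim_length_1 lookup_basis)

text \<open>
  A key \<open>w\<close> violating the claim is chosen of minimal length and then with the longest initial run
  of \<open>y\<close>. No other term of the commutator can then contribute to the coefficient of \<open>y # w\<close>.
\<close>

lemma keys_of_commutator:
  assumes R: "perm_closed R" "expands y R" and x: "\<And>n. replicate n y \<notin> keys x"
    and sub: "keys (commutator y x) \<subseteq> R" and w: "w \<in> keys x"
  shows "w @ [y] \<in> R"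
proof (rule ccontr)
  assume "w @ [y] \<notin> R"
  define Bad where "Bad = {w \<in> keys x. w @ [y] \<notin> R}"
  define run where "run w = length (takeWhile (\<lambda>a. a = y) w)" for w
  let ?r = "measures [length, \<lambda>w. length w - run w]"
  have "w \<in> Bad" using w \<open>w @ [y] \<notin> R\<close> by (simp add: Bad_def)
  from wf_measures[unfolded wf_eq_minimal, rule_format, OF this]
  obtain w where bad: "w \<in> Bad" and "\<forall>w'. (w', w) \<in> ?r \<longrightarrow> w' \<notin> Bad" by (rule bexE)
  then have min: "(w', w) \<in> ?r \<Longrightarrow> w' \<notin> Bad" for w' by blast
  have wx: "w \<in> keys x" and wR: "w @ [y] \<notin> R" using bad by (auto simp: Bad_def)
  have zR: "y # w \<notin> R" using wR perm_closedD[OF R(1), of "y # w" "w @ [y]"] by auto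
  have short: "q @ w' \<in> R" if "q \<in> keys (prim y)" "w' \<in> keys x" "length w' < length w" for q w'
  proof -
    have "w' \<notin> Bad" using that(3) by (intro min) (simp add: measures_def)
    then have "w' @ [y] \<in> R" using that(2) by (simp add: Bad_def)
    then have "y # w' \<in> R" by (rule perm_closedD[OF R(1)]) simp
    then show ?thesis using R(2) that(1) by (simp add: expands_def)
  qed
  have "lookup (prim y * x) (y # w)
      = (\<Sum>i\<in>{1}. lookup (prim y) (take i (y # w)) * lookup x (drop i (y # w)))"
    unfolding lookup_mult_word
  proof (rule sum.mono_neutral_right)
    show "\<forall>i\<in>{..length (y # w)} - {1}. lookup (prim y) (take i (y # w)) * lookup x (drop i (y # w)) = 0"
    proof
      fix i assume "i \<in> {..length (y # w)} - {1}"
      then consider "i = 0" | "i \<ge> 2" "i \<le> length (y # w)" by force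
      then show "lookup (prim y) (take i (y # w)) * lookup x (drop i (y # w)) = 0"
      proof cases
        case 2
        have "length (drop i (y # w)) < length w" unfolding length_drop list.size using 2 by simp
        then have "\<not> (take i (y # w) \<in> keys (prim y) \<and> drop i (y # w) \<in> keys x)"
          using short[of "take i (y # w)" "drop i (y # w)"] zR by (auto simp only: append_take_drop_id)
        then show ?thesis by (auto simp: in_keys_iff)
      qed (simp add: lookup_prim_Nil)
    qed
  qed simp_all
  then have 1: "lookup (prim y * x) (y # w) = lookup x w"
    by (simp add: lookup_prim_length_1)
  have "lookup (x * prim y) (y # w) = 0"
    unfolding lookup_mult_word
  proof (rule sum.neutral, rule ballI, rule ccontr)
    fix i assume i: "i \<in> {..length (y # w)}"
      and "lookup x (take i (y # w)) * lookup (prim y) (drop i (y # w)) \<noteq> 0"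
    define w' q where "w' = take i (y # w)" and "q = drop i (y # w)"
    have w': "w' \<in> keys x" and q: "q \<in> keys (prim y)"
      using \<open>_ \<noteq> 0\<close> by (auto simp: w'_def q_def in_keys_iff)
    have eq: "y # w = w' @ q" by (simp add: w'_def q_def)
    have "q \<noteq> []" using q lookup_prim_Nil by (auto simp: in_keys_iff)
    show False
    proof (cases "length w' < length w")
      case True
      have "q @ w' \<in> R" by (rule short[OF q w' True])
      then have "w' @ q \<in> R" by (rule perm_closedD[OF R(1)]) simp
      then show False using eq zR by simp
    next
      case False
      moreover have "length w' + length q = Suc (length w)" using arg_cong[OF eq, of length] by simp
      moreover have "length q > 0" using \<open>q \<noteq> []\<close> by simp
      ultimately have "length q = 1" "length w' = length w" by linarith+
      then have "q = [y]"
        using q lookup_prim_length_1[of q y] by (simp add: in_keys_iff lookup_basis split: if_splits)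
      have "w \<noteq> []" using x[of 0] wx by auto
      then obtain w'' where w'': "w' = y # w''" "w = w'' @ [y]"
        using eq \<open>q = [y]\<close> by (cases w') auto
      \<comment> \<open>Powers of \<open>y\<close> being excluded, some letter of \<open>w''\<close>
        differs from \<open>y\<close>. So moving the last \<open>y\<close> of \<open>w\<close> to
        the front produces a word \<open>w'\<close> with a longer initial run.\<close>
      have "\<exists>a\<in>set w''. a \<noteq> y"
      proof (rule ccontr)
        assume "\<not> ?thesis"
        then have "w'' = replicate (length w'') y" by (intro replicate_eqI) auto
        then have "w = replicate (Suc (length w'')) y" unfolding snoc_eq_replicate_Suc w''(2) by simp
        then show False using x wx by metis
      qed
      then have "run w = run w''" by (auto simp: run_def w''(2) takeWhile_append1)
      moreover have "run w'' \<le> length w''" by (simp add: run_def length_takeWhile_le)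
      ultimately have "(w', w) \<in> ?r" by (simp add: measures_def w'' run_def)
      then have "w' @ [y] \<in> R" using min[of w'] w' by (auto simp: Bad_def)
      then have "w @ [y] \<in> R" by (rule perm_closedD[OF R(1)]) (simp add: w'')
      then show False using wR by simp
    qed
  qed
  with 1 have "lookup (commutator y x) (y # w) = lookup x w"
    by (simp add: commutator_def lookup_minus)
  then have "y # w \<in> keys (commutator y x)" using wx by (simp add: in_keys_iff)
  then show False using sub zR by auto
qed

text \<open>The commutators are undone from the outermost inwards. The hypothesis on powers serves
  the innermost one; each other is applied to a commutator, which contains no powers of one
  letter.\<close>

lemma keys_of_ad:
  assumes "perm_closed R" "\<And>y. y \<in> set (ys @ [y0]) \<Longrightarrow> expands y R" "\<And>n. replicate n y0 \<notin> keys x"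
    and "keys (ad (ys @ [y0]) x) \<subseteq> R"
  shows "keys x \<subseteq> residual R (ys @ [y0])"
  using assms
proof (induction ys arbitrary: R)
  case Nil
  then show ?case using keys_of_commutator[of R y0 x] by auto
next
  case (Cons y ys)
  let ?x = "ad (ys @ [y0]) x"
  have "\<exists>a b. ?x = a * b - b * a" by (cases ys) (auto simp: commutator_def)
  then have "replicate n y \<notin> keys ?x" for n by (auto simp: in_keys_iff lookup_commutator_pure)
  then have "keys ?x \<subseteq> residual R [y]"
    using keys_of_commutator[of R y ?x] Cons.prems by auto
  then have "keys x \<subseteq> residual (residual R [y]) (ys @ [y0])"
    using Cons.prems by (intro Cons.IH) (auto intro: perm_closed_residual expands_residual)
  then show ?case using perm_closedD[OF Cons.prems(1)] by fastforce
qed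

lemma expand_pure:
  assumes R: "perm_closed R" "expands y R" and "replicate r y \<in> residual R ys"
  shows "keys (scale_pm a (pword (replicate r y))) \<subseteq> residual R ys"
  using expands_pword[of "replicate r y" "residual R ys" "[]"] assms
  by (auto simp: keys_scale_pm perm_closed_residual expands_residual split: if_splits)

text \<open>A commutator with \<open>prim y\<close> loses what commutes with it. \<open>p y\<close>
  is the multiple of a power of \<open>prim y\<close> that matches the power of \<open>y\<close> in
  \<open>x\<close>; so \<open>x - p y\<close> has the same iterated commutators with
  \<open>y\<close> innermost, contains no power of \<open>y\<close>, and is covered by
  \<open>keys_of_ad\<close>. It remains to place the power of \<open>y\<close> itself: if all
  letters of \<open>ys\<close> agree this is \<open>pure\<close>, otherwise a second letter of
  \<open>ys\<close> does it.\<close>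

lemma keys_of_all_ad:
  assumes R: "perm_closed R" "\<And>y. y \<in> set ys \<Longrightarrow> expands y R" and x: "x \<in> homog deg d" "d > 0"
    and ad: "\<And>ys'. mset ys' = mset ys \<Longrightarrow> keys (ad ys' x) \<subseteq> R"
    and pure: "\<And>s r. ys = replicate (length ys) s \<Longrightarrow> ys \<noteq> [] \<Longrightarrow> replicate r s \<in> keys x
      \<Longrightarrow> replicate r s @ ys \<in> R"
  shows "keys x \<subseteq> residual R ys"
proof (cases "ys = []")
  case True
  then show ?thesis using ad[of "[]"] by simp
next
  case False
  \<comment> \<open>By homogeneity this is the only exponent with which a power of \<open>y\<close>
    can occur in \<open>x\<close>.\<close>
  define r where "r y = d div deg y" for y
  define p where "p y = scale_pm (lookup x (replicate (r y) y)) (pword (replicate (r y) y))" for y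
  have wdeg_rep: "wdeg deg (replicate n y) = n * deg y" for n y by (simp add: wdeg_def sum_list_replicate)
  have r: "n = r y" if "replicate n y \<in> keys x" for n y
  proof -
    have "n * deg y = d" using that x(1) wdeg_rep[of n y] by (auto simp: homog_def words_def)
    then show ?thesis using deg_pos[of y] by (auto simp: r_def)
  qed
  have peeled: "keys (x - p y) \<subseteq> residual R ys" if "y \<in> set ys" for y
  proof -
    obtain s t where st: "ys = s @ y # t" using \<open>y \<in> set ys\<close> by (auto simp: in_set_conv_decomp)
    define ys0 where "ys0 = s @ t"
    have ys0: "mset (ys0 @ [y]) = mset ys" by (simp add: ys0_def st)
    have "commutator y (pword (replicate (r y) y)) = 0"
    proof -
      have "pword (replicate n y) = prim y ^ n" for n by (induction n) (simp_all add: pword_Cons)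
      then show ?thesis by (simp add: commutator_def power_commutes)
    qed
    then have "ad (ys0 @ [y]) (p y) = 0"
      by (simp add: ad_append p_def lin_scale[OF lin_commutator] lin_zero[OF lin_ad])
    then have "ad (ys0 @ [y]) (x - p y) = ad (ys0 @ [y]) x" by (simp add: lin_diff[OF lin_ad])
    then have 1: "keys (ad (ys0 @ [y]) (x - p y)) \<subseteq> R" using ad[OF ys0] by simp
    have 2: "replicate n y \<notin> keys (x - p y)" for n
    proof (cases "n = r y")
      case True
      then show ?thesis
        by (simp add: in_keys_iff lookup_minus p_def lookup_pword_short)
    next
      case False
      then have "lookup x (replicate n y) = 0" using r[of n y] by (auto simp: in_keys_iff)
      moreover have "lookup (pword (replicate (r y) y)) (replicate n y) = 0"
      proof (rule lookup_eq_0, rule notI)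
        assume "replicate n y \<in> keys (pword (replicate (r y) y))"
        from wdeg_pword[OF this] have "n * deg y = r y * deg y" by (simp add: wdeg_rep)
        then show False using deg_pos[of y] False by simp
      qed
      ultimately show ?thesis by (simp add: in_keys_iff lookup_minus p_def)
    qed
    have "set (ys0 @ [y]) = set ys" using ys0 by (metis set_mset_mset)
    then have "keys (x - p y) \<subseteq> residual R (ys0 @ [y])"
      using R 1 2 by (intro keys_of_ad) auto
    moreover have "w @ ys \<in> R" if "w @ ys0 @ [y] \<in> R" for w
      using that by (rule perm_closedD[OF R(1)]) (use ys0 in simp)
    ultimately show ?thesis by auto
  qed
  have done_if: ?thesis if "y \<in> set ys" "lookup x (replicate (r y) y) \<noteq> 0 \<Longrightarrow> replicate (r y) y @ ys \<in> R" for y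
  proof -
    have "keys (p y) \<subseteq> residual R ys"
    proof (cases "lookup x (replicate (r y) y) = 0")
      case True
      then show ?thesis by (simp add: p_def)
    next
      case False
      then show ?thesis
        unfolding p_def using that R by (intro expand_pure) auto
    qed
    moreover have "keys x \<subseteq> keys (x - p y) \<union> keys (p y)"
      using keys_add[of "x - p y" "p y"] by simp
    ultimately show ?thesis using peeled[OF that(1)] by blast
  qed
  show ?thesis
  proof (cases "\<exists>s. ys = replicate (length ys) s")
    case True
    then obtain s where s: "ys = replicate (length ys) s" ..
    have "s \<in> set ys" using False by (subst s) simp
    then show ?thesis
      by (rule done_if) (use pure[OF s False] in \<open>simp add: in_keys_iff\<close>)
  next
    case not_pure: False
    \<comment> \<open>With \<open>y\<close> of maximal degree in \<open>ys\<close>, no word of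
      \<open>p y1\<close> is a positive power of \<open>y\<close>, since its letters are
      \<open>y1\<close> or have smaller degree than \<open>y1\<close>. So the power of
      \<open>y\<close> survives in \<open>x - p y1\<close>.\<close>
    define D where "D = Max (deg ` set ys)"
    have "D \<in> deg ` set ys" unfolding D_def using False by (intro Max_in) auto
    then obtain y where y: "y \<in> set ys" "deg y = D" by auto
    have "\<exists>y1\<in>set ys. y1 \<noteq> y"
    proof (rule ccontr)
      assume "\<not> ?thesis"
      then have "ys = replicate (length ys) y" by (intro replicate_eqI) auto
      then show False using not_pure by blast
    qed
    then obtain y1 where y1: "y1 \<in> set ys" "y1 \<noteq> y" by blast
    then have le: "deg y1 \<le> deg y" unfolding y(2) D_def by (intro Max_ge) auto
    show ?thesis
    proof (rule done_if[OF y(1)])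
      assume nz: "lookup x (replicate (r y) y) \<noteq> 0"
      have "r y \<noteq> 0"
      proof
        assume "r y = 0"
        then have "[] \<in> keys x" using nz by (simp add: in_keys_iff)
        then show False using x by (auto simp: homog_def words_def)
      qed
      have "replicate (r y) y \<notin> keys (pword (replicate (r y1) y1))"
      proof
        assume mem: "replicate (r y) y \<in> keys (pword (replicate (r y1) y1))"
        have letters: "\<forall>a\<in>set q. a = y1 \<or> deg a < deg y1" if "q \<in> keys (pword (replicate n y1))" for q n
          using that
        proof (induction n arbitrary: q)
          case 0
          then show ?case by (simp add: zero_list_def)
        next
          case (Suc n)
          then obtain q1 q2 where "q = q1 @ q2" "q1 \<in> keys (prim y1)" "q2 \<in> keys (pword (replicate n y1))"
            by (auto simp: pword_Cons elim: keys_mult_wordE)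
          then show ?case using Suc.IH[of q2] keys_prim[of q1 y1] by fastforce
        qed
        have "y \<in> set (replicate (r y) y)" using \<open>r y \<noteq> 0\<close> by simp
        then show False using letters[OF mem] y1(2) le by auto
      qed
      then have "replicate (r y) y \<in> keys (x - p y1)"
        using nz by (simp add: in_keys_iff lookup_minus p_def)
      then show "replicate (r y) y @ ys \<in> R" using peeled[OF y1(1)] by auto
    qed
  qed
qed

text \<open>By \<open>lookup_hp2_peel\<close> a run of \<open>e\<close> at the end leaves the
  coefficients of words other than \<open>z\<close> unchanged. The degree bound, preserved by
  \<open>letters_hp2\<close>, ensures that no remaining letter can produce \<open>e\<close>.\<close>

lemma hp2_closed_peel:
  assumes "hp2_closed R"
  shows "hp2_closed {z. (\<forall>a\<in>set z. a \<noteq> e \<and> deg a \<le> deg e) \<and> z @ replicate t e \<in> R}"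
    (is "hp2_closed ?U")
  unfolding hp2_closed_def
proof (intro ballI subsetI)
  fix z z' assume z: "z \<in> ?U" and z': "z' \<in> keys (hp2 (basis z))"
  have letters: "\<forall>a\<in>set z'. a \<noteq> e \<and> deg a \<le> deg e"
  proof
    fix a assume "a \<in> set z'"
    from letters_hp2[OF z' this] obtain y where "y \<in> set z" "a = y \<or> deg a < deg y" by blast
    then show "a \<noteq> e \<and> deg a \<le> deg e" using z by fastforce
  qed
  show "z' \<in> ?U"
  proof (cases "z' = z")
    case False
    have "e \<notin> set z'" using letters by blast
    from lookup_hp2_peel[OF this, of "basis z" t]
    have "lookup (hp2 (basis (z @ replicate t e))) (z' @ replicate t e) = lookup (hp2 (basis z)) z'"
      using False by (simp add: lookup_basis basis_append)
    then have "z' @ replicate t e \<in> keys (hp2 (basis (z @ replicate t e)))"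
      using z' by (simp add: in_keys_iff)
    then show ?thesis using assms z letters by (auto simp: hp2_closed_def)
  qed (use z in simp)
qed

section \<open>The induction on the degree of the expanded letter\<close>

lemma hp2_cpow_id: "hp2 (\<Psi> n x) = \<Psi> (n + n) x"
  unfolding hp2_def coprod_cpow_id cpow_add[OF lin_id] conv_def
  by (subst lin_ext_comp[OF lin_tensor_mult[OF lin_id]], rule lin_ext_cong) auto

lemma lookup_cpow_id_letter:
  assumes "length z \<le> 1"
  shows "lookup (\<Psi> n (basis [c])) z = of_nat n * lookup (basis [c]) z"
proof -
  have "of_nat (n choose k) * lookup (cpow aug_proj k (basis [c])) z
      = (if k = 1 then of_nat n * lookup (basis [c]) z else 0)" for k
    by (simp add: lookup_cpow_aug_proj_letter[OF assms])
  then have "lookup (\<Psi> n (basis [c])) z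
      = (\<Sum>k\<le>n. if k = 1 then of_nat n * lookup (basis [c]) z else 0)"
    by (simp only: cpow_id_binomial lookup_sum lookup_scale_pm)
  then show ?thesis by (cases n) (simp_all add: sum.delta)
qed

text \<open>\<open>hp2\<close> commutes with iterated commutators, and those of \<open>x\<close>
  stay in \<open>U\<close> by \<open>keys_ad\<close>; \<open>keys_of_all_ad\<close> carries this
  back to \<open>hp2 x\<close>. Powers of one letter are read off from
  \<open>lookup_hp2_pure\<close>.\<close>

lemma keys_hp2_residual:
  assumes U: "hp2_closed U" "\<And>y. y \<in> set ys \<Longrightarrow> expands y U"
    and x: "x \<in> homog deg d" "d > 0" "keys x \<subseteq> residual U ys"
  shows "keys (hp2 x) \<subseteq> residual U ys"
proof (rule keys_of_all_ad[OF _ U(2) _ x(2)])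
  note perm = hp2_closed_imp_perm_closed[OF U(1)]
  show "perm_closed U" by (rule perm)
  show "hp2 x \<in> homog deg d"
    using wdeg_hp2[OF _ x(1)] by (auto simp: homog_def words_def)
  fix ys' assume ys': "mset ys' = mset ys"
  have "keys x \<subseteq> residual U ys'"
    using x(3) perm_closedD[OF perm] ys' by fastforce
  moreover have "set ys' = set ys" using ys' by (metis set_mset_mset)
  ultimately have "keys (ad ys' x) \<subseteq> U" using U(2) by (intro keys_ad[OF perm]) auto
  then show "keys (ad ys' (hp2 x)) \<subseteq> U"
    using hp2_closed_keys[OF U(1)] by (simp add: hp2_ad[symmetric])
next
  fix s r assume s: "ys = replicate (length ys) s" and r: "replicate r s \<in> keys (hp2 x)"
  let ?m = "length ys"
  have "keys (x * basis ys) \<subseteq> U"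
    using x(3) by (auto elim!: keys_mult_wordE)
  then have "keys (hp2 (x * basis ys)) \<subseteq> U" by (rule hp2_closed_keys[OF U(1)])
  moreover have "replicate (r + ?m) s \<in> keys (hp2 (x * basis ys))"
    using r by (subst s) (simp add: in_keys_iff lookup_hp2_pure)
  ultimately have "replicate (r + ?m) s \<in> U" by blast
  then show "replicate r s @ ys \<in> U" by (subst s) (simp add: replicate_add)
qed

text \<open>If \<open>q\<close> were unreachable, its coefficient would be 0 in
  \<open>\<Psi> (2 ^ k) (basis [c])\<close> for every \<open>k\<close>, because all words of these
  elements other than \<open>c\<close> are reachable. A polynomial vanishing at all powers of two is
  zero, and with it the linear coefficient, which is that of \<open>q\<close> in
  \<open>prim c\<close>.\<close>

lemma expands_without_high_letters:
  assumes R: "hp2_closed R" and IH: "\<And>y R. deg y < deg c \<Longrightarrow> hp2_closed R \<Longrightarrow> expands y R"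
    and v: "\<And>e. e \<in> set v \<Longrightarrow> e = c \<or> deg e < deg c" "c # v \<in> R"
    and q: "q \<in> keys (prim c)"
  shows "q @ v \<in> R"
proof (rule ccontr)
  assume notin: "q @ v \<notin> R"
  note perm = hp2_closed_imp_perm_closed[OF R]
  \<comment> \<open>The copies of \<open>c\<close> in \<open>v\<close> are collected at the end;
    \<open>ys\<close> keeps the remaining letters, whose degrees are smaller, so the induction
    hypothesis applies to them.\<close>
  define t where "t = count_list v c"
  define ys where "ys = filter (\<lambda>a. a \<noteq> c) v"
  define U where "U = {z. (\<forall>a\<in>set z. a \<noteq> c \<and> deg a \<le> deg c) \<and> z @ replicate t c \<in> R}"
  let ?R = "residual R (replicate t c)"
  have U: "hp2_closed U" unfolding U_def by (rule hp2_closed_peel[OF R])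
  note permU = hp2_closed_imp_perm_closed[OF U]
  have permR: "perm_closed ?R" by (rule perm_closed_residual[OF perm])
  have v_split: "mset (ys @ replicate t c) = mset v"
    unfolding ys_def t_def by (rule mset_split_letter)
  have low: "deg y < deg c" if "y \<in> set ys" for y using that v(1) by (auto simp: ys_def)
  have exp_U: "expands y U" and exp_R: "expands y ?R" if "y \<in> set ys" for y
    using IH[OF low[OF that] U] IH[OF low[OF that] R] by (auto intro: expands_residual)
  have U_I: "z \<in> U" if "\<forall>a\<in>set z. deg a < deg c" "z @ replicate t c \<in> R" for z
    using that by (auto simp: U_def)
  have c_ys: "[c] @ ys @ replicate t c \<in> R"
    by (rule perm_closedD[OF perm v(2)]) (use v_split in simp)
  define X where "X k = \<Psi> (2 ^ k) (basis [c])" for k :: nat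
  \<comment> \<open>The subtracted multiple of \<open>c\<close> is the only part of
    \<open>X k\<close> with a letter that is not of smaller degree than \<open>c\<close>.\<close>
  define x where "x k = X k - scale_pm (2 ^ k) (basis [c])" for k
  have X_Suc: "X (Suc k) = hp2 (X k)" for k
    by (simp add: X_def hp2_cpow_id mult_2)
  have X_0: "X 0 = basis [c]" by (simp add: X_def conv_unit_right lin_id)
  have hp2_c: "hp2 (basis [c]) = x 1 + scale_pm 2 (basis [c])"
    using X_Suc[of 0] by (simp add: x_def X_0)
  have x_Suc: "x (Suc k) = hp2 (x k) + scale_pm (2 ^ k) (x 1)" for k
  proof -
    have "hp2 (x k) = X (Suc k) - scale_pm (2 ^ k) (x 1 + scale_pm 2 (basis [c]))"
      by (simp add: x_def[of k] lin_diff[OF lin_hp2'] lin_scale[OF lin_hp2'] X_Suc hp2_c)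
    then show ?thesis
      by (simp add: x_def[of "Suc k"] pmv.scale_right_distrib mult.commute)
  qed
  have x_homog: "x k \<in> homog deg (deg c)" for k
  proof -
    have "X k \<in> homog deg (deg c)"
      by (auto simp: X_def homog_def words_def dest!: wdeg_cpow_id)
    then show ?thesis
      using keys_minus_subset[of "X k" "scale_pm (2 ^ k) (basis [c])"]
      by (fastforce simp: x_def homog_def words_def keys_scale_pm split: if_splits)
  qed
  have x_low: "\<forall>a\<in>set z. deg a < deg c" if z: "z \<in> keys (x k)" for z k
  proof
    fix a assume a: "a \<in> set z"
    have "length z > 1"
    proof (rule ccontr)
      assume "\<not> length z > 1"
      then have "lookup (x k) z = 0"
        by (simp add: x_def X_def lookup_minus lookup_cpow_id_letter)
      then show False using z by (simp add: in_keys_iff)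
    qed
    moreover have "wdeg deg z = deg c" using z x_homog[of k] by (auto simp: homog_def words_def)
    ultimately show "deg a < deg c" using letters_of_wdeg[OF _ a, of "deg c"] by auto
  qed
  have "keys (x 1) \<subseteq> residual U ys"
  proof (rule keys_of_all_ad[OF permU exp_U x_homog deg_pos])
    fix ys' assume ys': "mset ys' = mset ys"
    then have set_ys': "set ys' = set ys" by (metis set_mset_mset)
    let ?A = "ad ys' (basis [c])"
    have "keys ?A \<subseteq> ?R"
    proof (rule keys_ad[OF permR])
      have "[c] @ ys' @ replicate t c \<in> R"
        by (rule perm_closedD[OF perm c_ys]) (use ys' in simp)
      then show "keys (basis [c] :: ('c, 'k) free_alg) \<subseteq> residual ?R ys'" by simp
    qed (use exp_R set_ys' in simp)
    then have "keys (?A * basis (replicate t c)) \<subseteq> R" by (auto elim!: keys_mult_wordE)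
    then have sub: "keys (hp2 (?A * basis (replicate t c))) \<subseteq> R" by (rule hp2_closed_keys[OF R])
    show "keys (ad ys' (x 1)) \<subseteq> U"
    proof
      fix z assume z: "z \<in> keys (ad ys' (x 1))"
      have z_low: "\<forall>a\<in>set z. deg a < deg c"
        by (rule letters_keys_ad[OF x_low _ z]) (use low set_ys' in auto)
      then have "c \<notin> set z" by auto
      \<comment> \<open>Every word of \<open>?A\<close> contains \<open>c\<close> and
        \<open>z\<close> does not, so the second summand cannot cancel \<open>z\<close> in the
        first.\<close>
      moreover have "hp2 ?A = ad ys' (x 1) + scale_pm 2 ?A"
        by (simp add: hp2_ad hp2_c lin_add[OF lin_ad] lin_scale[OF lin_ad])
      moreover have "lookup ?A z = 0"
        using letter_keys_ad[of "basis [c]" c z ys'] \<open>c \<notin> set z\<close> by (intro lookup_eq_0) auto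
      ultimately have "lookup (hp2 (?A * basis (replicate t c))) (z @ replicate t c) = lookup (ad ys' (x 1)) z"
        by (simp add: lookup_hp2_peel lookup_add)
      then have "z @ replicate t c \<in> R" using sub z by (auto simp: in_keys_iff)
      then show "z \<in> U" using z_low by (intro U_I)
    qed
  next
    fix s r assume s: "ys = replicate (length ys) s" "ys \<noteq> []" and r: "replicate r s \<in> keys (x 1)"
    let ?m = "length ys"
    have "s \<in> set ys" using s by (metis in_set_replicate length_0_conv)
    then have "deg s < deg c" by (rule low)
    then have "s \<noteq> c" by auto
    \<comment> \<open>Commutators are blind to powers of one letter, so the coefficient is computed
      directly: \<open>ys\<close> multiplies it by \<open>2 ^ ?m\<close>, and the final run of
      \<open>c\<close> leaves it unchanged.\<close>
    have "keys (hp2 (basis [c] * basis ys * basis (replicate t c))) \<subseteq> R"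
      using c_ys R by (simp add: hp2_closed_def flip: basis_append)
    moreover have "lookup (hp2 (basis [c] * basis ys * basis (replicate t c))) (replicate (r + ?m) s @ replicate t c) \<noteq> 0"
    proof -
      have "c \<notin> set (replicate (r + ?m) s)" using \<open>s \<noteq> c\<close> by simp
      moreover have "lookup (basis [c] * basis ys) (replicate (r + ?m) s) = (0 :: 'k)"
      proof -
        have "c \<in> set ([c] @ ys)" by simp
        then have "[c] @ ys \<noteq> replicate (r + ?m) s"
          using \<open>c \<notin> set (replicate (r + ?m) s)\<close> by metis
        then show ?thesis unfolding basis_append[symmetric] lookup_basis by simp
      qed
      moreover have "lookup (hp2 (basis [c] * basis ys)) (replicate (r + ?m) s) = 2 ^ ?m * lookup (hp2 (basis [c])) (replicate r s)"
        by (subst s(1)) (simp add: lookup_hp2_pure)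
      moreover have "lookup (hp2 (basis [c])) (replicate r s) = lookup (x 1) (replicate r s)"
        using \<open>s \<noteq> c\<close> by (cases r) (auto simp: hp2_c lookup_add lookup_basis)
      ultimately show ?thesis using r by (simp add: lookup_hp2_peel in_keys_iff)
    qed
    ultimately have "replicate (r + ?m) s @ replicate t c \<in> R" by (auto simp: in_keys_iff)
    then have "replicate (r + ?m) s \<in> U" using \<open>deg s < deg c\<close> by (intro U_I) auto
    then show "replicate r s @ ys \<in> U" by (subst s(1)) (simp add: replicate_add)
  qed
  note x_1 = this
  have x_k: "keys (x k) \<subseteq> residual U ys" for k
  proof (induction k)
    case 0
    then show ?case by (simp add: x_def X_0)
  next
    case (Suc k)
    have "keys (hp2 (x k)) \<subseteq> residual U ys"
      by (rule keys_hp2_residual[OF U exp_U x_homog deg_pos Suc])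
    moreover have "keys (scale_pm (2 ^ k) (x 1)) \<subseteq> residual U ys" using x_1 by (simp add: keys_scale_pm)
    moreover have "keys (x (Suc k)) \<subseteq> keys (hp2 (x k)) \<union> keys (scale_pm (2 ^ k) (x 1))"
      unfolding x_Suc[of k] by (rule keys_add)
    ultimately show ?case by blast
  qed
  show False
  proof (cases "q = [c]")
    case True
    then show False using notin v(2) by simp
  next
    case False
    have "q \<notin> residual U ys"
    proof
      assume "q \<in> residual U ys"
      then have "q @ ys @ replicate t c \<in> R" by (simp add: U_def)
      then have "q @ v \<in> R" by (rule perm_closedD[OF perm]) (use v_split in simp)
      with notin show False by simp
    qed
    then have "lookup (x k) q = 0" for k using x_k[of k] by (auto simp: in_keys_iff)
    then have zero: "lookup (X k) q = 0" for k using False by (simp add: x_def lookup_minus lookup_basis)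
    have "hopf_power_poly [c] q = 0"
    proof (rule poly_eq_of_nat[of "range (\<lambda>k. 2 ^ k)"])
      show "infinite (range (\<lambda>k. 2 ^ k :: nat))"
        by (rule range_inj_infinite) (simp add: inj_on_def)
      fix n :: nat assume "n \<in> range (\<lambda>k. 2 ^ k)"
      then show "poly (hopf_power_poly [c] q) (of_nat n) = poly 0 (of_nat n)"
        using zero by (auto simp: poly_hopf_power_poly X_def simp del: of_nat_power)
    qed
    then have "lookup (prim c) q = 0" using coeff_hopf_power_poly_1[of "[c]" q] by simp
    then show False using q by (simp add: in_keys_iff)
  qed
qed

text \<open>\<open>e\<close> is taken of maximal degree among the letters of \<open>v\<close> other
  than \<open>c\<close>, since \<open>hp2_closed_peel\<close> wants the remaining letters bounded by
  the degree of \<open>e\<close>. Peeling replaces the closed set by another one, so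
  \<open>R\<close> is arbitrary in both inductions.\<close>

lemma expands_of_hp2_closed: "hp2_closed R \<Longrightarrow> expands c R"
proof (induction "deg c" arbitrary: c R rule: less_induct)
  case less
  have "q @ v \<in> R" if "hp2_closed R" "c # v \<in> R" "q \<in> keys (prim c)" for q v R
    using that
  proof (induction v arbitrary: R rule: measure_induct_rule[of length])
    case (less v)
    show ?case
    proof (cases "\<exists>e\<in>set v. e \<noteq> c \<and> deg c \<le> deg e")
      case False
      then show ?thesis
        using less.prems by (intro expands_without_high_letters[OF less.prems(1) less.hyps]) auto
    next
      case True
      let ?E = "{e \<in> set v. e \<noteq> c}"
      define D where "D = Max (deg ` ?E)"
      have "D \<in> deg ` ?E" unfolding D_def using True by (intro Max_in) auto
      then obtain e where e: "e \<in> set v" "e \<noteq> c" "deg e = D" by auto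
      have max: "deg a \<le> deg e" if "a \<in> ?E" for a unfolding e(3) D_def using that by (intro Max_ge) auto
      then have "deg c \<le> deg e" using True by force
      define v' where "v' = filter (\<lambda>a. a \<noteq> e) v"
      define t where "t = count_list v e"
      let ?U = "{z. (\<forall>a\<in>set z. a \<noteq> e \<and> deg a \<le> deg e) \<and> z @ replicate t e \<in> R}"
      note perm = hp2_closed_imp_perm_closed[OF less.prems(1)]
      have split: "mset (v' @ replicate t e) = mset v"
        unfolding v'_def t_def by (rule mset_split_letter)
      have "length v' < length v" unfolding v'_def using e(1) by (intro length_filter_less[of e]) auto
      moreover have "c # v' \<in> ?U"
      proof -
        have "(c # v') @ replicate t e \<in> R"
          by (rule perm_closedD[OF perm less.prems(2)]) (use split in simp)
        then show ?thesis using max e(2) \<open>deg c \<le> deg e\<close> by (fastforce simp: v'_def)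
      qed
      ultimately have "q @ v' \<in> ?U"
        using hp2_closed_peel[OF less.prems(1)] less.prems(3) by (intro less.IH) auto
      then have "q @ v' @ replicate t e \<in> R" by simp
      then show ?thesis by (rule perm_closedD[OF perm]) (use split in simp)
    qed
  qed
  then show ?case using less.prems by (auto simp: expands_def)
qed

text \<open>The words reachable in any number of steps form a set closed under \<open>hp2\<close>,
  as one application of \<open>hp2\<close> is a step with exponent 2.\<close>

lemma leads_to_tranclp_gvec:
  assumes "z \<in> keys (gvec \<Delta> b)"
  shows "(leads_to \<Delta>)\<^sup>+\<^sup>+ b z"
proof -
  define R where "R = {w. (leads_to \<Delta>)\<^sup>*\<^sup>* b w}"
  have R: "hp2_closed R"
    unfolding hp2_closed_def
  proof (intro ballI subsetI)
    fix w z assume "w \<in> R" "z \<in> keys (hp2 (basis w))"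
    then have "leads_to \<Delta> w z"
      unfolding leads_to_def by (intro exI[of _ 2]) (simp add: hopf_power_2 hp2_def in_keys_iff)
    with \<open>w \<in> R\<close> show "z \<in> R" by (simp add: R_def rtranclp.rtrancl_into_rtrancl)
  qed
  obtain u where u: "mset u = mset b" "z \<in> keys (pword u)" using assms by (rule keys_gvec)
  have "u @ [] \<in> R"
    by (rule perm_closedD[OF hp2_closed_imp_perm_closed[OF R], of b]) (use u in \<open>simp_all add: R_def\<close>)
  then have "z @ [] \<in> R"
    by (rule expands_pword[rotated 2]) (use u R in \<open>simp_all add: expands_of_hp2_closed hp2_closed_imp_perm_closed\<close>)
  \<comment> \<open>The step with exponent 1 makes the chain nonempty also when
    \<open>z = b\<close>.\<close>
  moreover have "leads_to \<Delta> b b"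
    unfolding leads_to_def
    by (intro exI[of _ 1]) (simp add: hopf_power_eq_cpow conv_unit_right lin_id)
  ultimately show ?thesis by (simp add: R_def rtranclp_into_tranclp2)
qed

end

text \<open>Reachability is expressed by the transitive closure in general and by a single step
  under \<open>nonneg_coprod\<close>, because otherwise coefficients in single Hopf powers can
  cancel. The multiplicity is read as the dimension of an eigenspace for \<open>a \<ge> 2\<close>,
  and as a number of basis vectors for every \<open>a\<close>, since all eigenvalues coincide at
  \<open>a = 1\<close>.\<close>

theorem theorem3p15:
  fixes deg :: "'c::linorder \<Rightarrow> nat"
    and \<Delta> :: "('c, 'k::field_char_0) free_alg \<Rightarrow> ('c list \<times> 'c list \<Rightarrow>\<^sub>0 'k)"
    and \<epsilon> :: "('c, 'k) free_alg \<Rightarrow> 'k"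
    and S :: "('c, 'k) free_alg \<Rightarrow> ('c, 'k) free_alg"
    and a :: nat
  assumes hopf: "cocomm_graded_free_hopf_algebra deg \<Delta> \<epsilon> S"
    and order: "\<And>c c'. deg c < deg c' \<Longrightarrow> c < c'"
    and a: "a \<ge> 1"
  shows
    "(\<forall>b. eigenvector (hopf_power \<Delta> a) (of_nat a ^ length (lyndon_factors b)) (gvec \<Delta> b)) \<and>
     (\<forall>b. gvec \<Delta> b = (\<Sum>b' | b' \<in> Poly_Mapping.keys (gvec \<Delta> b) \<and> (leads_to \<Delta>)\<^sup>+\<^sup>+ b b'.
            scale_pm (Poly_Mapping.lookup (gvec \<Delta> b) b') (basis b'))) \<and>
     (nonneg_coprod \<Delta> \<longrightarrow>
       (\<forall>b. gvec \<Delta> b = (\<Sum>b' | b' \<in> Poly_Mapping.keys (gvec \<Delta> b) \<and> leads_to \<Delta> b b'.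
            scale_pm (Poly_Mapping.lookup (gvec \<Delta> b) b') (basis b')))) \<and>
     (\<forall>b. gvec \<Delta> b = sym_word b +
           (\<Sum>b' | b' \<in> Poly_Mapping.keys (gvec \<Delta> b) \<and> length b' > length b.
            scale_pm (Poly_Mapping.lookup (gvec \<Delta> b) b') (basis b'))) \<and>
     (\<forall>n. inj_on (gvec \<Delta>) (words deg n) \<and> pmv.independent (gvec \<Delta> ` words deg n) \<and>
          pmv.span (gvec \<Delta> ` words deg n) = homog deg n) \<and>
     (\<forall>n k. fps_nth (fps_nth (lyndon_series deg) n) k =
          of_nat (card {b \<in> words deg n. length (lyndon_factors b) = k})) \<and>
     (a \<ge> 2 \<longrightarrow> (\<forall>n k. fps_nth (fps_nth (lyndon_series deg) n) k =
          of_nat (pmv.dim {x \<in> homog deg n. hopf_power \<Delta> a x = scale_pm (of_nat a ^ k) x})))"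
proof -
  interpret lyndon_hopf deg \<Delta> \<epsilon> S
    by (intro lyndon_hopf.intro hopf_char0.intro hopf)
  note series = nth_lyndon_series[OF deg_pos finite_words]
  show ?thesis
  proof (intro conjI allI impI)
    show "inj_on (gvec \<Delta>) (words deg n)" "pmv.independent (gvec \<Delta> ` words deg n)" for n
      using independent_gvec by blast+
    show "fps_nth (fps_nth (lyndon_series deg) n) k =
          of_nat (pmv.dim {x \<in> homog deg n. hopf_power \<Delta> a x = scale_pm (of_nat a ^ k) x})"
      if "a \<ge> 2" for n k
      by (simp only: series dim_eigenspace[OF that])
  qed (rule eigenvector_gvec[OF a] gvec_eq_sum_keys gvec_eq_sym_word_plus_longer span_gvec series
      | erule (1) leads_to_of_nonneg | erule leads_to_tranclp_gvec)+
qed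

end
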